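(* Let $V$ be a finite-dimensional complex vector space with a Hermitian inner product, and let $K$ be a compact connected Lie group with Lie algebra $\mathfrak{k}$ acting on $V$ via a unitary representation, such that $(K,H_V)$ is a Gelfand pair (equivalently, the action of $K$ on $V$ is multiplicity-free). Let $\tau:V\to\mathfrak{k}^*$ be the moment map. If $\sigma\in\widehat{K}$ occurs in $\mathbb{C}[V]$, then the coadjoint orbit in $\mathfrak{k}^*$ corresponding to $\sigma$ is contained in $\tau(V)$.
   Context: Write the Hermitian inner product on $V$ (taken complex linear in the first variable) as $\langle\cdot,\cdot\rangle=(\cdot,\cdot)+i\,\omega(\cdot,\cdot)$, with $(\cdot,\cdot)$ and $\omega$ its real and imaginary parts. The Heisenberg group is $H_V=V\times\mathbb{R}$ with product $(z,t)(z',t')=(z+z',\,t+t'-\tfrac12\omega(z,z'))$, on which $K$ acts by $k\cdot(z,t)=(kz,t)$; $(K,H_V)$ is a Gelfand pair when the convolution algebra $L^1_K(H_V)$ of integrable $K$-invariant functions on $H_V$ is commutative. $\mathbb{C}[V]$ is the algebra of (holomorphic) polynomial functions on the complex vector space $V$, with $K$ acting by $(k\cdot p)(z)=p(k^{-1}z)$. The action of $K$ on $V$ is multiplicity-free if each irreducible representation of $K$ occurs at most once in $\mathbb{C}[V]$; this is known to be equivalent to $(K,H_V)$ being a Gelfand pair. The (unnormalized) moment map $\tau:V\to\mathfrak{k}^*$ is $\tau(z)(A)=\omega(z,Az)$ for $z\in V$, $A\in\mathfrak{k}$, where $(A,z)\mapsto Az$ is the derived action. $\widehat{K}$ is the set of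 equivalence classes of irreducible unitary representations of $K$. The Orbit Method correspondence between $\widehat{K}$ and integral coadjoint orbits in $\mathfrak{k}^*$ is the highest weight one (without $\rho$-shift): fix a maximal torus $T\subset K$ with Lie algebra $\mathfrak{t}$ and a positive root system; if $\sigma$ has highest weight with differential $\Lambda:\mathfrak{t}\to i\mathbb{R}$, let $\alpha\in\mathfrak{k}^*$ be the real functional with $\Lambda=i\,\alpha|_{\mathfrak{t}}$ and $\alpha=0$ on the orthogonal complement of $\mathfrak{t}$ in $\mathfrak{k}$ with respect to an $\mathrm{Ad}(K)$-invariant inner product; the orbit corresponding to $\sigma$ is $\mathrm{Ad}^*(K)\alpha$. *)

theory Defs
  imports "HOL-Analysis.Analysis" "HOL-Algebra.Group"
begin

text \<open>Unlike \<^class>\<open>euclidean_space\<close>, the following class admits the zero-dimensional space.\<close>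

class finite_dim_inner = real_inner +
  assumes finite_dim: "\<exists>B. finite B \<and> (\<forall>x. \<exists>r. x = (\<Sum>b\<in>B. r b *\<^sub>R b))"

instance euclidean_space \<subseteq> finite_dim_inner
proof
  show "\<exists>B. finite B \<and> (\<forall>x::'a. \<exists>r. x = (\<Sum>b\<in>B. r b *\<^sub>R b))"
    by (rule exI[of _ Basis]) (metis euclidean_representation finite_Basis)
qed

class hermitian_space = finite_dim_inner +
  fixes scaleC :: "complex \<Rightarrow> 'a \<Rightarrow> 'a" (infixr \<open>*\<^sub>C\<close> 75)
    and cinner :: "'a \<Rightarrow> 'a \<Rightarrow> complex"
  assumes scaleC_add_right: "a *\<^sub>C (x + y) = a *\<^sub>C x + a *\<^sub>C y"
    and scaleC_add_left: "(a + b) *\<^sub>C x = a *\<^sub>C x + b *\<^sub>C x"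
    and scaleC_scaleC: "a *\<^sub>C (b *\<^sub>C x) = (a * b) *\<^sub>C x"
    and scaleC_of_real: "complex_of_real r *\<^sub>C x = r *\<^sub>R x"
    and cinner_add_left: "cinner (x + y) z = cinner x z + cinner y z"
    and cinner_scaleC_left: "cinner (a *\<^sub>C x) y = a * cinner x y"
    and cinner_commute: "cinner x y = cnj (cinner y x)"
    and inner_eq_Re_cinner: "inner x y = Re (cinner x y)"

definition omega :: "'v::hermitian_space \<Rightarrow> 'v \<Rightarrow> real" where
  "omega z w = Im (cinner z w)"

definition clinear_map :: "('v::hermitian_space \<Rightarrow> 'w::hermitian_space) \<Rightarrow> bool" where
  "clinear_map f \<longleftrightarrow> (\<forall>x y. f (x + y) = f x + f y) \<and> (\<forall>a x. f (a *\<^sub>C x) = a *\<^sub>C f x)"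

definition clinear_form :: "('v::hermitian_space \<Rightarrow> complex) \<Rightarrow> bool" where
  "clinear_form f \<longleftrightarrow> (\<forall>x y. f (x + y) = f x + f y) \<and> (\<forall>a x. f (a *\<^sub>C x) = a * f x)"

definition csubspace :: "'v::hermitian_space set \<Rightarrow> bool" where
  "csubspace S \<longleftrightarrow> subspace S \<and> (\<forall>a. \<forall>x\<in>S. a *\<^sub>C x \<in> S)"

inductive_set polynomial_functions :: "('v::hermitian_space \<Rightarrow> complex) set" where
  const: "(\<lambda>z. a) \<in> polynomial_functions"
| form: "clinear_form f \<Longrightarrow> f \<in> polynomial_functions"
| add: "p \<in> polynomial_functions \<Longrightarrow> q \<in> polynomial_functions \<Longrightarrow>
    (\<lambda>z. p z + q z) \<in> polynomial_functions"
| mult: "p \<in> polynomial_functions \<Longrightarrow> q \<in> polynomial_functions \<Longrightarrow>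
    (\<lambda>z. p z * q z) \<in> polynomial_functions"

text \<open>\<open>Ck_on k S f\<close> is meant for open subsets \<open>S\<close> of finite-dimensional spaces, where it
  says that \<open>f\<close> is \<open>k\<close> times continuously differentiable on \<open>S\<close>: all iterated
  directional derivatives of order at most \<open>k\<close> exist and are continuous.\<close>

primrec Ck_on ::
  "nat \<Rightarrow> 'a::real_normed_vector set \<Rightarrow> ('a \<Rightarrow> 'b::real_normed_vector) \<Rightarrow> bool" where
  "Ck_on 0 S f \<longleftrightarrow> continuous_on S f"
| "Ck_on (Suc k) S f \<longleftrightarrow>
    (\<forall>x\<in>S. f differentiable (at x)) \<and>
    (\<forall>v. Ck_on k S (\<lambda>x. frechet_derivative f (at x) v))"

definition smooth_on ::
  "'a::real_normed_vector set \<Rightarrow> ('a \<Rightarrow> 'b::real_normed_vector) \<Rightarrow> bool" where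
  "smooth_on S f \<longleftrightarrow> (\<forall>k. Ck_on k S f)"

type_synonym ('k, 'e) chart = "'k set \<times> ('k \<Rightarrow> 'e)"

definition chart_inv :: "('k, 'e) chart \<Rightarrow> 'e \<Rightarrow> 'k" where
  "chart_inv c = inv_into (fst c) (snd c)"

definition chart_image :: "('k, 'e) chart \<Rightarrow> 'e set" where
  "chart_image c = snd c ` fst c"

text \<open>The carrier of the group is topologised as a subspace of the ambient Hausdorff space.
  Second countability is not demanded; it is automatic for compact groups.\<close>

locale lie_group = group G
  for G :: "('k::t2_space, 'm) monoid_scheme" (structure) +
  fixes atlas :: "('k, 'e::finite_dim_inner) chart set"
  assumes atlas_cover: "(\<Union>c\<in>atlas. fst c) = carrier G"
    and chart_domain: "c \<in> atlas \<Longrightarrow> openin (top_of_set (carrier G)) (fst c)"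
    and chart_open: "c \<in> atlas \<Longrightarrow> open (chart_image c)"
    and chart_homeomorphism:
      "c \<in> atlas \<Longrightarrow> homeomorphism (fst c) (chart_image c) (snd c) (chart_inv c)"
    and chart_compatible: "c \<in> atlas \<Longrightarrow> d \<in> atlas \<Longrightarrow>
      smooth_on (snd c ` (fst c \<inter> fst d)) (snd d \<circ> chart_inv c)"
    and continuous_mult:
      "continuous_on (carrier G \<times> carrier G) (\<lambda>(g, h). g \<otimes> h)"
    and continuous_inv: "continuous_on (carrier G) (\<lambda>g. inv g)"
    and smooth_mult: "a \<in> atlas \<Longrightarrow> b \<in> atlas \<Longrightarrow> c \<in> atlas \<Longrightarrow>
      smooth_on {p \<in> chart_image a \<times> chart_image b.
          chart_inv a (fst p) \<otimes> chart_inv b (snd p) \<in> fst c}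
        (\<lambda>p. snd c (chart_inv a (fst p) \<otimes> chart_inv b (snd p)))"
    and smooth_inv: "a \<in> atlas \<Longrightarrow> c \<in> atlas \<Longrightarrow>
      smooth_on {x \<in> chart_image a. inv (chart_inv a x) \<in> fst c}
        (\<lambda>x. snd c (inv (chart_inv a x)))"

text \<open>The Lie algebra is the tangent space at the identity. A chart \<open>c\<close> around the identity
  identifies it with the model space \<open>'e\<close>, a curve \<open>\<gamma>\<close> through the identity having
  as tangent vector the derivative of \<open>snd c \<circ> \<gamma>\<close>.\<close>

definition one_parameter_subgroup ::
  "('k::t2_space, 'm) monoid_scheme \<Rightarrow> (real \<Rightarrow> 'k) \<Rightarrow> bool" where
  "one_parameter_subgroup G \<gamma> \<longleftrightarrow>
    range \<gamma> \<subseteq> carrier G \<and> continuous_on UNIV \<gamma> \<and> (\<forall>s t. \<gamma> (s + t) = \<gamma> s \<otimes>\<^bsub>G\<^esub> \<gamma> t)"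

definition lie_exp ::
  "('k::t2_space, 'm) monoid_scheme \<Rightarrow> ('k, 'e::finite_dim_inner) chart \<Rightarrow> 'e \<Rightarrow> 'k" where
  "lie_exp G c A = (THE g. \<exists>\<gamma>. one_parameter_subgroup G \<gamma> \<and>
      ((snd c \<circ> \<gamma>) has_vector_derivative A) (at 0) \<and> g = \<gamma> 1)"

definition Ad ::
  "('k::t2_space, 'm) monoid_scheme \<Rightarrow> ('k, 'e::finite_dim_inner) chart \<Rightarrow> 'k \<Rightarrow> 'e \<Rightarrow> 'e" where
  "Ad G c g A = frechet_derivative
      (\<lambda>x. snd c (g \<otimes>\<^bsub>G\<^esub> chart_inv c x \<otimes>\<^bsub>G\<^esub> inv\<^bsub>G\<^esub> g)) (at (snd c \<one>\<^bsub>G\<^esub>)) A"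

definition coadjoint ::
  "('k::t2_space, 'm) monoid_scheme \<Rightarrow> ('k, 'e::finite_dim_inner) chart \<Rightarrow>
    'k \<Rightarrow> ('e \<Rightarrow> real) \<Rightarrow> 'e \<Rightarrow> real" where
  "coadjoint G c g \<xi> = (\<lambda>A. \<xi> (Ad G c (inv\<^bsub>G\<^esub> g) A))"

definition coadjoint_orbit ::
  "('k::t2_space, 'm) monoid_scheme \<Rightarrow> ('k, 'e::finite_dim_inner) chart \<Rightarrow>
    ('e \<Rightarrow> real) \<Rightarrow> ('e \<Rightarrow> real) set" where
  "coadjoint_orbit G c \<xi> = {coadjoint G c g \<xi> | g. g \<in> carrier G}"

definition Ad_invariant_inner ::
  "('k::t2_space, 'm) monoid_scheme \<Rightarrow> ('k, 'e::finite_dim_inner) chart \<Rightarrow>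
    ('e \<Rightarrow> 'e \<Rightarrow> real) \<Rightarrow> bool" where
  "Ad_invariant_inner G c B \<longleftrightarrow>
    (\<forall>X. linear (B X)) \<and> (\<forall>X Y. B X Y = B Y X) \<and> (\<forall>X. X \<noteq> 0 \<longrightarrow> B X X > 0) \<and>
    (\<forall>g\<in>carrier G. \<forall>X Y. B (Ad G c g X) (Ad G c g Y) = B X Y)"

definition unitary_rep ::
  "('k::t2_space, 'm) monoid_scheme \<Rightarrow> ('k \<Rightarrow> 'v::hermitian_space \<Rightarrow> 'v) \<Rightarrow> bool" where
  "unitary_rep G \<rho> \<longleftrightarrow>
    (\<forall>g\<in>carrier G. clinear_map (\<rho> g) \<and> (\<forall>z w. cinner (\<rho> g z) (\<rho> g w) = cinner z w)) \<and>
    (\<forall>z. \<rho> \<one>\<^bsub>G\<^esub> z = z) \<and>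
    (\<forall>g\<in>carrier G. \<forall>h\<in>carrier G. \<forall>z. \<rho> (g \<otimes>\<^bsub>G\<^esub> h) z = \<rho> g (\<rho> h z)) \<and>
    (\<forall>z. continuous_on (carrier G) (\<lambda>g. \<rho> g z))"

definition irreducible_unitary_rep ::
  "('k::t2_space, 'm) monoid_scheme \<Rightarrow> ('k \<Rightarrow> 'w::hermitian_space \<Rightarrow> 'w) \<Rightarrow> bool" where
  "irreducible_unitary_rep G \<sigma> \<longleftrightarrow>
    unitary_rep G \<sigma> \<and> (\<exists>w::'w. w \<noteq> 0) \<and>
    (\<forall>S. csubspace S \<and> (\<forall>g\<in>carrier G. \<sigma> g ` S \<subseteq> S) \<longrightarrow> S = {0} \<or> S = UNIV)"

definition occurs_in_polynomials ::
  "('k::t2_space, 'm) monoid_scheme \<Rightarrow> ('k \<Rightarrow> 'v::hermitian_space \<Rightarrow> 'v) \<Rightarrow>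
    ('k \<Rightarrow> 'w::hermitian_space \<Rightarrow> 'w) \<Rightarrow> bool" where
  "occurs_in_polynomials G \<rho> \<sigma> \<longleftrightarrow>
    (\<exists>\<Phi> :: 'w \<Rightarrow> 'v \<Rightarrow> complex.
      range \<Phi> \<subseteq> polynomial_functions \<and> inj \<Phi> \<and>
      (\<forall>v w z. \<Phi> (v + w) z = \<Phi> v z + \<Phi> w z) \<and>
      (\<forall>a w z. \<Phi> (a *\<^sub>C w) z = a * \<Phi> w z) \<and>
      (\<forall>g\<in>carrier G. \<forall>w z. \<Phi> (\<sigma> g w) z = \<Phi> w (\<rho> (inv\<^bsub>G\<^esub> g) z)))"

definition derived_rep ::
  "('k::t2_space, 'm) monoid_scheme \<Rightarrow> ('k, 'e::finite_dim_inner) chart \<Rightarrow>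
    ('k \<Rightarrow> 'v::hermitian_space \<Rightarrow> 'v) \<Rightarrow> 'e \<Rightarrow> 'v \<Rightarrow> 'v" where
  "derived_rep G c \<rho> A z = vector_derivative (\<lambda>s. \<rho> (lie_exp G c (s *\<^sub>R A)) z) (at 0)"

definition moment_map ::
  "('k::t2_space, 'm) monoid_scheme \<Rightarrow> ('k, 'e::finite_dim_inner) chart \<Rightarrow>
    ('k \<Rightarrow> 'v::hermitian_space \<Rightarrow> 'v) \<Rightarrow> 'v \<Rightarrow> 'e \<Rightarrow> real" where
  "moment_map G c \<rho> z = (\<lambda>A. omega z (derived_rep G c \<rho> A z))"

definition torus_in :: "('k::t2_space, 'm) monoid_scheme \<Rightarrow> 'k set \<Rightarrow> bool" where
  "torus_in G T \<longleftrightarrow> subgroup T G \<and> compact T \<and> connected T \<and>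
    (\<forall>g\<in>T. \<forall>h\<in>T. g \<otimes>\<^bsub>G\<^esub> h = h \<otimes>\<^bsub>G\<^esub> g)"

definition maximal_torus :: "('k::t2_space, 'm) monoid_scheme \<Rightarrow> 'k set \<Rightarrow> bool" where
  "maximal_torus G T \<longleftrightarrow> torus_in G T \<and> (\<forall>T'. torus_in G T' \<and> T \<subseteq> T' \<longrightarrow> T' = T)"

definition subgroup_lie_algebra ::
  "('k::t2_space, 'm) monoid_scheme \<Rightarrow> ('k, 'e::finite_dim_inner) chart \<Rightarrow> 'k set \<Rightarrow> 'e set" where
  "subgroup_lie_algebra G c T = {A. \<forall>s. lie_exp G c (s *\<^sub>R A) \<in> T}"

text \<open>A pair \<open>(A, B)\<close> stands for the element \<open>A + iB\<close> of the complexified Lie algebra.\<close>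

definition complexified_scale ::
  "complex \<Rightarrow> 'e::real_vector \<times> 'e \<Rightarrow> 'e \<times> 'e" where
  "complexified_scale a X =
    (Re a *\<^sub>R fst X - Im a *\<^sub>R snd X, Im a *\<^sub>R fst X + Re a *\<^sub>R snd X)"

definition complexified_derived_rep ::
  "('k::t2_space, 'm) monoid_scheme \<Rightarrow> ('k, 'e::finite_dim_inner) chart \<Rightarrow>
    ('k \<Rightarrow> 'v::hermitian_space \<Rightarrow> 'v) \<Rightarrow> 'e \<times> 'e \<Rightarrow> 'v \<Rightarrow> 'v" where
  "complexified_derived_rep G c \<rho> X z =
    derived_rep G c \<rho> (fst X) z + \<i> *\<^sub>C derived_rep G c \<rho> (snd X) z"

text \<open>Weights and roots are written multiplicatively, as characters of the torus \<open>T\<close>; they are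
  made \<^const>\<open>extensional\<close> so that equality of characters is equality of functions. The root
  spaces are those of the complexified adjoint action of \<open>T\<close>; a function admitting a nonzero
  root space is necessarily a continuous character.\<close>

definition root_space ::
  "('k::t2_space, 'm) monoid_scheme \<Rightarrow> ('k, 'e::finite_dim_inner) chart \<Rightarrow> 'k set \<Rightarrow>
    ('k \<Rightarrow> complex) \<Rightarrow> ('e \<times> 'e) set" where
  "root_space G c T \<theta> =
    {X. \<forall>h\<in>T. (Ad G c h (fst X), Ad G c h (snd X)) = complexified_scale (\<theta> h) X}"

definition roots ::
  "('k::t2_space, 'm) monoid_scheme \<Rightarrow> ('k, 'e::finite_dim_inner) chart \<Rightarrow> 'k set \<Rightarrow>
    ('k \<Rightarrow> complex) set" where
  "roots G c T = {\<theta> \<in> extensional T. (\<exists>h\<in>T. \<theta> h \<noteq> 1) \<and> (\<exists>X\<in>root_space G c T \<theta>. X \<noteq> 0)}"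

definition positive_system ::
  "('k::t2_space, 'm) monoid_scheme \<Rightarrow> ('k, 'e::finite_dim_inner) chart \<Rightarrow> 'k set \<Rightarrow>
    ('k \<Rightarrow> complex) set \<Rightarrow> bool" where
  "positive_system G c T P \<longleftrightarrow> P \<subseteq> roots G c T \<and>
    (\<forall>\<theta>\<in>roots G c T. \<theta> \<in> P \<longleftrightarrow> restrict (\<lambda>h. inverse (\<theta> h)) T \<notin> P) \<and>
    (\<forall>\<theta>\<in>P. \<forall>\<psi>\<in>P. restrict (\<lambda>h. \<theta> h * \<psi> h) T \<in> roots G c T \<longrightarrow>
      restrict (\<lambda>h. \<theta> h * \<psi> h) T \<in> P)"

definition highest_weight ::
  "('k::t2_space, 'm) monoid_scheme \<Rightarrow> ('k, 'e::finite_dim_inner) chart \<Rightarrow> 'k set \<Rightarrow>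
    ('k \<Rightarrow> complex) set \<Rightarrow> ('k \<Rightarrow> 'w::hermitian_space \<Rightarrow> 'w) \<Rightarrow> ('k \<Rightarrow> complex) \<Rightarrow> bool" where
  "highest_weight G c T P \<sigma> \<mu> \<longleftrightarrow> \<mu> \<in> extensional T \<and>
    (\<exists>v. v \<noteq> 0 \<and> (\<forall>h\<in>T. \<sigma> h v = \<mu> h *\<^sub>C v) \<and>
      (\<forall>\<theta>\<in>P. \<forall>X\<in>root_space G c T \<theta>. complexified_derived_rep G c \<sigma> X v = 0))"

definition weight_differential ::
  "('k::t2_space, 'm) monoid_scheme \<Rightarrow> ('k, 'e::finite_dim_inner) chart \<Rightarrow>
    ('k \<Rightarrow> complex) \<Rightarrow> 'e \<Rightarrow> complex" where
  "weight_differential G c \<mu> A = vector_derivative (\<lambda>s. \<mu> (lie_exp G c (s *\<^sub>R A))) (at 0)"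

text \<open>The orbit method correspondence (without \<open>\<rho>\<close>-shift) for a fixed maximal torus \<open>T\<close>,
  positive system \<open>P\<close> and \<open>Ad\<close>-invariant inner product \<open>B\<close>. As a relation it does not
  presuppose the existence and uniqueness of the highest weight.\<close>

definition orbit_corresponds ::
  "('k::t2_space, 'm) monoid_scheme \<Rightarrow> ('k, 'e::finite_dim_inner) chart \<Rightarrow> 'k set \<Rightarrow>
    ('k \<Rightarrow> complex) set \<Rightarrow> ('e \<Rightarrow> 'e \<Rightarrow> real) \<Rightarrow> ('k \<Rightarrow> 'w::hermitian_space \<Rightarrow> 'w) \<Rightarrow>
    ('e \<Rightarrow> real) set \<Rightarrow> bool" where
  "orbit_corresponds G c T P B \<sigma> \<O> \<longleftrightarrow>
    (\<exists>\<mu> \<alpha>. highest_weight G c T P \<sigma> \<mu> \<and> linear \<alpha> \<and>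
      (\<forall>A\<in>subgroup_lie_algebra G c T.
        weight_differential G c \<mu> A = \<i> * complex_of_real (\<alpha> A)) \<and>
      (\<forall>X. (\<forall>A\<in>subgroup_lie_algebra G c T. B X A = 0) \<longrightarrow> \<alpha> X = 0) \<and>
      \<O> = coadjoint_orbit G c \<alpha>)"

definition heisenberg :: "('v::hermitian_space \<times> real) monoid" where
  "heisenberg = \<lparr>carrier = UNIV,
    monoid.mult = (\<lambda>(z, t) (z', t'). (z + z', t + t' - omega z z' / 2)), one = (0, 0)\<rparr>"

lemma group_heisenberg: "group (heisenberg :: ('v::hermitian_space \<times> real) monoid)"
proof (rule groupI)
  have add: "omega z (w + w') = omega z w + omega z w'"
    "omega (w + w') z = omega w z + omega w' z" for z w w' :: 'v
    by (metis omega_def cinner_add_left cinner_commute complex_cnj_add plus_complex.sel(2))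
       (simp add: omega_def cinner_add_left)
  have zero: "omega 0 z = 0" "omega z 0 = 0" for z :: 'v
    using add(1)[of z 0 0] add(2)[of 0 0 z] by simp_all
  have self: "omega z z = 0" for z :: 'v
    using arg_cong[OF cinner_commute[of z z], of Im] by (simp add: omega_def)
  have neg: "omega (- z) z = 0" for z :: 'v
    using add(2)[of "- z" z z] zero self[of z] by simp
  fix x y z :: "'v \<times> real"
  show "x \<otimes>\<^bsub>heisenberg\<^esub> y \<otimes>\<^bsub>heisenberg\<^esub> z = x \<otimes>\<^bsub>heisenberg\<^esub> (y \<otimes>\<^bsub>heisenberg\<^esub> z)"
    by (simp add: heisenberg_def split_beta add field_simps)
  show "\<one>\<^bsub>heisenberg\<^esub> \<otimes>\<^bsub>heisenberg\<^esub> x = x"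
    by (simp add: heisenberg_def split_beta zero)
  have "(- fst x, - snd x) \<otimes>\<^bsub>heisenberg\<^esub> x = \<one>\<^bsub>heisenberg\<^esub>"
    by (simp add: heisenberg_def split_beta neg)
  then show "\<exists>y\<in>carrier heisenberg. y \<otimes>\<^bsub>heisenberg\<^esub> x = \<one>\<^bsub>heisenberg\<^esub>"
    by (rule bexI) (simp add: heisenberg_def)
qed (simp_all add: heisenberg_def)

definition left_haar_measure ::
  "('h::topological_space, 'm) monoid_scheme \<Rightarrow> 'h measure \<Rightarrow> bool" where
  "left_haar_measure H M \<longleftrightarrow> carrier H = UNIV \<and> sets M = sets borel \<and>
    emeasure M UNIV \<noteq> 0 \<and> (\<forall>C. compact C \<longrightarrow> emeasure M C < \<infinity>) \<and>
    (\<forall>x. \<forall>S\<in>sets borel. emeasure M ((\<lambda>y. x \<otimes>\<^bsub>H\<^esub> y) ` S) = emeasure M S)"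

definition convolution ::
  "('h, 'm) monoid_scheme \<Rightarrow> 'h measure \<Rightarrow> ('h \<Rightarrow> complex) \<Rightarrow> ('h \<Rightarrow> complex) \<Rightarrow> 'h \<Rightarrow> complex" where
  "convolution H M f g x = (\<integral>y. f y * g (inv\<^bsub>H\<^esub> y \<otimes>\<^bsub>H\<^esub> x) \<partial>M)"

definition invariant_L1 ::
  "('k::t2_space, 'm) monoid_scheme \<Rightarrow> ('k \<Rightarrow> 'v::hermitian_space \<Rightarrow> 'v) \<Rightarrow>
    ('v \<times> real) measure \<Rightarrow> ('v \<times> real \<Rightarrow> complex) set" where
  "invariant_L1 G \<rho> M = {f. integrable M f \<and>
    (\<forall>g\<in>carrier G. AE x in M. f (\<rho> g (fst x), snd x) = f x)}"

definition gelfand_pair ::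
  "('k::t2_space, 'm) monoid_scheme \<Rightarrow> ('k \<Rightarrow> 'v::hermitian_space \<Rightarrow> 'v) \<Rightarrow> bool" where
  "gelfand_pair G \<rho> \<longleftrightarrow>
    (\<exists>M. left_haar_measure (heisenberg :: ('v \<times> real) monoid) M \<and>
      (\<forall>f\<in>invariant_L1 G \<rho> M. \<forall>g\<in>invariant_L1 G \<rho> M.
        AE x in M. convolution heisenberg M f g x = convolution heisenberg M g f x))"

end

theory Submission
  imports Defs
begin

text \<open>The proof is variational. Let \<open>f = \<Phi> v\<close> be the polynomial on \<open>V\<close> to which an equivariant
embedding \<open>\<Phi>\<close> of \<open>\<sigma>\<close> sends a highest weight vector \<open>v\<close>, and let \<open>z\<close> be a point where
\<open>|f|\<^sup>2 exp (-|z|\<^sup>2)\<close> is maximal. Since \<open>f\<close> is holomorphic, vanishing of the derivative there says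
\<open>Df(z) w = \<langle>w, z\<rangle> f(z)\<close> for every direction \<open>w\<close>. Choose \<open>w = Az\<close> with \<open>A\<close> in the Lie algebra:
equivariance turns the left hand side into minus the value at \<open>z\<close> of \<open>A\<close> acting on \<open>f\<close>, and
by complex linearity the same holds for \<open>A\<close> in the complexified Lie algebra. On the Lie algebra
of the torus, \<open>f\<close> is an eigenvector with eigenvalue \<open>i \<alpha>\<close>, and one reads off \<open>\<tau>(z) = \<alpha>\<close> there.
A positive root vector \<open>X\<close> kills \<open>f\<close>, so \<open>\<langle>Xz, z\<rangle> = 0\<close>; as the Lie algebra acts by skew-Hermitian
operators, \<open>\<tau>(z)\<close> vanishes on the real and imaginary parts of \<open>X\<close>, hence also on those of the
conjugate vector, which belongs to the negative root. There \<open>\<alpha>\<close> vanishes too, because root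
vectors are orthogonal to the torus. The torus and the root vectors span, so \<open>\<tau>(z) = \<alpha>\<close>, and
equivariance of \<open>\<tau>\<close> carries the whole coadjoint orbit of \<open>\<alpha>\<close> into the image. This is
\<open>highest_weight_in_moment_image\<close> together with \<open>orbit_subset_moment_image\<close>.

Three facts about a compact Lie group \<open>K\<close> and a continuous unitary representation \<open>\<rho>\<close> make this
argument meaningful, and they take up most of the text. The first two start from the expansion of
the product to second order in a chart around the identity (\<open>ex_local_law\<close>): up to an error that
is quadratic in a Lipschitz sense, multiplication is addition of coordinates.

 \<^item> Each tangent vector \<open>A\<close> is the velocity of exactly one one-parameter subgroup. If \<open>g\<^sub>n\<close> has
 coordinates \<open>A/n\<close>, any pointwise cluster point of the step functions sending \<open>t\<close> to the power of
 \<open>g\<^sub>n\<close> with exponent \<open>\<lfloor>nt\<rfloor>\<close> is such a subgroup, and compactness provides one. It is unique because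
 squaring nearly doubles distances near the identity while the two candidates are tangent.

 \<^item> The derived representation is linear in the Lie algebra element. A group element at
 distance \<open>d\<close> from the identity needs about \<open>1/d\<close> multiplications to leave a fixed neighbourhood on
 which \<open>\<rho>\<close> is close to the identity, so \<open>\<rho>\<close> moves vectors by at most a multiple of \<open>d\<close>. Hence
 the derivative of \<open>\<rho>\<close> along a curve depends only on the tangent vector of the curve, and the
 product of two one-parameter subgroups is tangent to the one for the sum.

 \<^item> A functional that vanishes on the Lie algebra of a maximal torus and on all root vectors is
 zero. Otherwise a nonzero subspace orthogonal to all of these is invariant under the torus, and
 its complexification contains a joint eigenvector. That vector is either a root vector or fixed
 by the torus, and a fixed vector is in the Lie algebra of the torus by maximality.\<close>

section \<open>Finite-dimensional inner product spaces\<close>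

text \<open>With expansions in an orthogonal family, coordinates are bounded linear functionals. Local
compactness, boundedness of linear maps and closedness of subspaces all reduce to this.\<close>

lemma finite_orthogonal_spanning:
  fixes S :: "'a::finite_dim_inner set"
  obtains C where "finite C" "pairwise orthogonal C" "0 \<notin> C" "span C = span S"
proof -
  obtain B :: "'a set" where B: "finite B" "\<forall>x. \<exists>r. x = (\<Sum>b\<in>B. r b *\<^sub>R b)"
    using finite_dim by blast
  have "x \<in> span B" for x
  proof -
    obtain r where "x = (\<Sum>b\<in>B. r b *\<^sub>R b)" using B(2) by blast
    then show ?thesis by (simp add: span_sum span_scale span_base)
  qed
  then have "S \<subseteq> span B" by blast
  obtain I where I: "I \<subseteq> S" "independent I" "S \<subseteq> span I"
    using real_vector.maximal_independent_subset by blast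
  have "finite I"
    using real_vector.independent_span_bound[OF B(1) I(2)] I(1) \<open>S \<subseteq> span B\<close> by blast
  then obtain C where C: "finite C" "span C = span I" "pairwise orthogonal C"
    using basis_orthogonal by blast
  have "span I = span S"
    using I by (metis dual_order.eq_iff span_mono span_span)
  then show ?thesis
    using C by (intro that[of "C - {0}"]) (auto intro: pairwise_mono simp: pairwise_def)
qed

lemma orthogonal_expansion:
  assumes "finite C" "pairwise orthogonal C" "0 \<notin> C" "x \<in> span C"
  shows "x = (\<Sum>c\<in>C. (inner x c / inner c c) *\<^sub>R c)"
proof -
  obtain r where r: "x = (\<Sum>c\<in>C. r c *\<^sub>R c)"
    using assms(1,4) by (auto simp: span_finite)
  have "inner x c = r c * inner c c" if "c \<in> C" for c
  proof -
    have "inner x c = (\<Sum>d\<in>C. r d * inner d c)" by (simp add: r inner_sum_left)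
    also have "\<dots> = (\<Sum>d\<in>C. if d = c then r c * inner c c else 0)"
      using assms(2) that by (intro sum.cong) (auto simp: pairwise_def orthogonal_def)
    finally show ?thesis using assms(1) that by simp
  qed
  then have "(inner x c / inner c c) *\<^sub>R c = r c *\<^sub>R c" if "c \<in> C" for c
    using that assms(3) by auto
  then have "(\<Sum>c\<in>C. (inner x c / inner c c) *\<^sub>R c) = (\<Sum>c\<in>C. r c *\<^sub>R c)"
    by (intro sum.cong) simp_all
  also have "\<dots> = x" by (rule r[symmetric])
  finally show ?thesis by (rule sym)
qed

lemma orthogonal_basis:
  obtains C :: "'a::finite_dim_inner set" where "finite C" "0 \<notin> C"
    "\<And>x. x = (\<Sum>c\<in>C. (inner x c / inner c c) *\<^sub>R c)" "span C = UNIV"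
proof -
  obtain C :: "'a set" where C: "finite C" "pairwise orthogonal C" "0 \<notin> C" "span C = span UNIV"
    using finite_orthogonal_spanning by blast
  have "x = (\<Sum>c\<in>C. (inner x c / inner c c) *\<^sub>R c)" for x
    by (rule orthogonal_expansion) (use C in auto)
  then show ?thesis
    using C by (intro that[of C]) auto
qed

instance finite_dim_inner \<subseteq> heine_borel
proof
  fix f :: "nat \<Rightarrow> 'a"
  assume f: "bounded (range f)"
  obtain C :: "'a set" where C: "finite C" "0 \<notin> C"
    "\<And>x. x = (\<Sum>c\<in>C. (inner x c / inner c c) *\<^sub>R c)" "span C = UNIV"
    using orthogonal_basis by blast
  have bdd: "bounded ((\<lambda>x. inner x c) ` range f)" for c
    by (rule bounded_linear_image[OF f bounded_linear_inner_left])
  have "\<exists>r. strict_mono (r::nat\<Rightarrow>nat) \<and> (\<forall>c\<in>D. convergent (\<lambda>n. inner (f (r n)) c))"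
    if "finite D" for D
    using that
  proof (induction D)
    case empty
    show ?case by (intro exI[of _ id]) (simp add: strict_mono_def)
  next
    case (insert d D)
    then obtain r where r: "strict_mono (r::nat\<Rightarrow>nat)" "\<forall>c\<in>D. convergent (\<lambda>n. inner (f (r n)) c)"
      by blast
    have "bounded (range (\<lambda>n. inner (f (r n)) d))"
      by (rule bounded_subset[OF bdd[of d]]) auto
    then obtain l s where s: "strict_mono (s::nat\<Rightarrow>nat)" "((\<lambda>n. inner (f (r n)) d) \<circ> s) \<longlonglongrightarrow> l"
      using bounded_imp_convergent_subsequence by blast
    have "convergent (\<lambda>n. inner (f (r (s n))) c)" if "c \<in> D" for c
      using convergent_subseq_convergent[OF r(2)[rule_format, OF that] s(1)] by (simp add: o_def)
    moreover have "convergent (\<lambda>n. inner (f (r (s n))) d)"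
      using s(2) by (auto simp: convergent_def o_def)
    ultimately show ?case
      using strict_mono_o[OF r(1) s(1)] by (intro exI[of _ "r \<circ> s"]) (auto simp: o_def)
  qed
  then obtain r where r: "strict_mono (r::nat\<Rightarrow>nat)" "\<forall>c\<in>C. convergent (\<lambda>n. inner (f (r n)) c)"
    using C(1) by blast
  have "\<exists>l. \<forall>c\<in>C. (\<lambda>n. inner (f (r n)) c) \<longlonglongrightarrow> l c"
    using r(2) unfolding convergent_def by (rule bchoice)
  then obtain l where l: "\<forall>c\<in>C. (\<lambda>n. inner (f (r n)) c) \<longlonglongrightarrow> l c"
    by blast
  have "(\<lambda>n. \<Sum>c\<in>C. (inner (f (r n)) c / inner c c) *\<^sub>R c) \<longlonglongrightarrow> (\<Sum>c\<in>C. (l c / inner c c) *\<^sub>R c)"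
    using l C(2) by (intro tendsto_sum tendsto_scaleR tendsto_divide) auto
  moreover have "(\<lambda>n. \<Sum>c\<in>C. (inner (f (r n)) c / inner c c) *\<^sub>R c) = f \<circ> r"
    using C(3)[symmetric] by (intro ext) simp
  ultimately have "(f \<circ> r) \<longlonglongrightarrow> (\<Sum>c\<in>C. (l c / inner c c) *\<^sub>R c)"
    by simp
  then show "\<exists>l r. strict_mono (r::nat\<Rightarrow>nat) \<and> (f \<circ> r) \<longlonglongrightarrow> l"
    using r(1) by blast
qed

instance finite_dim_inner \<subseteq> banach ..

instance prod :: (finite_dim_inner, finite_dim_inner) finite_dim_inner
proof
  obtain B :: "'a set" where B: "finite B" "\<And>x. \<exists>r. x = (\<Sum>b\<in>B. r b *\<^sub>R b)"
    using finite_dim by blast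
  obtain C :: "'b set" where C: "finite C" "\<And>x. \<exists>r. x = (\<Sum>b\<in>C. r b *\<^sub>R b)"
    using finite_dim by blast
  let ?D = "(\<lambda>b. (b, 0)) ` B \<union> (\<lambda>b. (0, b)) ` C :: ('a \<times> 'b) set"
  have "(a, b) \<in> span ?D" for a b
  proof -
    obtain r s where rs: "a = (\<Sum>b\<in>B. r b *\<^sub>R b)" "b = (\<Sum>b\<in>C. s b *\<^sub>R b)"
      using B(2) C(2) by metis
    have "(\<Sum>b\<in>B. r b *\<^sub>R (b, 0)) + (\<Sum>b\<in>C. s b *\<^sub>R (0, b)) \<in> span ?D"
      by (intro span_add span_sum span_scale) (auto intro: span_base)
    also have "(\<Sum>b\<in>B. r b *\<^sub>R (b, 0)) + (\<Sum>b\<in>C. s b *\<^sub>R (0, b)) = (a, b)"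
      by (simp add: rs prod_eq_iff fst_sum snd_sum)
    finally show ?thesis .
  qed
  moreover have "finite ?D" using B(1) C(1) by simp
  ultimately have "\<forall>x. \<exists>r. x = (\<Sum>b\<in>?D. r b *\<^sub>R b)"
    by (auto simp: span_finite)
  then show "\<exists>B. finite B \<and> (\<forall>x::'a \<times> 'b. \<exists>r. x = (\<Sum>b\<in>B. r b *\<^sub>R b))"
    using \<open>finite ?D\<close> by blast
qed

text \<open>The constants \<open>k\<close> do not depend on \<open>f\<close>, so that bounds on finitely many vectors bound whole
families of linear maps uniformly.\<close>

lemma linear_bounded_on_orthogonal_basis:
  obtains C :: "'a::finite_dim_inner set" and k :: "'a \<Rightarrow> real" where "finite C"
    "\<And>c. c \<in> C \<Longrightarrow> 0 \<le> k c"
    "\<And>f :: 'a \<Rightarrow> 'b::real_normed_vector. \<And>x. linear f \<Longrightarrow> norm (f x) \<le> (\<Sum>c\<in>C. k c * norm (f c)) * norm x"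
proof -
  obtain C :: "'a set" where C: "finite C" "0 \<notin> C"
    "\<And>x. x = (\<Sum>c\<in>C. (inner x c / inner c c) *\<^sub>R c)" "span C = UNIV"
    using orthogonal_basis by blast
  have "norm (f x) \<le> (\<Sum>c\<in>C. (1 / norm c) * norm (f c)) * norm x" if "linear f" for f :: "'a \<Rightarrow> 'b" and x
  proof -
    have "f x = f (\<Sum>c\<in>C. (inner x c / inner c c) *\<^sub>R c)" using C(3) by metis
    also have "\<dots> = (\<Sum>c\<in>C. (inner x c / inner c c) *\<^sub>R f c)"
      by (simp add: linear_sum[OF that] linear_scale[OF that])
    also have "norm \<dots> \<le> (\<Sum>c\<in>C. (1 / norm c) * norm (f c) * norm x)"
    proof (rule sum_norm_le)
      fix c assume "c \<in> C"
      then have nz: "norm c > 0" using C(2) by auto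
      have "\<bar>inner x c\<bar> / (norm c * norm c) \<le> (norm x * norm c) / (norm c * norm c)"
        by (intro divide_right_mono Cauchy_Schwarz_ineq2) auto
      also have "\<dots> = norm x / norm c" using nz by simp
      finally have "\<bar>inner x c\<bar> / inner c c \<le> norm x / norm c"
        by (simp add: power2_norm_eq_inner[symmetric] power2_eq_square)
      then have "\<bar>inner x c\<bar> / inner c c * norm (f c) \<le> norm x / norm c * norm (f c)"
        by (rule mult_right_mono) simp
      then show "norm ((inner x c / inner c c) *\<^sub>R f c) \<le> (1 / norm c) * norm (f c) * norm x"
        by (simp add: mult_ac)
    qed
    finally show ?thesis by (simp add: sum_distrib_right)
  qed
  then show ?thesis using C(1) by (intro that[of C "\<lambda>c. 1 / norm c"]) auto
qed

lemma linear_imp_bounded_linear: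
  fixes f :: "'a::finite_dim_inner \<Rightarrow> 'b::real_normed_vector"
  assumes "linear f" shows "bounded_linear f"
proof -
  obtain C k where "\<And>f :: 'a \<Rightarrow> 'b. \<And>x. linear f \<Longrightarrow> norm (f x) \<le> (\<Sum>c\<in>C. k c * norm (f c)) * norm x"
    using linear_bounded_on_orthogonal_basis by metis
  then show ?thesis
    using assms by (intro bounded_linear_intro[where K = "\<Sum>c\<in>C. k c * norm (f c)"])
       (auto simp: linear_add linear_scale mult_ac)
qed

lemma closed_finite_dim_subspace:
  fixes S :: "'a::finite_dim_inner set"
  assumes "subspace S" shows "closed S"
proof -
  obtain C where C: "finite C" "pairwise orthogonal C" "0 \<notin> C" "span C = span S"
    using finite_orthogonal_spanning by blast
  then have sp: "span C = S" using assms by (simp add: span_eq_iff)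
  have "S = {x. x = (\<Sum>c\<in>C. (inner x c / inner c c) *\<^sub>R c)}"
  proof (safe)
    fix x assume "x \<in> S" then show "x = (\<Sum>c\<in>C. (inner x c / inner c c) *\<^sub>R c)"
      using orthogonal_expansion C(1-3) sp by blast
  next
    fix x assume "x = (\<Sum>c\<in>C. (inner x c / inner c c) *\<^sub>R c)"
    also have "\<dots> \<in> span C" by (intro span_sum span_scale span_base)
    finally show "x \<in> S" using sp by simp
  qed
  moreover have "closed {x. x = (\<Sum>c\<in>C. (inner x c / inner c c) *\<^sub>R c)}"
    using C(3) by (intro closed_Collect_eq continuous_intros) auto
  ultimately show ?thesis by simp
qed

text \<open>The dimension theory of \<^locale>\<open>finite_dimensional_vector_space\<close> takes a basis as a parameter.\<close>

lemma finite_dimensional_basis: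
  obtains C :: "'a::finite_dim_inner set" where "finite_dimensional_vector_space scaleR C"
proof -
  obtain B :: "'a set" where B: "finite B" "span B = UNIV"
    using orthogonal_basis by metis
  obtain I where I: "I \<subseteq> B" "independent I" "B \<subseteq> span I"
    using real_vector.maximal_independent_subset by blast
  have "span I = UNIV"
    using B(2) I(3) by (metis span_mono span_span top.extremum_uniqueI)
  then have "finite_dimensional_vector_space scaleR I"
    using I finite_subset[OF I(1) B(1)]
    by unfold_locales
      (auto simp: real_vector.scale_right_distrib real_vector.scale_left_distrib dependent_raw_def span_raw_def)
  then show ?thesis using that by blast
qed

section \<open>Gaussian-weighted maxima of polynomial functions\<close>

lemma cinner_add_right: "cinner x (y + z) = cinner x y + cinner x z"
  by (metis cinner_add_left cinner_commute complex_cnj_add)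

lemma cinner_scaleC_right: "cinner x (a *\<^sub>C y) = cnj a * cinner x y"
  by (metis cinner_scaleC_left cinner_commute complex_cnj_mult)

lemma cinner_scaleR_left: "cinner (r *\<^sub>R x) y = complex_of_real r * cinner x y"
  by (metis cinner_scaleC_left scaleC_of_real)

lemma cinner_scaleR_right: "cinner x (r *\<^sub>R y) = complex_of_real r * cinner x y"
  by (metis cinner_scaleC_right scaleC_of_real complex_cnj_complex_of_real)

lemma omega_add_right: "omega z (x + y) = omega z x + omega z y"
  by (simp add: omega_def cinner_add_right)

lemma omega_scaleR_right: "omega z (r *\<^sub>R x) = r * omega z x"
  by (simp add: omega_def cinner_scaleR_right)

lemma clinear_map_imp_linear: "clinear_map f \<Longrightarrow> linear f"
  by (intro linearI) (metis clinear_map_def scaleC_of_real)+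

lemma clinear_form_imp_linear:
  assumes "clinear_form f" shows "linear f"
proof (intro linearI)
  show "f (x + y) = f x + f y" for x y
    using assms by (simp add: clinear_form_def)
  show "f (r *\<^sub>R x) = r *\<^sub>R f x" for r x
    using assms by (metis clinear_form_def scaleC_of_real scaleR_conv_of_real)
qed

lemma clinear_form_scaleC: "clinear_form f \<Longrightarrow> f (a *\<^sub>C x) = a * f x"
  by (simp add: clinear_form_def)

text \<open>Polynomial functions on a complex vector space are holomorphic: the real derivative is complex
linear.\<close>

lemma polynomial_function_derivative:
  fixes p :: "'v::hermitian_space \<Rightarrow> complex"
  assumes "p \<in> polynomial_functions"
  shows "\<exists>D. (p has_derivative D) (at z) \<and> clinear_form D"
  using assms
proof (induction rule: polynomial_functions.induct)
  case (const a)
  show ?case by (intro exI[of _ "\<lambda>_. 0"]) (auto simp: clinear_form_def)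
next
  case (form f)
  then show ?case
    using linear_imp_bounded_linear[OF clinear_form_imp_linear[OF form]]
    by (intro exI[of _ f]) (simp add: bounded_linear_imp_has_derivative)
next
  case (add p q)
  then obtain D E where "(p has_derivative D) (at z)" "clinear_form D"
    "(q has_derivative E) (at z)" "clinear_form E" by blast
  then show ?case
    by (intro exI[of _ "\<lambda>w. D w + E w"])
       (auto intro!: derivative_eq_intros simp: clinear_form_def algebra_simps)
next
  case (mult p q)
  then obtain D E where "(p has_derivative D) (at z)" "clinear_form D"
    "(q has_derivative E) (at z)" "clinear_form E" by blast
  then show ?case
    by (intro exI[of _ "\<lambda>w. p z * E w + D w * q z"])
       (auto intro!: derivative_eq_intros simp: clinear_form_def algebra_simps)
qed

lemma polynomial_function_growth:
  fixes p :: "'v::hermitian_space \<Rightarrow> complex"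
  assumes "p \<in> polynomial_functions"
  shows "\<exists>C n. 0 \<le> C \<and> (\<forall>z. norm (p z) \<le> C * (1 + norm z) ^ n)"
  using assms
proof (induction rule: polynomial_functions.induct)
  case (const a)
  show ?case by (intro exI[of _ "norm a"] exI[of _ 0]) auto
next
  case (form f)
  obtain K where K: "\<And>x. norm (f x) \<le> norm x * K" "K \<ge> 0"
    using bounded_linear.nonneg_bounded[OF linear_imp_bounded_linear[OF clinear_form_imp_linear[OF form]]]
    by blast
  have "norm (f z) \<le> K * (1 + norm z) ^ 1" for z
    using K(1)[of z] K(2) by (simp add: algebra_simps)
  then show ?case using K(2) by blast
next
  case (add p q)
  then obtain C n D m where *: "0 \<le> C" "\<And>z. norm (p z) \<le> C * (1 + norm z) ^ n"
    "0 \<le> D" "\<And>z. norm (q z) \<le> D * (1 + norm z) ^ m" by blast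
  have "norm (p z + q z) \<le> (C + D) * (1 + norm z) ^ (n + m)" for z
  proof -
    have "norm (p z + q z) \<le> C * (1 + norm z) ^ n + D * (1 + norm z) ^ m"
      using *(2,4)[of z] norm_triangle_ineq[of "p z" "q z"] by linarith
    also have "\<dots> \<le> C * (1 + norm z) ^ (n + m) + D * (1 + norm z) ^ (n + m)"
      using *(1,3) by (intro add_mono mult_left_mono power_increasing) auto
    finally show ?thesis by (simp add: algebra_simps)
  qed
  then show ?case using *(1,3) by (intro exI[of _ "C + D"] exI[of _ "n + m"]) auto
next
  case (mult p q)
  then obtain C n D m where *: "0 \<le> C" "\<And>z. norm (p z) \<le> C * (1 + norm z) ^ n"
    "0 \<le> D" "\<And>z. norm (q z) \<le> D * (1 + norm z) ^ m" by blast
  have "norm (p z * q z) \<le> (C * D) * (1 + norm z) ^ (n + m)" for z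
  proof -
    have "norm (p z * q z) \<le> (C * (1 + norm z) ^ n) * (D * (1 + norm z) ^ m)"
      unfolding norm_mult using * by (intro mult_mono) auto
    then show ?thesis by (simp add: power_add mult_ac)
  qed
  then show ?case using *(1,3) by (intro exI[of _ "C * D"] exI[of _ "n + m"]) auto
qed

text \<open>A polynomial grows more slowly than the Gaussian decays, so the weighted modulus exceeds its
value at \<open>z1\<close> only in a bounded region, which is relatively compact.\<close>

lemma gaussian_weighted_maximum:
  fixes p :: "'v::hermitian_space \<Rightarrow> complex"
  assumes p: "p \<in> polynomial_functions" and nz: "p z1 \<noteq> 0"
  obtains z0 where "p z0 \<noteq> 0"
    "\<And>z. (norm (p z))\<^sup>2 * exp (- (norm z)\<^sup>2) \<le> (norm (p z0))\<^sup>2 * exp (- (norm z0)\<^sup>2)"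
proof -
  define F where "F z = (norm (p z))\<^sup>2 * exp (- (norm z)\<^sup>2)" for z
  have pos: "F z1 > 0" using nz by (simp add: F_def)
  have cp: "continuous_on UNIV p"
    using polynomial_function_derivative[OF p] has_derivative_continuous
    by (metis continuous_at_imp_continuous_on)
  obtain C n where C: "0 \<le> C" "\<And>z. norm (p z) \<le> C * (1 + norm z) ^ n"
    using polynomial_function_growth[OF p] by blast
  have "((\<lambda>x::real. (C * (1 + x) ^ n)\<^sup>2 * exp (- x\<^sup>2)) \<longlongrightarrow> 0) at_top"
  proof (rule tendsto_sandwich[OF _ _ tendsto_const])
    have "filterlim (\<lambda>x::real. 1 + x) at_top at_top"
      by (rule filterlim_tendsto_add_at_top[OF tendsto_const filterlim_ident])
    from filterlim_compose[OF tendsto_power_div_exp_0[of "2 * n"] this]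
    have "((\<lambda>x::real. C\<^sup>2 * exp 1 * ((1 + x) ^ (2 * n) / exp (1 + x))) \<longlongrightarrow> C\<^sup>2 * exp 1 * 0) at_top"
      by (intro tendsto_mult tendsto_const)
    then show "((\<lambda>x::real. C\<^sup>2 * exp 1 * ((1 + x) ^ (2 * n) / exp (1 + x))) \<longlongrightarrow> 0) at_top"
      by simp
    show "\<forall>\<^sub>F x::real in at_top. (C * (1 + x) ^ n)\<^sup>2 * exp (- x\<^sup>2)
        \<le> C\<^sup>2 * exp 1 * ((1 + x) ^ (2 * n) / exp (1 + x))"
      using eventually_ge_at_top[of 1]
    proof eventually_elim
      case (elim x)
      then have "exp (- x\<^sup>2) \<le> exp (- x)" by (simp add: power2_eq_square)
      then have "(C * (1 + x) ^ n)\<^sup>2 * exp (- x\<^sup>2) \<le> (C * (1 + x) ^ n)\<^sup>2 * exp (- x)"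
        by (intro mult_left_mono) auto
      also have "\<dots> = C\<^sup>2 * exp 1 * ((1 + x) ^ (2 * n) / exp (1 + x))"
        by (simp add: exp_add exp_minus power_mult_distrib power_mult[symmetric] field_simps)
      finally show ?case .
    qed
  qed auto
  then have "eventually (\<lambda>x::real. (C * (1 + x) ^ n)\<^sup>2 * exp (- x\<^sup>2) < F z1) at_top"
    using pos by (intro order_tendstoD) auto
  then obtain R where R: "\<And>x::real. x \<ge> R \<Longrightarrow> (C * (1 + x) ^ n)\<^sup>2 * exp (- x\<^sup>2) < F z1"
    unfolding eventually_at_top_linorder by blast
  have far: "F z < F z1" if "norm z \<ge> R" for z
  proof -
    have "F z \<le> (C * (1 + norm z) ^ n)\<^sup>2 * exp (- (norm z)\<^sup>2)"
      unfolding F_def by (intro mult_right_mono power_mono C(2)) auto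
    then show ?thesis using R[OF that] by linarith
  qed
  have z1: "z1 \<in> cball 0 R" using far[of z1] by force
  have "continuous_on (cball 0 R) F"
    unfolding F_def by (intro continuous_intros continuous_on_subset[OF cp]) auto
  then obtain z0 where z0: "z0 \<in> cball 0 R" "\<And>z. z \<in> cball 0 R \<Longrightarrow> F z \<le> F z0"
    using continuous_attains_sup[of "cball 0 R" F] z1 compact_cball by blast
  have max: "F z \<le> F z0" for z
    using z0(2)[of z] z0(2)[OF z1] far[of z] by (cases "norm z \<le> R") auto
  have "F z0 > 0" using max[of z1] pos by linarith
  then have "p z0 \<noteq> 0" by (auto simp: F_def)
  then show ?thesis using that[of z0] max by (simp add: F_def)
qed

text \<open>The derivative of the weighted squared modulus gives the equation for the real parts. Applying
it to \<open>\<i> w\<close> as well and using complex linearity of \<open>D\<close> gives it for the imaginary parts.\<close>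

lemma gaussian_critical_point:
  fixes p :: "'v::hermitian_space \<Rightarrow> complex"
  assumes D: "(p has_derivative D) (at z0)" "clinear_form D"
    and max: "\<And>z. (norm (p z))\<^sup>2 * exp (- (norm z)\<^sup>2) \<le> (norm (p z0))\<^sup>2 * exp (- (norm z0)\<^sup>2)"
  shows "D w = cinner w z0 * p z0"
proof -
  define c where "c = p z0"
  have re: "inner c (D w) = (norm c)\<^sup>2 * inner z0 w" for w
  proof -
    define \<phi> where "\<phi> z = inner (p z) (p z) * exp (- inner z z)" for z
    have D': "(\<phi> has_derivative (\<lambda>w. (inner c c * (exp (- inner z0 z0) * (- (inner z0 w + inner w z0)))
        + (inner c (D w) + inner (D w) c) * exp (- inner z0 z0)))) (at z0)"
      unfolding \<phi>_def by (auto intro!: derivative_eq_intros D(1) simp: c_def)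
    have "\<phi> z \<le> \<phi> z0" for z
      using max[of z] by (simp add: \<phi>_def power2_norm_eq_inner)
    then have "(\<lambda>w. (inner c c * (exp (- inner z0 z0) * (- (inner z0 w + inner w z0)))
        + (inner c (D w) + inner (D w) c) * exp (- inner z0 z0))) = (\<lambda>_. 0)"
      by (intro differential_zero_maxmin[OF _ open_UNIV D']) auto
    from fun_cong[OF this, of w]
    have "exp (- inner z0 z0) * (2 * inner c (D w) - 2 * inner c c * inner z0 w) = 0"
      by (simp add: inner_commute algebra_simps)
    then show ?thesis by (simp add: power2_norm_eq_inner)
  qed
  have re': "Re (cnj c * D w) = Re ((norm c)\<^sup>2 * cinner w z0)" for w
    using re[of w] by (simp add: inner_complex_def inner_commute[of z0 w] inner_eq_Re_cinner[of w z0])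
  have "Im (cnj c * D w) = Im ((norm c)\<^sup>2 * cinner w z0)" for w
    using re'[of "\<i> *\<^sub>C w"] clinear_form_scaleC[OF D(2), of \<i> w]
    by (simp add: cinner_scaleC_left)
  then have "cnj c * D w = (norm c)\<^sup>2 * cinner w z0"
    using re'[of w] by (simp only: complex_eq_iff simp_thms)
  also have "\<dots> = cnj c * (cinner w z0 * c)"
    by (simp add: complex_norm_square mult_ac flip: of_real_power)
  finally have *: "cnj c * D w = cnj c * (cinner w z0 * c)" .
  show ?thesis
  proof (cases "c = 0")
    case False
    then show ?thesis using * by (simp add: c_def)
  next
    case True
    then have "norm (p z) = 0" for z
      using max[of z] by (simp add: c_def mult_le_0_iff)
    then have "p = (\<lambda>_. 0)" by auto
    then have "D = (\<lambda>_. 0)" using D(1) has_derivative_unique has_derivative_const by blast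
    then show ?thesis using True by (simp add: c_def)
  qed
qed

section \<open>One-parameter groups of operators\<close>

lemma has_vector_derivative_iff_quotient_tendsto:
  "(f has_vector_derivative D) (at a within S) \<longleftrightarrow>
    ((\<lambda>x. (f x - f a) /\<^sub>R (x - a)) \<longlongrightarrow> D) (at a within S)"
proof -
  have eq: "norm ((f x - f a) /\<^sub>R (x - a) - D) = norm (f x - f a - (x - a) *\<^sub>R D) / norm (x - a)"
    if "x \<noteq> a" for x
  proof -
    have "(f x - f a) /\<^sub>R (x - a) - D = (f x - f a - (x - a) *\<^sub>R D) /\<^sub>R (x - a)"
      using that by (simp add: scaleR_diff_right)
    then show ?thesis by (simp add: divide_inverse mult.commute)
  qed
  have "(f has_vector_derivative D) (at a within S) \<longleftrightarrow>
      ((\<lambda>x. norm (f x - f a - (x - a) *\<^sub>R D) / norm (x - a)) \<longlongrightarrow> 0) (at a within S)"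
    unfolding has_vector_derivative_def has_derivative_iff_norm
    by (simp add: bounded_linear_scaleR_left)
  also have "\<dots> \<longleftrightarrow> ((\<lambda>x. norm ((f x - f a) /\<^sub>R (x - a) - D)) \<longlongrightarrow> 0) (at a within S)"
    by (rule filterlim_cong[OF refl refl]) (simp add: eventually_at_filter eq)
  also have "\<dots> \<longleftrightarrow> ((\<lambda>x. (f x - f a) /\<^sub>R (x - a)) \<longlongrightarrow> D) (at a within S)"
    by (simp add: tendsto_norm_zero_iff Lim_null[symmetric])
  finally show ?thesis .
qed

text \<open>Averages over \<open>[0, e]\<close> of a continuous orbit are vectors with a differentiable orbit, since
translating the orbit shifts the interval of integration. Such averages are dense, and the
vectors with a differentiable orbit form a subspace, which is closed in finite dimension.\<close>

lemma one_parameter_operator_group_differentiable: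
  fixes U :: "real \<Rightarrow> 'v::finite_dim_inner \<Rightarrow> 'v"
  assumes lin: "\<And>s. linear (U s)" and zero: "\<And>z. U 0 z = z"
    and add: "\<And>s t z. U (s + t) z = U s (U t z)"
    and cont: "\<And>z. continuous_on UNIV (\<lambda>s. U s z)"
  obtains D where "((\<lambda>s. U s z) has_vector_derivative D) (at 0)"
proof -
  define S where "S = {z. \<exists>D. ((\<lambda>s. U s z) has_vector_derivative D) (at 0)}"
  have "subspace S"
  proof (unfold subspace_def, intro conjI ballI allI)
    show "0 \<in> S"
      unfolding S_def using linear_0[OF lin] by (auto intro!: exI[of _ 0])
    show "x + y \<in> S" if "x \<in> S" "y \<in> S" for x y
      using that unfolding S_def mem_Collect_eq linear_add[OF lin]
      by (elim exE) (rule exI, erule (1) has_vector_derivative_add)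
    show "r *\<^sub>R x \<in> S" if x: "x \<in> S" for r x
    proof -
      obtain D where "((\<lambda>s. U s x) has_vector_derivative D) (at 0)"
        using x by (auto simp: S_def)
      then have "((\<lambda>s. r *\<^sub>R U s x) has_vector_derivative r *\<^sub>R D) (at 0)"
        by (rule bounded_linear.has_vector_derivative[OF bounded_linear_scaleR_right])
      then show ?thesis unfolding S_def mem_Collect_eq linear_scale[OF lin] by blast
    qed
  qed
  then have "closed S" by (rule closed_finite_dim_subspace)
  obtain g where g: "\<And>x. x \<in> {-2..2} \<Longrightarrow> (g has_vector_derivative U x z) (at x within {-2..2})"
    using antiderivative_continuous[of "-2" 2 "\<lambda>s. U s z"] continuous_on_subset[OF cont] by blast
  have g': "(g has_vector_derivative U x z) (at x)" if "x \<in> {-2<..<2}" for x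
    using g[of x] that by (simp add: at_within_Icc_at)
  define F where "F s = g s - g 0" for s
  have F': "(F has_vector_derivative U x z) (at x)" if "x \<in> {-2<..<2}" for x
    using has_vector_derivative_diff[OF g'[OF that] has_vector_derivative_const[of "g 0"]]
    by (simp add: F_def[abs_def])
  \<comment> \<open>\<open>F e\<close> is the integral of the orbit over \<open>[0, e]\<close>. Both sides have the same derivative in \<open>e\<close>.\<close>
  have shift: "U t (F e) = F (t + e) - F t" if t: "\<bar>t\<bar> < 1" and e: "0 \<le> e" "e < 1" for t e
  proof -
    define H where "H s = U t (F s) - F (t + s)" for s
    have "(H has_vector_derivative 0) (at s within {0..e})" if "s \<in> {0..e}" for s
    proof -
      have "((\<lambda>s. U t (F s)) has_vector_derivative U t (U s z)) (at s)"
        using t e that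
        by (intro bounded_linear.has_vector_derivative[OF linear_imp_bounded_linear[OF lin]] F') auto
      moreover have "((\<lambda>s. F (t + s)) has_vector_derivative U (t + s) z) (at s)"
      proof -
        have "((\<lambda>s. t + s) has_vector_derivative 1) (at s)"
          by (auto intro!: derivative_eq_intros)
        then have "((F \<circ> (\<lambda>s. t + s)) has_vector_derivative 1 *\<^sub>R U (t + s) z) (at s)"
          using t e that by (intro vector_diff_chain_at F') auto
        then show ?thesis by (simp add: o_def)
      qed
      ultimately have "(H has_vector_derivative U t (U s z) - U (t + s) z) (at s)"
        unfolding H_def by (rule has_vector_derivative_diff)
      then show ?thesis by (simp add: add has_vector_derivative_at_within)
    qed
    then obtain k where "\<And>s. s \<in> {0..e} \<Longrightarrow> H s = k"
      using has_vector_derivative_zero_constant[of "{0..e}" H] by auto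
    then have "H e = H 0" using e by auto
    then show ?thesis by (simp add: H_def F_def linear_0[OF lin] algebra_simps)
  qed
  have mem: "F e \<in> S" if e: "0 < e" "e < 1" for e
  proof -
    have "((\<lambda>s. s + e) has_vector_derivative 1) (at 0)"
      by (auto intro!: derivative_eq_intros)
    then have "((F \<circ> (\<lambda>s. s + e)) has_vector_derivative 1 *\<^sub>R U (0 + e) z) (at 0)"
      using e by (intro vector_diff_chain_at F') auto
    then have "((\<lambda>s. F (s + e) - F s) has_vector_derivative U e z - U 0 z) (at 0)"
      using F'[of 0] by (intro has_vector_derivative_diff) (auto simp: o_def)
    then have "((\<lambda>s. U s (F e)) has_vector_derivative U e z - U 0 z) (at 0)"
      by (rule has_vector_derivative_transform_within_open[of _ _ _ "{-1<..<1}"])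
         (use e shift in auto)
    then show ?thesis by (auto simp: S_def)
  qed
  have lim: "((\<lambda>e. (1 / e) *\<^sub>R F e) \<longlongrightarrow> z) (at_right 0)"
  proof -
    have "((\<lambda>e. (F e - F 0) /\<^sub>R (e - 0)) \<longlongrightarrow> U 0 z) (at_right 0)"
      using F'[of 0] has_vector_derivative_at_within[of F "U 0 z" 0 "{0<..}"]
      by (simp add: has_vector_derivative_iff_quotient_tendsto)
    then show ?thesis by (simp add: F_def zero inverse_eq_divide)
  qed
  have ev: "\<forall>\<^sub>F e in at_right (0::real). (1 / e) *\<^sub>R F e \<in> S"
    using eventually_at_right_real[of 0 1]
    by (rule eventually_mono) (use mem subspace_scale[OF \<open>subspace S\<close>] in auto)
  have "z \<in> S"
    by (rule Lim_in_closed_set[OF \<open>closed S\<close> ev _ lim]) simp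
  then show ?thesis using that by (auto simp: S_def)
qed

section \<open>Second order Taylor estimate\<close>

text \<open>The factor \<open>R\<close> in the Lipschitz constant of the remainder is what a bounded second derivative
buys over mere differentiability. The argument applies the mean value inequality twice, once to
the first derivative and once to the remainder itself.\<close>

lemma C2_linear_remainder:
  fixes f :: "'a::finite_dim_inner \<Rightarrow> 'b::real_normed_vector"
  assumes S: "open S" "p0 \<in> S" and f: "smooth_on S f"
  obtains r C where "0 < r" "0 \<le> C" "cball p0 r \<subseteq> S"
    "\<And>R p q. R \<le> r \<Longrightarrow> p \<in> cball p0 R \<Longrightarrow> q \<in> cball p0 R \<Longrightarrow>
      norm (f p - f q - frechet_derivative f (at p0) (p - q)) \<le> C * R * norm (p - q)"
proof -
  define D where "D x = frechet_derivative f (at x)" for x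
  define E where "E v x = frechet_derivative (\<lambda>x. D x v) (at x)" for v x
  have "Ck_on (Suc (Suc 0)) S f" using f unfolding smooth_on_def by blast
  then have D: "\<And>x. x \<in> S \<Longrightarrow> (f has_derivative D x) (at x)"
    and E: "\<And>x v. x \<in> S \<Longrightarrow> ((\<lambda>x. D x v) has_derivative E v x) (at x)"
    and contE: "\<And>v w. continuous_on S (\<lambda>x. E v x w)"
    by (auto simp: D_def E_def frechet_derivative_works)
  obtain r where r: "r > 0" "cball p0 r \<subseteq> S"
    using S open_contains_cball by blast
  obtain Cb :: "'a set" and k where Cb: "finite Cb" "\<And>c. c \<in> Cb \<Longrightarrow> 0 \<le> k c"
    "\<And>f :: 'a \<Rightarrow> 'b. \<And>x. linear f \<Longrightarrow> norm (f x) \<le> (\<Sum>c\<in>Cb. k c * norm (f c)) * norm x"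
    using linear_bounded_on_orthogonal_basis by blast
  have "\<exists>M. \<forall>x\<in>cball p0 r. norm (E v x w) \<le> M" for v w
  proof -
    have "compact ((\<lambda>x. E v x w) ` cball p0 r)"
      using contE[of v w] r(2) by (intro compact_continuous_image compact_cball) (rule continuous_on_subset)
    then have "bounded ((\<lambda>x. E v x w) ` cball p0 r)"
      by (rule compact_imp_bounded)
    then show ?thesis
      unfolding bounded_iff by (simp only: ball_simps)
  qed
  then obtain M where M: "\<And>v w x. x \<in> cball p0 r \<Longrightarrow> norm (E v x w) \<le> M v w"
    by metis
  have M0: "0 \<le> M v w" for v w
    using M[of p0 v w] r(1) norm_ge_zero[of "E v p0 w"] by (simp del: norm_ge_zero)
  define K where "K v = (\<Sum>w\<in>Cb. k w * M v w)" for v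
  define C where "C = (\<Sum>v\<in>Cb. k v * K v)"
  have K0: "0 \<le> K v" for v using Cb(2) M0 by (auto simp: K_def intro!: sum_nonneg)
  have C0: "0 \<le> C" using Cb(2) K0 by (auto simp: C_def intro!: sum_nonneg)
  have E_bound: "norm (E v x w) \<le> K v * norm w" if "x \<in> cball p0 r" for v x w
  proof -
    have "norm (E v x w) \<le> (\<Sum>c\<in>Cb. k c * norm (E v x c)) * norm w"
      using E[of x v] r(2) that by (intro Cb(3) has_derivative_linear) auto
    also have "\<dots> \<le> K v * norm w"
      unfolding K_def using M[OF that] Cb(2) by (intro mult_right_mono sum_mono mult_left_mono) auto
    finally show ?thesis .
  qed
  have D_lip: "norm (D x v - D p0 v) \<le> K v * norm (x - p0)" if "x \<in> cball p0 r" for x v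
  proof (rule differentiable_bound[of "cball p0 r" "\<lambda>x. D x v" "E v"])
    show "((\<lambda>x. D x v) has_derivative E v x) (at x within cball p0 r)" if "x \<in> cball p0 r" for x
      using E that r(2) by (meson has_derivative_at_withinI subsetD)
    show "onorm (E v x) \<le> K v" if "x \<in> cball p0 r" for x
      by (rule onorm_bound[OF K0 E_bound[OF that]])
  qed (use that r(1) in auto)
  have D_op: "norm (D x w - D p0 w) \<le> C * R * norm w" if "x \<in> cball p0 R" "R \<le> r" for x w R
  proof -
    have x: "x \<in> cball p0 r" "x \<in> S" "norm (x - p0) \<le> R"
      using that r(2) by (auto simp: dist_norm norm_minus_commute)
    have "linear (\<lambda>w. D x w - D p0 w)"
      using D[OF x(2)] D[OF S(2)] by (intro linear_compose_sub has_derivative_linear)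
    then have "norm (D x w - D p0 w) \<le> (\<Sum>c\<in>Cb. k c * norm (D x c - D p0 c)) * norm w"
      by (rule Cb(3))
    also have "\<dots> \<le> (\<Sum>c\<in>Cb. k c * (K c * R)) * norm w"
    proof (intro mult_right_mono sum_mono mult_left_mono)
      fix c
      have "norm (D x c - D p0 c) \<le> K c * norm (x - p0)" by (rule D_lip[OF x(1)])
      also have "\<dots> \<le> K c * R" by (intro mult_left_mono x(3) K0)
      finally show "norm (D x c - D p0 c) \<le> K c * R" .
    qed (use Cb(2) in auto)
    also have "\<dots> = C * R * norm w"
      by (simp only: C_def sum_distrib_right mult.assoc)
    finally show ?thesis .
  qed
  have "norm (f p - f q - D p0 (p - q)) \<le> C * R * norm (p - q)"
    if R: "R \<le> r" and p: "p \<in> cball p0 R" and q: "q \<in> cball p0 R" for R p q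
  proof -
    have lin: "linear (D p0)" using D[OF S(2)] by (rule has_derivative_linear)
    have "norm ((f p - D p0 p) - (f q - D p0 q)) \<le> C * R * norm (p - q)"
    proof (rule differentiable_bound[of "cball p0 R" "\<lambda>x. f x - D p0 x" "\<lambda>x w. D x w - D p0 w"])
      show "((\<lambda>x. f x - D p0 x) has_derivative (\<lambda>w. D x w - D p0 w)) (at x within cball p0 R)"
        if "x \<in> cball p0 R" for x
      proof -
        have "x \<in> S" using that R r(2) by auto
        then show ?thesis
          by (rule has_derivative_diff[OF has_derivative_at_withinI[OF D]
              bounded_linear_imp_has_derivative[OF has_derivative_bounded_linear[OF D[OF S(2)]]]])
      qed
      show "onorm (\<lambda>w. D x w - D p0 w) \<le> C * R" if "x \<in> cball p0 R" for x
        proof (rule onorm_bound[OF _ D_op[OF that R]])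
          have "0 \<le> R" using p zero_le_dist[of p0 p] by (simp del: zero_le_dist)
          then show "0 \<le> C * R" using C0 by simp
        qed
    qed (use p q in auto)
    then show ?thesis by (simp add: linear_diff[OF lin] algebra_simps)
  qed
  then show ?thesis using that[of r C] r C0 by (simp add: D_def)
qed

section \<open>The group law in a chart around the identity\<close>

text \<open>Tychonoff's theorem, with the limit taken along a filter \<open>H\<close> on the index set because the
product need not be sequentially compact.\<close>

lemma compact_pointwise_cluster:
  fixes u :: "nat \<Rightarrow> 'i \<Rightarrow> 'b::t2_space"
  assumes S: "compact S" and u: "\<And>n i. u n i \<in> S"
  obtains \<gamma> H where "H \<noteq> bot" "H \<le> sequentially" "\<And>i. \<gamma> i \<in> S" "\<And>i. ((\<lambda>n. u n i) \<longlongrightarrow> \<gamma> i) H"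
proof -
  have "compactin (product_topology (\<lambda>_::'i. euclidean :: 'b topology) UNIV) (PiE UNIV (\<lambda>_. S))"
    unfolding compactin_PiE using S by (simp add: compactin_euclidean_iff)
  then have "compact (PiE UNIV (\<lambda>_::'i. S))"
    by (simp add: euclidean_product_topology compactin_euclidean_iff)
  moreover have "filtermap u sequentially \<noteq> bot"
    by (simp add: filtermap_bot_iff)
  moreover have "eventually (\<lambda>x. x \<in> PiE UNIV (\<lambda>_::'i. S)) (filtermap u sequentially)"
    using u by (simp add: eventually_filtermap PiE_iff)
  ultimately obtain \<gamma> where \<gamma>: "\<gamma> \<in> PiE UNIV (\<lambda>_::'i. S)" "inf (nhds \<gamma>) (filtermap u sequentially) \<noteq> bot"
    unfolding compact_filter by blast
  define H where "H = inf (filtercomap u (nhds \<gamma>)) sequentially"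
  have "H \<noteq> bot"
  proof
    assume "H = bot"
    then have "eventually (\<lambda>_. False) H" by simp
    then obtain P Q where PQ: "eventually P (filtercomap u (nhds \<gamma>))" "eventually Q sequentially"
      "\<And>n. P n \<and> Q n \<Longrightarrow> False"
      unfolding H_def eventually_inf by blast
    then obtain P' where P': "eventually P' (nhds \<gamma>)" "\<And>n. P' (u n) \<Longrightarrow> P n"
      unfolding eventually_filtercomap by blast
    have "eventually (\<lambda>y. \<not> P' y) (filtermap u sequentially)"
      unfolding eventually_filtermap using PQ(2) by (rule eventually_mono) (use PQ(3) P'(2) in blast)
    then have "eventually (\<lambda>_. False) (inf (nhds \<gamma>) (filtermap u sequentially))"
      unfolding eventually_inf using P'(1) by blast
    then show False using \<gamma>(2) by (simp add: trivial_limit_def)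
  qed
  moreover have "H \<le> sequentially" by (simp add: H_def)
  moreover have "((\<lambda>n. u n i) \<longlongrightarrow> \<gamma> i) H" for i
  proof -
    have "(u \<longlongrightarrow> \<gamma>) H"
      unfolding H_def using filterlim_filtercomap by (rule filterlim_mono) auto
    from continuous_on_tendsto_compose[OF continuous_on_product_coordinates this]
    show ?thesis by simp
  qed
  ultimately show ?thesis using \<gamma>(1) by (intro that[of H \<gamma>]) auto
qed

lemma has_vector_derivative_at_0_quadraticI:
  assumes "f 0 = 0" and "eventually (\<lambda>t. norm (f t - t *\<^sub>R A) \<le> K * t\<^sup>2) (at (0::real))"
  shows "(f has_vector_derivative A) (at 0)"
  unfolding has_vector_derivative_iff_quotient_tendsto
proof (rule Lim_null[THEN iffD2], rule Lim_null_comparison[where g = "\<lambda>t. K * \<bar>t\<bar>"])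
  show "((\<lambda>t::real. K * \<bar>t\<bar>) \<longlongrightarrow> 0) (at 0)"
    by (auto intro!: tendsto_eq_intros)
  show "eventually (\<lambda>t. norm ((f t - f 0) /\<^sub>R (t - 0) - A) \<le> K * \<bar>t\<bar>) (at 0)"
    using assms(2) eventually_neq_at_within[of 0 0 UNIV]
  proof eventually_elim
    case (elim t)
    have "(f t - f 0) /\<^sub>R (t - 0) - A = (f t - t *\<^sub>R A) /\<^sub>R t"
      using elim assms(1) by (simp add: scaleR_diff_right)
    then have "norm ((f t - f 0) /\<^sub>R (t - 0) - A) = norm (f t - t *\<^sub>R A) / \<bar>t\<bar>"
      by (simp add: divide_inverse mult.commute)
    also have "\<dots> \<le> (K * t\<^sup>2) / \<bar>t\<bar>"
      using elim by (intro divide_right_mono) auto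
    also have "\<dots> = K * \<bar>t\<bar>" using elim by (cases "t > 0") (auto simp: power2_eq_square)
    finally show ?case .
  qed
qed

context lie_group begin

lemma chart_facts:
  assumes "a \<in> atlas"
  shows chart_subset: "fst a \<subseteq> carrier G"
    and chart_inv_chart: "g \<in> fst a \<Longrightarrow> chart_inv a (snd a g) = g"
    and chart_chart_inv: "x \<in> chart_image a \<Longrightarrow> snd a (chart_inv a x) = x"
    and chart_inv_mem: "x \<in> chart_image a \<Longrightarrow> chart_inv a x \<in> fst a"
    and chart_mem: "g \<in> fst a \<Longrightarrow> snd a g \<in> chart_image a"
    and continuous_on_chart: "continuous_on (fst a) (snd a)"
    and continuous_on_chart_inv: "continuous_on (chart_image a) (chart_inv a)"
  using chart_homeomorphism[OF assms] atlas_cover assms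
  unfolding homeomorphism_def by auto

lemma chart_exists: "g \<in> carrier G \<Longrightarrow> \<exists>a\<in>atlas. g \<in> fst a"
  using atlas_cover by blast

lemma eventually_in_chart:
  assumes a: "a \<in> atlas" and f: "(f \<longlongrightarrow> g) F" "eventually (\<lambda>x. f x \<in> carrier G) F" and g: "g \<in> fst a"
  shows "eventually (\<lambda>x. f x \<in> fst a) F"
proof -
  obtain O' where O': "open O'" "fst a = carrier G \<inter> O'"
    using chart_domain[OF a] by (auto simp: openin_open)
  have "eventually (\<lambda>x. f x \<in> O') F"
    using f(1) O' g by (intro topological_tendstoD) auto
  with f(2) show ?thesis by eventually_elim (use O' in auto)
qed

lemma tendsto_compose_within:
  assumes "continuous_on S h" "(f \<longlongrightarrow> g) F" "eventually (\<lambda>x. f x \<in> S) F" "g \<in> S"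
  shows "((\<lambda>x. h (f x)) \<longlongrightarrow> h g) F"
  using continuous_on_tendsto_compose[OF assms(1,2,4,3)] .

lemma tendsto_group_mult:
  assumes "(f \<longlongrightarrow> a) F" "(g \<longlongrightarrow> b) F" "eventually (\<lambda>x. f x \<in> carrier G) F"
    "eventually (\<lambda>x. g x \<in> carrier G) F" "a \<in> carrier G" "b \<in> carrier G"
  shows "((\<lambda>x. f x \<otimes> g x) \<longlongrightarrow> a \<otimes> b) F"
proof -
  have "((\<lambda>x. (case (f x, g x) of (g, h) \<Rightarrow> g \<otimes> h)) \<longlongrightarrow> (case (a, b) of (g, h) \<Rightarrow> g \<otimes> h)) F"
    using assms eventually_conj[OF assms(3,4)]
    by (intro tendsto_compose_within[OF continuous_mult] tendsto_Pair) auto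
  then show ?thesis by simp
qed

lemma tendsto_group_inv:
  assumes "(f \<longlongrightarrow> a) F" "eventually (\<lambda>x. f x \<in> carrier G) F" "a \<in> carrier G"
  shows "((\<lambda>x. inv (f x)) \<longlongrightarrow> inv a) F"
  using tendsto_compose_within[OF continuous_inv assms] .

text \<open>The domain on which the group law is smooth in charts is open, so that it contains balls.\<close>

lemma open_chart_product_domain:
  assumes "a \<in> atlas" "b \<in> atlas" "d \<in> atlas"
  shows "open {p \<in> chart_image a \<times> chart_image b. chart_inv a (fst p) \<otimes> chart_inv b (snd p) \<in> fst d}"
proof -
  let ?S = "chart_image a \<times> chart_image b"
  let ?f = "\<lambda>p. chart_inv a (fst p) \<otimes> chart_inv b (snd p)"
  have sub: "chart_inv a (fst p) \<in> carrier G" "chart_inv b (snd p) \<in> carrier G" if "p \<in> ?S" for p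
    using that chart_subset[OF assms(1)] chart_subset[OF assms(2)]
      chart_inv_mem[OF assms(1)] chart_inv_mem[OF assms(2)] by auto
  have "continuous_on ?S (\<lambda>p. chart_inv a (fst p))" "continuous_on ?S (\<lambda>p. chart_inv b (snd p))"
    by (rule continuous_on_compose2[OF continuous_on_chart_inv[OF assms(1)]], auto intro: continuous_intros)
       (rule continuous_on_compose2[OF continuous_on_chart_inv[OF assms(2)]], auto intro: continuous_intros)
  then have "continuous_on ?S (\<lambda>p. (case (chart_inv a (fst p), chart_inv b (snd p)) of (g, h) \<Rightarrow> g \<otimes> h))"
    by (intro continuous_on_compose2[OF continuous_mult] continuous_on_Pair) (use sub in auto)
  then have cont: "continuous_on ?S ?f" by simp
  obtain O' where O': "open O'" "fst d = carrier G \<inter> O'"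
    using chart_domain[OF assms(3)] by (auto simp: openin_open)
  have "open (?S \<inter> ?f -` O')"
    using cont O'(1) by (intro continuous_open_preimage open_Times chart_open assms)
  also have "?S \<inter> ?f -` O' = {p \<in> ?S. ?f p \<in> fst d}"
    using sub O'(2) by auto
  finally show ?thesis .
qed

end

locale compact_lie_group_chart = lie_group +
  fixes c
  assumes c_atlas: "c \<in> atlas" and one_in_chart: "\<one> \<in> fst c"
    and compact_carrier: "compact (carrier G)"
begin

definition coord where "coord g = snd c g - snd c \<one>"

definition point where "point x = chart_inv c (snd c \<one> + x)"

text \<open>\<open>near R\<close> is a neighbourhood of the identity only for positive \<open>R\<close>, and it is compact only while
the ball of radius \<open>R\<close> lies in the image of the chart; \<open>local_law\<close> provides such an \<open>R\<close>.\<close>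

definition near where "near R = {g \<in> fst c. norm (coord g) \<le> R}"

text \<open>The second order expansion of the product at the identity: the deviation of the group law from
the addition of coordinates has Lipschitz constant \<open>C * R\<close> on \<open>near R\<close>. The bound on \<open>C * r\<close>
makes this deviation small compared with its arguments.\<close>

definition local_law :: "real \<Rightarrow> real \<Rightarrow> bool" where
  "local_law r C \<longleftrightarrow> 0 < r \<and> 0 \<le> C \<and> C * r \<le> 1 / 4 \<and>
    (\<forall>x. norm x \<le> r \<longrightarrow> snd c \<one> + x \<in> chart_image c) \<and>
    (\<forall>R g h g' h'. R \<le> r \<longrightarrow> g \<in> near R \<longrightarrow> h \<in> near R \<longrightarrow> g' \<in> near R \<longrightarrow> h' \<in> near R \<longrightarrow>
      g \<otimes> h \<in> fst c \<and>
      norm (coord (g \<otimes> h) - coord (g' \<otimes> h') - (coord g - coord g') - (coord h - coord h'))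
        \<le> C * R * (norm (coord g - coord g') + norm (coord h - coord h')))"

lemma coord_one [simp]: "coord \<one> = 0" by (simp add: coord_def)

lemma near_carrier: "g \<in> near R \<Longrightarrow> g \<in> carrier G"
  using chart_subset[OF c_atlas] by (auto simp: near_def)

lemma point_coord: "g \<in> fst c \<Longrightarrow> point (coord g) = g"
  by (simp add: point_def coord_def chart_inv_chart[OF c_atlas])

lemma one_near: "0 \<le> R \<Longrightarrow> \<one> \<in> near R"
  using one_in_chart by (simp add: near_def)

lemma near_mono: "g \<in> near R \<Longrightarrow> R \<le> R' \<Longrightarrow> g \<in> near R'"
  by (auto simp: near_def)

lemma continuous_on_coord: "continuous_on (fst c) coord"
  unfolding coord_def by (intro continuous_intros continuous_on_chart c_atlas)

lemma tendsto_coord: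
  assumes "(f \<longlongrightarrow> g) F" "eventually (\<lambda>x. f x \<in> carrier G) F" "g \<in> fst c"
  shows "((\<lambda>x. coord (f x)) \<longlongrightarrow> coord g) F"
  using tendsto_compose_within[OF continuous_on_coord assms(1) eventually_in_chart[OF c_atlas assms] assms(3)] .

lemma eventually_near:
  assumes "(f \<longlongrightarrow> \<one>) F" "eventually (\<lambda>x. f x \<in> carrier G) F" "R > 0"
  shows "eventually (\<lambda>x. f x \<in> near R) F"
proof -
  have "eventually (\<lambda>x. norm (coord (f x)) < R) F"
    using tendsto_norm[OF tendsto_coord[OF assms(1,2) one_in_chart]] assms(3)
    by (intro order_tendstoD) auto
  with eventually_in_chart[OF c_atlas assms(1,2) one_in_chart]
  show ?thesis by eventually_elim (simp add: near_def)
qed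

text \<open>The product with the identity in either slot is the identity map, so the derivative of the group
law at the pair of identities is addition. The rest is the Taylor estimate for smooth functions.\<close>

lemma ex_local_law: "\<exists>r C. local_law r C"
proof -
  define x0 where "x0 = snd c \<one>"
  define S where "S = {p \<in> chart_image c \<times> chart_image c. chart_inv c (fst p) \<otimes> chart_inv c (snd p) \<in> fst c}"
  define m where "m p = snd c (chart_inv c (fst p) \<otimes> chart_inv c (snd p))" for p
  have x0: "x0 \<in> chart_image c" "chart_inv c x0 = \<one>"
    unfolding x0_def by (auto intro: chart_mem c_atlas one_in_chart simp: chart_inv_chart[OF c_atlas one_in_chart])
  have S: "open S" "(x0, x0) \<in> S"
    unfolding S_def using open_chart_product_domain[OF c_atlas c_atlas c_atlas] x0 one_in_chart by auto
  have sm: "smooth_on S m"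
    unfolding S_def m_def by (rule smooth_mult[OF c_atlas c_atlas c_atlas])
  define D where "D = frechet_derivative m (at (x0, x0))"
  have "Ck_on (Suc 0) S m" using sm by (simp add: smooth_on_def del: Ck_on.simps)
  then have D: "(m has_derivative D) (at (x0, x0))"
    using S(2) by (simp add: D_def frechet_derivative_works)
  have mem: "chart_inv c x \<in> carrier G" if "x \<in> chart_image c" for x
    using chart_inv_mem[OF c_atlas that] chart_subset[OF c_atlas] by blast
  have op: "open (chart_image c)" by (rule chart_open[OF c_atlas])
  have D1: "D (u, 0) = u" for u
  proof -
    have 1: "((\<lambda>x. (x, x0)) has_derivative (\<lambda>u. (u, 0))) (at x0)"
      by (intro derivative_intros)
    have "((m \<circ> (\<lambda>x. (x, x0))) has_derivative (D \<circ> (\<lambda>u. (u, 0)))) (at x0)"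
      by (rule diff_chain_at[OF 1]) (rule D)
    moreover have "((m \<circ> (\<lambda>x. (x, x0))) has_derivative (\<lambda>u. u)) (at x0)"
    proof (rule has_derivative_transform_within_open[OF has_derivative_ident op x0(1)])
      show "x = (m \<circ> (\<lambda>x. (x, x0))) x" if "x \<in> chart_image c" for x
        using mem[OF that] by (simp add: m_def x0(2) chart_chart_inv[OF c_atlas that])
    qed
    ultimately have "D \<circ> (\<lambda>u. (u, 0)) = (\<lambda>u. u)" by (rule has_derivative_unique)
    from fun_cong[OF this, of u] show ?thesis by simp
  qed
  have D2: "D (0, u) = u" for u
  proof -
    have 1: "((\<lambda>x. (x0, x)) has_derivative (\<lambda>u. (0, u))) (at x0)"
      by (intro derivative_intros)
    have "((m \<circ> (\<lambda>x. (x0, x))) has_derivative (D \<circ> (\<lambda>u. (0, u)))) (at x0)"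
      by (rule diff_chain_at[OF 1]) (rule D)
    moreover have "((m \<circ> (\<lambda>x. (x0, x))) has_derivative (\<lambda>u. u)) (at x0)"
    proof (rule has_derivative_transform_within_open[OF has_derivative_ident op x0(1)])
      show "x = (m \<circ> (\<lambda>x. (x0, x))) x" if "x \<in> chart_image c" for x
        using mem[OF that] by (simp add: m_def x0(2) chart_chart_inv[OF c_atlas that])
    qed
    ultimately have "D \<circ> (\<lambda>u. (0, u)) = (\<lambda>u. u)" by (rule has_derivative_unique)
    from fun_cong[OF this, of u] show ?thesis by simp
  qed
  have D_sum: "D (u, v) = u + v" for u v
    using linear_add[OF has_derivative_linear[OF D], of "(u, 0)" "(0, v)"] D1 D2 by simp
  obtain r C where rC: "0 < r" "0 \<le> C" "cball (x0, x0) r \<subseteq> S"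
    "\<And>R p q. R \<le> r \<Longrightarrow> p \<in> cball (x0, x0) R \<Longrightarrow> q \<in> cball (x0, x0) R \<Longrightarrow>
      norm (m p - m q - D (p - q)) \<le> C * R * norm (p - q)"
    unfolding D_def using C2_linear_remainder[OF S sm] by blast
  define r' where "r' = min (r / 2) (1 / (8 * (C + 1)))"
  have r': "0 < r'" "2 * r' \<le> r" "(2 * C) * r' \<le> 1 / 4"
  proof -
    show "0 < r'" "2 * r' \<le> r" using rC(1,2) by (auto simp: r'_def)
    have "(2 * C) * r' \<le> (2 * C) * (1 / (8 * (C + 1)))"
      using rC(2) by (intro mult_left_mono) (auto simp: r'_def)
    also have "\<dots> \<le> 1 / 4" using rC(2) by (simp add: field_simps)
    finally show "(2 * C) * r' \<le> 1 / 4" .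
  qed
  have ball: "(snd c g, snd c h) \<in> cball (x0, x0) (2 * R)" if "g \<in> near R" "h \<in> near R" for g h R
  proof -
    have "dist (x0, x0) (snd c g, snd c h) \<le> norm (coord g) + norm (coord h)"
      using norm_Pair_le[of "coord g" "coord h"]
      by (subst dist_commute) (simp add: dist_norm coord_def x0_def)
    also have "\<dots> \<le> 2 * R" using that by (auto simp: near_def)
    finally show ?thesis by simp
  qed
  have "local_law r' (2 * C)"
    unfolding local_law_def
  proof (intro conjI allI impI)
    show "snd c \<one> + x \<in> chart_image c" if "norm x \<le> r'" for x
    proof -
      have "(x0 + x, x0) \<in> cball (x0, x0) r"
        using r' that by (simp add: dist_norm norm_Pair)
      then show ?thesis using rC(3) by (auto simp: S_def x0_def)
    qed
  next
    fix R g h g' h' assume R: "R \<le> r'" and n: "g \<in> near R" "h \<in> near R" "g' \<in> near R" "h' \<in> near R"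
    have R2: "2 * R \<le> r" using R r' by simp
    have inS: "(snd c g, snd c h) \<in> S"
      using ball[OF n(1,2)] rC(3) R2 by (auto intro: order_trans)
    then show "g \<otimes> h \<in> fst c"
      using n by (auto simp: S_def near_def chart_inv_chart[OF c_atlas])
    have "norm (m (snd c g, snd c h) - m (snd c g', snd c h') - D ((snd c g, snd c h) - (snd c g', snd c h')))
        \<le> C * (2 * R) * norm ((snd c g, snd c h) - (snd c g', snd c h'))"
      by (rule rC(4)[OF R2 ball[OF n(1,2)] ball[OF n(3,4)]])
    also have "\<dots> \<le> C * (2 * R) * (norm (coord g - coord g') + norm (coord h - coord h'))"
    proof (rule mult_left_mono)
      show "norm ((snd c g, snd c h) - (snd c g', snd c h')) \<le> norm (coord g - coord g') + norm (coord h - coord h')"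
        using norm_Pair_le[of "coord g - coord g'" "coord h - coord h'"] by (simp add: coord_def)
      have "0 \<le> R" using n(1) norm_ge_zero[of "coord g"] by (simp add: near_def del: norm_ge_zero)
      then show "0 \<le> C * (2 * R)" using rC(2) by simp
    qed
    finally show "norm (coord (g \<otimes> h) - coord (g' \<otimes> h') - (coord g - coord g') - (coord h - coord h'))
        \<le> 2 * C * R * (norm (coord g - coord g') + norm (coord h - coord h'))"
      using n by (simp add: m_def D_sum coord_def near_def chart_inv_chart[OF c_atlas] algebra_simps)
  qed (use r' rC in auto)
  then show ?thesis by blast
qed


section \<open>Powers and inverses near the identity\<close>

lemma local_lawD:
  assumes "local_law r C"
  shows "0 < r" "0 \<le> C" "C * r \<le> 1 / 4"
    "norm x \<le> r \<Longrightarrow> snd c \<one> + x \<in> chart_image c"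
  using assms unfolding local_law_def by blast+

lemma local_law_difference:
  assumes "local_law r C" "R \<le> r" "g \<in> near R" "h \<in> near R" "g' \<in> near R" "h' \<in> near R"
  shows "norm (coord (g \<otimes> h) - coord (g' \<otimes> h') - (coord g - coord g') - (coord h - coord h'))
        \<le> C * R * (norm (coord g - coord g') + norm (coord h - coord h'))"
  using assms unfolding local_law_def by blast

lemma local_law_mult_mem:
  assumes "local_law r C" "g \<in> near r" "h \<in> near r"
  shows "g \<otimes> h \<in> fst c"
  using assms unfolding local_law_def by blast

lemma near_nonneg: "g \<in> near R \<Longrightarrow> 0 \<le> R"
  using norm_ge_zero[of "coord g"] by (simp add: near_def del: norm_ge_zero)

lemma local_law_mult_right:
  assumes "local_law r C" "R \<le> r" "g \<in> near R" "h \<in> near R"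
  shows "norm (coord (g \<otimes> h) - coord g - coord h) \<le> C * R * norm (coord h)"
  using local_law_difference[OF assms(1,2,3,4,3) one_near[OF near_nonneg[OF assms(3)]]]
    near_carrier[OF assms(3)] by simp

lemma local_law_mult_left:
  assumes "local_law r C" "R \<le> r" "g \<in> near R" "h \<in> near R"
  shows "norm (coord (g \<otimes> h) - coord g - coord h) \<le> C * R * norm (coord g)"
  using local_law_difference[OF assms(1,2,3,4) one_near[OF near_nonneg[OF assms(3)]] assms(4)]
    near_carrier[OF assms(4)] by (simp add: algebra_simps)

lemma local_law_constant_small:
  assumes "local_law r C" "0 \<le> R" "R \<le> r"
  shows "0 \<le> C * R" "C * R \<le> 1 / 4"
  using local_lawD(2,3)[OF assms(1)] assms(2,3) mult_left_mono[OF assms(3), of C] by auto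

lemma point_near:
  assumes "local_law r C" "norm x \<le> r"
  shows "point x \<in> near (norm x)" "coord (point x) = x"
proof -
  have x: "snd c \<one> + x \<in> chart_image c" by (rule local_lawD(4)[OF assms])
  show c: "coord (point x) = x"
    by (simp add: coord_def point_def chart_chart_inv[OF c_atlas x])
  show "point x \<in> near (norm x)"
    by (simp add: near_def c) (simp add: point_def chart_inv_mem[OF c_atlas x])
qed

lemma closed_near:
  assumes "local_law r C" "R \<le> r"
  shows "closed (near R)"
proof -
  have "near R = point ` cball 0 R"
  proof (intro equalityI subsetI)
    fix g assume "g \<in> near R"
    then show "g \<in> point ` cball 0 R"
      using point_coord[of g] by (intro image_eqI[of _ _ "coord g"]) (auto simp: near_def)
  next
    fix g assume "g \<in> point ` cball 0 R"
    then obtain x where "norm x \<le> R" "g = point x" by auto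
    then show "g \<in> near R"
      using point_near(1)[OF assms(1), of x] assms(2) near_mono by auto
  qed
  moreover have "continuous_on (cball 0 R) point"
    unfolding point_def
  proof (rule continuous_on_compose2[OF continuous_on_chart_inv[OF c_atlas]])
    show "(+) (snd c \<one>) ` cball 0 R \<subseteq> chart_image c"
      using local_lawD(4)[OF assms(1)] assms(2) by (intro image_subsetI) simp
  qed (intro continuous_intros)
  ultimately show ?thesis
    using compact_continuous_image compact_cball compact_imp_closed by metis
qed

lemma tendsto_one_if_coord:
  assumes "local_law r C" "eventually (\<lambda>x. f x \<in> near r) F" "((\<lambda>x. coord (f x)) \<longlongrightarrow> 0) F"
  shows "(f \<longlongrightarrow> \<one>) F"
proof -
  have "((\<lambda>x. snd c \<one> + coord (f x)) \<longlongrightarrow> snd c \<one> + 0) F"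
    by (intro tendsto_intros assms)
  then have "((\<lambda>x. snd c \<one> + coord (f x)) \<longlongrightarrow> snd c \<one>) F" by simp
  then have "((\<lambda>x. point (coord (f x))) \<longlongrightarrow> chart_inv c (snd c \<one>)) F"
    unfolding point_def
    by (rule tendsto_compose_within[OF continuous_on_chart_inv[OF c_atlas]])
      (use assms(2) one_in_chart in \<open>auto simp: near_def coord_def chart_mem c_atlas elim: eventually_mono\<close>)
  then have "((\<lambda>x. point (coord (f x))) \<longlongrightarrow> \<one>) F"
    by (simp add: chart_inv_chart[OF c_atlas one_in_chart])
  then show ?thesis
    by (rule Lim_transform_eventually) (use assms(2) in \<open>auto simp: near_def point_coord elim: eventually_mono\<close>)
qed

text \<open>As long as the powers stay small, the errors of the individual multiplications are at most
\<open>C * R * d\<close> with \<open>R\<close> growing linearly in \<open>k\<close>, so that they sum to a quantity quadratic in \<open>k * d\<close>.\<close>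

lemma power_near:
  assumes law: "local_law r C" and g: "g \<in> fst c" and k: "2 * real k * norm (coord g) \<le> r"
  shows "g [^] k \<in> near (2 * real k * norm (coord g)) \<and>
    norm (coord (g [^] k) - real k *\<^sub>R coord g) \<le> 2 * C * (real k)\<^sup>2 * (norm (coord g))\<^sup>2"
  using k
proof (induction k)
  case 0
  show ?case using one_near[of 0] by simp
next
  case (Suc k)
  define d where "d = norm (coord g)"
  define R where "R = 2 * real (Suc k) * d"
  have d0: "0 \<le> d" by (simp add: d_def)
  have R: "0 \<le> R" "R \<le> r" using Suc.prems d0 by (auto simp: R_def d_def)
  have le: "2 * real k * d \<le> R" "d \<le> R" using d0 by (auto simp: R_def algebra_simps)
  have IH: "g [^] k \<in> near (2 * real k * d)"
    "norm (coord (g [^] k) - real k *\<^sub>R coord g) \<le> 2 * C * (real k)\<^sup>2 * d\<^sup>2"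
    using Suc.IH le R by (auto simp: d_def)
  have n: "g [^] k \<in> near R" "g \<in> near R"
    using IH(1) le g by (auto simp: near_def d_def)
  have est: "norm (coord (g [^] k \<otimes> g) - coord (g [^] k) - coord g) \<le> C * R * d"
    using local_law_mult_right[OF law R(2) n] by (simp add: d_def)
  have in_c: "g [^] k \<otimes> g \<in> fst c"
    using local_law_mult_mem[OF law] n R(2) near_mono by blast
  have "norm (coord (g [^] k \<otimes> g)) \<le> norm (coord (g [^] k \<otimes> g) - coord (g [^] k) - coord g) + norm (coord (g [^] k)) + d"
    using norm_triangle_ineq[of "coord (g [^] k \<otimes> g) - coord (g [^] k) - coord g" "coord (g [^] k) + coord g"]
      norm_triangle_ineq[of "coord (g [^] k)" "coord g"] by (simp add: d_def)
  also have "\<dots> \<le> (1 / 4) * d + 2 * real k * d + d"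
    using est IH(1) mult_right_mono[OF local_law_constant_small(2)[OF law R] d0] by (auto simp: near_def)
  also have "\<dots> \<le> R" using d0 by (simp add: R_def algebra_simps)
  finally have 1: "g [^] Suc k \<in> near R" using in_c by (simp add: near_def)
  have "norm (coord (g [^] Suc k) - real (Suc k) *\<^sub>R coord g)
      \<le> norm (coord (g [^] k \<otimes> g) - coord (g [^] k) - coord g) + norm (coord (g [^] k) - real k *\<^sub>R coord g)"
    using norm_triangle_ineq[of "coord (g [^] k \<otimes> g) - coord (g [^] k) - coord g" "coord (g [^] k) - real k *\<^sub>R coord g"]
    by (simp add: algebra_simps)
  also have "\<dots> \<le> C * R * d + 2 * C * (real k)\<^sup>2 * d\<^sup>2" using est IH(2) by linarith
  also have "\<dots> = 2 * C * d\<^sup>2 * ((real k)\<^sup>2 + real k + 1)"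
    by (simp add: R_def power2_eq_square algebra_simps)
  also have "\<dots> \<le> 2 * C * d\<^sup>2 * (real (Suc k))\<^sup>2"
    using local_lawD(2)[OF law] by (intro mult_left_mono) (auto simp: power2_eq_square algebra_simps)
  finally show ?case using 1 by (simp add: R_def d_def mult_ac)
qed

text \<open>Both estimates come from the expansion of \<open>g \<otimes> inv g = \<one>\<close>: first with the fixed radius \<open>r\<close> to
see that the inverse is not much larger, then with a radius proportional to \<open>g\<close>.\<close>

lemma inv_near:
  assumes law: "local_law r C" and g: "g \<in> near r" "inv g \<in> near r" and s: "2 * norm (coord g) \<le> r"
  shows "norm (coord (inv g)) \<le> 2 * norm (coord g)"
    "norm (coord g + coord (inv g)) \<le> 2 * C * (norm (coord g))\<^sup>2"
proof -
  have gi: "g \<otimes> inv g = \<one>" using near_carrier[OF g(1)] by simp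
  have "norm (coord g + coord (inv g)) \<le> C * r * norm (coord g)"
    using local_law_mult_left[OF law order_refl g] by (simp add: gi norm_minus_commute algebra_simps)
      (metis norm_minus_cancel minus_add_distrib uminus_add_conv_diff add.commute)
  also have "\<dots> \<le> 1 / 4 * norm (coord g)"
    by (intro mult_right_mono local_lawD(3)[OF law]) simp
  finally have *: "norm (coord g + coord (inv g)) \<le> 1 / 4 * norm (coord g)" .
  show le: "norm (coord (inv g)) \<le> 2 * norm (coord g)"
  proof -
    have "norm (coord (inv g)) \<le> norm (coord g + coord (inv g)) + norm (coord g)"
      using norm_triangle_ineq4[of "coord g + coord (inv g)" "coord g"] by simp
    also have "\<dots> \<le> 2 * norm (coord g)" using * norm_ge_zero[of "coord g"] by linarith
    finally show ?thesis .
  qed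
  have n: "g \<in> near (2 * norm (coord g))" "inv g \<in> near (2 * norm (coord g))"
    using g le by (auto simp: near_def)
  have "norm (coord \<one> - coord g - coord (inv g)) \<le> C * (2 * norm (coord g)) * norm (coord g)"
    using local_law_mult_left[OF law s n] unfolding gi .
  moreover have "norm (coord \<one> - coord g - coord (inv g)) = norm (coord g + coord (inv g))"
    using norm_minus_cancel[of "coord g + coord (inv g)"] by simp
  ultimately show "norm (coord g + coord (inv g)) \<le> 2 * C * (norm (coord g))\<^sup>2"
    by (simp add: power2_eq_square mult_ac)
qed

section \<open>One-parameter subgroups and the exponential map\<close>

lemma one_parameter_subgroupD:
  assumes "one_parameter_subgroup G \<gamma>"
  shows "\<gamma> s \<in> carrier G" "continuous_on UNIV \<gamma>" "\<gamma> (s + t) = \<gamma> s \<otimes> \<gamma> t" "\<gamma> 0 = \<one>"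
    "\<gamma> (- s) = inv (\<gamma> s)" "(\<gamma> \<longlongrightarrow> \<gamma> s) (at s within S)"
proof -
  show 1: "\<gamma> s \<in> carrier G" for s using assms by (auto simp: one_parameter_subgroup_def)
  show c: "continuous_on UNIV \<gamma>" using assms by (auto simp: one_parameter_subgroup_def)
  show add: "\<gamma> (s + t) = \<gamma> s \<otimes> \<gamma> t" for s t using assms by (auto simp: one_parameter_subgroup_def)
  show 0: "\<gamma> 0 = \<one>"
    using add[of 0 0] 1[of 0] by (metis add_0 l_cancel_one')
  have "\<gamma> (- s) \<otimes> \<gamma> s = \<one>" using add[of "- s" s] 0 by simp
  then show "\<gamma> (- s) = inv (\<gamma> s)" using 1 inv_equality by metis
  show "(\<gamma> \<longlongrightarrow> \<gamma> s) (at s within S)"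
    using c by (meson continuous_on_def UNIV_I tendsto_within_subset subset_UNIV)
qed

text \<open>The limit of the step functions \<open>u n\<close> is additive because exponents \<open>\<lfloor>n s\<rfloor>\<close>
are additive up to one factor \<open>g n\<close>, which tends to the identity. The quadratic bound for powers
survives in the limit and shows that the velocity is \<open>A\<close>. It only concerns nonnegative times;
negative times are reached through the estimate for inverses.\<close>

proposition one_parameter_subgroup_exists:
  "\<exists>\<gamma>. one_parameter_subgroup G \<gamma> \<and> ((snd c \<circ> \<gamma>) has_vector_derivative A) (at 0)"
proof -
  obtain r C where law: "local_law r C" using ex_local_law by blast
  note r0 = local_lawD(1)[OF law] and C0 = local_lawD(2)[OF law]
  \<comment> \<open>The default value \<open>0\<close> keeps \<open>g n\<close> in the group for the finitely many \<open>n\<close> with \<open>A / n\<close> outside the chart.\<close>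
  define g where "g n = point (if norm ((1 / real n) *\<^sub>R A) \<le> r then (1 / real n) *\<^sub>R A else 0)" for n
  have g_c: "g n \<in> fst c" for n
    using point_near(1)[OF law] r0 by (auto simp: g_def near_def)
  then have gG: "g n \<in> carrier G" for n using chart_subset[OF c_atlas] by blast
  have limA: "(\<lambda>n. (1 / real n) *\<^sub>R A) \<longlonglongrightarrow> 0"
    using tendsto_scaleR[OF lim_1_over_n tendsto_const[of A]] by simp
  have ev: "\<forall>\<^sub>F n in sequentially. norm ((1 / real n) *\<^sub>R A) \<le> r"
    using order_tendstoD(2)[OF tendsto_norm_zero[OF limA] r0] by (rule eventually_mono) simp
  have coord_g: "\<forall>\<^sub>F n in sequentially. coord (g n) = (1 / real n) *\<^sub>R A"
    using ev by (rule eventually_mono) (simp add: g_def point_near(2)[OF law])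
  have g_lim: "g \<longlonglongrightarrow> \<one>"
  proof (rule tendsto_one_if_coord[OF law])
    show "\<forall>\<^sub>F n in sequentially. g n \<in> near r"
      using ev coord_g by eventually_elim (simp add: near_def g_c)
    show "(\<lambda>n. coord (g n)) \<longlonglongrightarrow> 0"
      using limA by (rule Lim_transform_eventually) (use coord_g in \<open>auto elim: eventually_mono\<close>)
  qed
  define u where "u n t = g n [^] \<lfloor>real n * t\<rfloor>" for n t
  have uG: "u n t \<in> carrier G" for n t using gG by (simp add: u_def)
  obtain \<gamma> H where H: "H \<noteq> bot" "H \<le> sequentially" and \<gamma>G: "\<And>t. \<gamma> t \<in> carrier G"
    and lim: "\<And>t. ((\<lambda>n. u n t) \<longlongrightarrow> \<gamma> t) H"
    by (rule compact_pointwise_cluster[where u = u, OF compact_carrier uG]) (rule that; assumption)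
  have g_limH: "(g \<longlongrightarrow> \<one>) H" using g_lim H(2) tendsto_mono by blast
  have add: "\<gamma> (s + t) = \<gamma> s \<otimes> \<gamma> t" for s t
  proof -
    define e where "e n = \<lfloor>real n * (s + t)\<rfloor> - \<lfloor>real n * s\<rfloor> - \<lfloor>real n * t\<rfloor>" for n
    have "e n = 0 \<or> e n = 1" for n
      unfolding e_def distrib_left by linarith
    then have ge: "g n [^] e n = (if e n = 0 then \<one> else g n)" for n
      using gG by (metis int_pow_0 int_pow_1)
    have "((\<lambda>n. g n [^] e n) \<longlongrightarrow> \<one>) H"
      unfolding ge by (rule filterlim_If) (auto intro: tendsto_mono[OF _ g_limH])
    then have "((\<lambda>n. u n s \<otimes> u n t \<otimes> g n [^] e n) \<longlongrightarrow> \<gamma> s \<otimes> \<gamma> t \<otimes> \<one>) H"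
      using lim gG uG \<gamma>G by (intro tendsto_group_mult) auto
    moreover have "u n s \<otimes> u n t \<otimes> g n [^] e n = u n (s + t)" for n
      using gG[of n] by (simp add: u_def e_def int_pow_mult[symmetric])
    ultimately have "((\<lambda>n. u n (s + t)) \<longlongrightarrow> \<gamma> s \<otimes> \<gamma> t) H" using \<gamma>G by simp
    then show ?thesis using tendsto_unique[OF H(1) lim] by blast
  qed
  define a where "a = norm A"
  have pos: "\<gamma> t \<in> near (2 * t * a) \<and> norm (coord (\<gamma> t) - t *\<^sub>R A) \<le> 2 * C * (t * a)\<^sup>2"
    if t: "0 \<le> t" "2 * t * a \<le> r" for t
  proof -
    define k where "k n = nat \<lfloor>real n * t\<rfloor>" for n
    have u_eq: "u n t = g n [^] k n" for n
      using t by (simp add: u_def k_def int_pow_int[symmetric])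
    have k_le: "real (k n) \<le> real n * t" for n
      using t by (simp add: k_def)
    have ev1: "\<forall>\<^sub>F n in H. u n t \<in> near (2 * t * a) \<and>
        norm (coord (u n t) - (real (k n) / real n) *\<^sub>R A) \<le> 2 * C * (t * a)\<^sup>2"
    proof (rule filter_leD[OF H(2)])
      show "\<forall>\<^sub>F n in sequentially. u n t \<in> near (2 * t * a) \<and>
        norm (coord (u n t) - (real (k n) / real n) *\<^sub>R A) \<le> 2 * C * (t * a)\<^sup>2"
        using coord_g eventually_gt_at_top[of 0]
      proof eventually_elim
        case (elim n)
        have nn: "norm (coord (g n)) = a / real n" using elim by (simp add: a_def)
        have kt: "real (k n) * norm (coord (g n)) \<le> t * a"
        proof -
          have "real (k n) * (a / real n) \<le> (real n * t) * (a / real n)"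
            by (intro mult_right_mono k_le) (simp add: a_def)
          then show ?thesis unfolding nn using elim(2) by simp
        qed
        then have le: "2 * real (k n) * norm (coord (g n)) \<le> 2 * t * a" by simp
        from power_near[OF law g_c order_trans[OF le t(2)]]
        have p: "u n t \<in> near (2 * real (k n) * norm (coord (g n)))"
          "norm (coord (u n t) - real (k n) *\<^sub>R coord (g n)) \<le> 2 * C * (real (k n))\<^sup>2 * (norm (coord (g n)))\<^sup>2"
          by (simp_all add: u_eq)
        have "2 * C * (real (k n))\<^sup>2 * (norm (coord (g n)))\<^sup>2 = 2 * C * (real (k n) * norm (coord (g n)))\<^sup>2"
          by (simp add: power_mult_distrib)
        also have "\<dots> \<le> 2 * C * (t * a)\<^sup>2"
          using kt C0 by (intro mult_left_mono power_mono) auto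
        finally show ?case using p elim near_mono[OF p(1) le] by simp
      qed
    qed
    have "eventually (\<lambda>n. u n t \<in> near (2 * t * a)) H" using ev1 by (rule eventually_mono) simp
    then have mem: "\<gamma> t \<in> near (2 * t * a)"
      using Lim_in_closed_set[OF closed_near[OF law t(2)] _ H(1) lim] by blast
    have "(\<lambda>n. real (k n) / real n) \<longlonglongrightarrow> t"
    proof (rule real_tendsto_sandwich[of "\<lambda>n. t - 1 / real n" _ _ "\<lambda>_. t"])
      show "\<forall>\<^sub>F n in sequentially. t - 1 / real n \<le> real (k n) / real n"
        using eventually_gt_at_top[of 0]
      proof eventually_elim
        case (elim n)
        have "real n * t - 1 \<le> real (k n)" unfolding k_def by linarith
        then have "(real n * t - 1) / real n \<le> real (k n) / real n"
          by (rule divide_right_mono) simp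
        then show ?case using elim by (simp add: diff_divide_distrib)
      qed
      show "\<forall>\<^sub>F n in sequentially. real (k n) / real n \<le> t"
        using eventually_gt_at_top[of 0] by eventually_elim (use k_le in \<open>simp add: field_simps\<close>)
      show "(\<lambda>n. t - 1 / real n) \<longlonglongrightarrow> t"
        using tendsto_diff[OF tendsto_const[of t] lim_1_over_n] by simp
    qed simp
    then have kH: "((\<lambda>n. real (k n) / real n) \<longlongrightarrow> t) H" using H(2) tendsto_mono by blast
    have "((\<lambda>n. norm (coord (u n t) - (real (k n) / real n) *\<^sub>R A)) \<longlongrightarrow> norm (coord (\<gamma> t) - t *\<^sub>R A)) H"
      using mem by (intro tendsto_intros tendsto_coord[OF lim] kH) (auto simp: uG near_def)
    then have "norm (coord (\<gamma> t) - t *\<^sub>R A) \<le> 2 * C * (t * a)\<^sup>2"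
      by (rule tendsto_upperbound) (use ev1 H(1) in \<open>auto elim: eventually_mono\<close>)
    then show ?thesis using mem by blast
  qed
  have \<gamma>0: "\<gamma> 0 = \<one>" using add[of 0 0] \<gamma>G[of 0] by (metis add_0 l_cancel_one')
  have neg: "\<gamma> (- s) = inv (\<gamma> s)" for s
    using add[of "- s" s] \<gamma>0 \<gamma>G inv_equality by (metis add.left_inverse)
  \<comment> \<open>With this bound on \<open>t\<close>, both \<open>\<gamma> t\<close> and its inverse fall under the estimates.\<close>
  define t0 where "t0 = r / 4 / (a + 1)"
  have t0: "t0 > 0" "4 * t0 * a \<le> r"
  proof -
    have "0 \<le> a" by (simp add: a_def)
    then have a1: "0 < a + 1" by simp
    then show "t0 > 0" using r0 by (simp add: t0_def)
    have "4 * t0 * a = (4 * (r / 4)) * a / (a + 1)" unfolding t0_def by (simp only: times_divide_eq_left times_divide_eq_right)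
    also have "\<dots> = r * (a / (a + 1))" by simp
    also have "\<dots> \<le> r * 1" using a1 \<open>0 \<le> a\<close> r0 by (intro mult_left_mono) auto
    finally show "4 * t0 * a \<le> r" by simp
  qed
  have near_t: "2 * t * a \<le> r" "4 * t * a \<le> r" if "0 \<le> t" "t \<le> t0" for t
  proof -
    have "t * a \<le> t0 * a" using that by (intro mult_right_mono) (auto simp: a_def)
    then show "4 * t * a \<le> r" using t0(2) by linarith
    moreover have "0 \<le> t * a" using that by (simp add: a_def)
    ultimately show "2 * t * a \<le> r" by linarith
  qed
  have right: "(\<gamma> \<longlongrightarrow> \<one>) (at_right 0)"
  proof (rule tendsto_one_if_coord[OF law])
    have ev2: "\<forall>\<^sub>F t in at_right 0. 0 \<le> t \<and> t \<le> t0"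
      using eventually_at_right_real[OF t0(1)] by (rule eventually_mono) auto
    show "\<forall>\<^sub>F t in at_right 0. \<gamma> t \<in> near r"
      using ev2 by (rule eventually_mono) (use pos near_t near_mono in blast)
    show "((\<lambda>t. coord (\<gamma> t)) \<longlongrightarrow> 0) (at_right 0)"
    proof (rule Lim_null_comparison[where g = "\<lambda>t. 2 * t * a"])
      show "\<forall>\<^sub>F t in at_right 0. norm (coord (\<gamma> t)) \<le> 2 * t * a"
        using ev2 by (rule eventually_mono) (use pos near_t in \<open>auto simp: near_def\<close>)
      show "((\<lambda>t. 2 * t * a) \<longlongrightarrow> 0) (at_right 0)"
        by (auto intro!: tendsto_eq_intros)
    qed
  qed
  then have "((\<lambda>t. inv (\<gamma> t)) \<longlongrightarrow> inv \<one>) (at_right 0)"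
    by (rule tendsto_group_inv) (use \<gamma>G in auto)
  then have right': "((\<lambda>t. \<gamma> (- t)) \<longlongrightarrow> \<one>) (at_right 0)" by (simp add: neg)
  define K where "K = 10 * C * a\<^sup>2"
  have quad_pos: "norm (coord (\<gamma> t) - t *\<^sub>R A) \<le> K * t\<^sup>2" if "0 \<le> t" "t \<le> t0" for t
  proof -
    have "norm (coord (\<gamma> t) - t *\<^sub>R A) \<le> 2 * C * (t * a)\<^sup>2" using pos near_t that by blast
    also have "\<dots> \<le> K * t\<^sup>2" using C0 by (simp add: K_def power_mult_distrib)
    finally show ?thesis .
  qed
  have ev_right: "\<forall>\<^sub>F t in at_right 0. norm (coord (\<gamma> t) - t *\<^sub>R A) \<le> K * t\<^sup>2"
    using eventually_at_right_real[OF t0(1)] by (rule eventually_mono) (use quad_pos in auto)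
  have near': "\<forall>\<^sub>F t in at_right 0. \<gamma> (- t) \<in> near r"
    by (rule eventually_near[OF right' _ r0]) (use \<gamma>G in auto)
  have ev_right': "\<forall>\<^sub>F t in at_right 0. norm (coord (\<gamma> (- t)) - (- t) *\<^sub>R A) \<le> K * (- t)\<^sup>2"
    using eventually_at_right_real[OF t0(1)] near'
  proof eventually_elim
    case (elim t)
    then have t: "0 \<le> t" "t \<le> t0" by auto
    have n: "\<gamma> t \<in> near (2 * t * a)" "norm (coord (\<gamma> t) - t *\<^sub>R A) \<le> 2 * C * (t * a)\<^sup>2"
      using pos near_t t by blast+
    have n': "norm (coord (\<gamma> t)) \<le> 2 * t * a" using n by (simp add: near_def)
    have "norm (coord (\<gamma> t) + coord (inv (\<gamma> t))) \<le> 2 * C * (norm (coord (\<gamma> t)))\<^sup>2"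
    proof (rule inv_near(2)[OF law])
      show "\<gamma> t \<in> near r" using n(1) near_t(1)[OF t] near_mono by blast
      show "inv (\<gamma> t) \<in> near r" using elim \<gamma>G by (simp add: neg)
      show "2 * norm (coord (\<gamma> t)) \<le> r" using n' near_t(2)[OF t] by linarith
    qed
    also have "\<dots> \<le> 2 * C * (2 * t * a)\<^sup>2"
      using n' C0 by (intro mult_left_mono power_mono) auto
    finally have 1: "norm (coord (\<gamma> t) + coord (\<gamma> (- t))) \<le> 8 * C * (t * a)\<^sup>2"
      by (simp add: neg power_mult_distrib)
    have "norm (coord (\<gamma> (- t)) - (- t) *\<^sub>R A) \<le> norm (coord (\<gamma> t) + coord (\<gamma> (- t))) + norm (coord (\<gamma> t) - t *\<^sub>R A)"
      using norm_triangle_ineq4[of "coord (\<gamma> t) + coord (\<gamma> (- t))" "coord (\<gamma> t) - t *\<^sub>R A"] by simp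
    also have "\<dots> \<le> 8 * C * (t * a)\<^sup>2 + 2 * C * (t * a)\<^sup>2" by (rule add_mono[OF 1 n(2)])
    also have "\<dots> = K * (- t)\<^sup>2" by (simp add: K_def power_mult_distrib)
    finally show ?case .
  qed
  have ev_all: "\<forall>\<^sub>F t in at 0. norm (coord (\<gamma> t) - t *\<^sub>R A) \<le> K * t\<^sup>2"
    unfolding eventually_at_split eventually_at_left_to_right
    using ev_right ev_right' by simp
  have "((\<lambda>t. coord (\<gamma> t)) has_vector_derivative A) (at 0)"
    by (rule has_vector_derivative_at_0_quadraticI[OF _ ev_all]) (simp add: \<gamma>0)
  from has_vector_derivative_add_const[THEN iffD2, OF this, of "snd c \<one>"]
  have deriv: "((snd c \<circ> \<gamma>) has_vector_derivative A) (at 0)"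
    by (simp add: coord_def o_def)
  have "(\<gamma> \<longlongrightarrow> \<one>) (at 0)"
    using right right' unfolding filterlim_at_split filterlim_at_left_to_right by simp
  then have "((\<lambda>h. \<gamma> t \<otimes> \<gamma> h) \<longlongrightarrow> \<gamma> t \<otimes> \<one>) (at 0)" for t
    using \<gamma>G by (intro tendsto_group_mult) auto
  then have "((\<lambda>h. \<gamma> (t + h)) \<longlongrightarrow> \<gamma> t) (at 0)" for t
    using \<gamma>G by (simp add: add)
  then have "isCont \<gamma> t" for t
    by (simp add: isCont_def LIM_offset_zero_iff[of t])
  then have "continuous_on UNIV \<gamma>" by (simp add: continuous_at_imp_continuous_on)
  then have "one_parameter_subgroup G \<gamma>"
    using \<gamma>G add by (auto simp: one_parameter_subgroup_def)
  then show ?thesis using deriv by blast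
qed


lemma coord_has_vector_derivative_iff:
  "((\<lambda>s. coord (f s)) has_vector_derivative A) F \<longleftrightarrow> ((snd c \<circ> f) has_vector_derivative A) F"
  unfolding coord_def diff_conv_add_uminus has_vector_derivative_add_const by (simp add: o_def)

lemma one_parameter_subgroup_multiple:
  assumes "one_parameter_subgroup G \<gamma>"
  shows "\<gamma> (real n * s) = \<gamma> s [^] n"
proof (induction n)
  case 0
  then show ?case using one_parameter_subgroupD(4)[OF assms] by simp
next
  case (Suc n)
  have "\<gamma> (real (Suc n) * s) = \<gamma> (real n * s + s)" by (simp add: algebra_simps)
  then show ?case using Suc one_parameter_subgroupD(3)[OF assms] by simp
qed

text \<open>Let \<open>e s\<close> be the distance of the two curves in coordinates. Since \<open>\<gamma> (2 * s)\<close> is the square of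
\<open>\<gamma> s\<close>, the expansion of the product gives \<open>e (2 * s) \<le> 2 * (1 + C * L * s) * e s\<close>. Iterating
downwards bounds \<open>e s\<close> by a constant multiple of \<open>2 ^ n * e (s / 2 ^ n)\<close>, which tends to \<open>0\<close> as
the curves are tangent. Powers then propagate equality from small to all times.\<close>

proposition one_parameter_subgroup_unique:
  assumes \<gamma>: "one_parameter_subgroup G \<gamma>" "((snd c \<circ> \<gamma>) has_vector_derivative A) (at 0)"
    and \<delta>: "one_parameter_subgroup G \<delta>" "((snd c \<circ> \<delta>) has_vector_derivative A) (at 0)"
  shows "\<gamma> = \<delta>"
proof -
  obtain r C where law: "local_law r C" using ex_local_law by blast
  note r0 = local_lawD(1)[OF law] and C0 = local_lawD(2)[OF law]
  note \<gamma>D = one_parameter_subgroupD[OF \<gamma>(1)] and \<delta>D = one_parameter_subgroupD[OF \<delta>(1)]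
  define L where "L = norm A + 1"
  have L: "L > 0" by (simp add: L_def add_nonneg_pos)
  have quot: "((\<lambda>s. coord (\<theta> s) /\<^sub>R s) \<longlongrightarrow> A) (at_right 0)"
    and small: "\<forall>\<^sub>F s in at_right 0. \<theta> s \<in> near (L * s)"
    if \<theta>: "one_parameter_subgroup G \<theta>" "((snd c \<circ> \<theta>) has_vector_derivative A) (at 0)" for \<theta>
  proof -
    have "((\<lambda>s. coord (\<theta> s)) has_vector_derivative A) (at 0 within {0<..})"
      using \<theta>(2) has_vector_derivative_at_within unfolding coord_has_vector_derivative_iff by blast
    then show q: "((\<lambda>s. coord (\<theta> s) /\<^sub>R s) \<longlongrightarrow> A) (at_right 0)"
      unfolding has_vector_derivative_iff_quotient_tendsto
      using one_parameter_subgroupD(4)[OF \<theta>(1)] by simp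
    have "\<forall>\<^sub>F s in at_right 0. norm (coord (\<theta> s) /\<^sub>R s) < L"
      using tendsto_norm[OF q] by (rule order_tendstoD) (simp add: L_def)
    moreover have "\<forall>\<^sub>F s in at_right 0. \<theta> s \<in> near r"
      using one_parameter_subgroupD[OF \<theta>(1)]
      by (intro eventually_near r0) (auto, metis)
    ultimately show "\<forall>\<^sub>F s in at_right 0. \<theta> s \<in> near (L * s)"
      using eventually_at_right_less
    proof eventually_elim
      case (elim s)
      then show ?case by (simp add: near_def field_simps)
    qed
  qed
  have "\<forall>\<^sub>F s in at_right 0. \<gamma> s \<in> near (L * s) \<and> \<delta> s \<in> near (L * s) \<and> s < r / L"
    using small[OF \<gamma>] small[OF \<delta>] eventually_at_right_real[of 0 "r / L"] r0 L
    by (auto elim: eventually_elim2 simp: eventually_conj_iff elim!: eventually_mono)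
  then obtain t1 where t1: "t1 > 0" and t1': "\<And>s. 0 < s \<Longrightarrow> s < t1 \<Longrightarrow>
      \<gamma> s \<in> near (L * s) \<and> \<delta> s \<in> near (L * s) \<and> s < r / L"
    unfolding eventually_at_right_field by auto
  define e where "e s = norm (coord (\<gamma> s) - coord (\<delta> s))" for s
  \<comment> \<open>The exponential factor absorbs the infinite product of the factors \<open>1 + C * L * s / 2 ^ n\<close>.\<close>
  define f where "f s = exp (- (C * L * s)) * e s" for s
  have double: "f (2 * s) \<le> 2 * f s" if s: "0 < s" "s < t1" for s
  proof -
    have n: "\<gamma> s \<in> near (L * s)" "\<delta> s \<in> near (L * s)" and Ls: "L * s \<le> r"
      using t1'[OF s] L by (auto simp: field_simps)
    have sq: "\<gamma> s \<otimes> \<gamma> s = \<gamma> (2 * s)" "\<delta> s \<otimes> \<delta> s = \<delta> (2 * s)"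
      using \<gamma>D(3)[of s s] \<delta>D(3)[of s s] by simp_all
    define x where "x = coord (\<gamma> s) - coord (\<delta> s)"
    define y where "y = coord (\<gamma> (2 * s)) - coord (\<delta> (2 * s))"
    have "norm (y - x - x) \<le> C * (L * s) * (norm x + norm x)"
      using local_law_difference[OF law Ls n(1) n(1) n(2) n(2)] unfolding sq x_def y_def .
    moreover have "norm y \<le> norm (y - x - x) + (norm x + norm x)"
      using norm_triangle_ineq[of "y - x - x" "x + x"] norm_triangle_ineq[of x x] by simp
    ultimately have "norm y \<le> 2 * (1 + C * L * s) * norm x"
      by (simp add: algebra_simps)
    then have "e (2 * s) \<le> 2 * (1 + C * L * s) * e s"
      by (simp only: e_def x_def y_def)
    also have "\<dots> \<le> 2 * exp (C * L * s) * e s"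
      by (intro mult_right_mono mult_left_mono exp_ge_add_one_self) (auto simp: e_def)
    finally have "exp (- (C * L * (2 * s))) * e (2 * s) \<le> exp (- (C * L * (2 * s))) * (2 * exp (C * L * s) * e s)"
      by (rule mult_left_mono) simp
    also have "\<dots> = 2 * (exp (- (C * L * (2 * s)) + C * L * s) * e s)"
      by (simp only: exp_add mult_ac)
    also have "\<dots> = 2 * f s" by (simp add: f_def algebra_simps)
    finally show ?thesis by (simp only: f_def)
  qed
  have halve: "f s \<le> 2 ^ n * f (s / 2 ^ n)" if s: "0 < s" "s < t1" for s n
  proof (induction n)
    case (Suc n)
    have "s / 2 ^ Suc n \<le> s" using s one_le_power[of "2::real" "Suc n"]
      by (simp add: divide_le_eq mult_le_cancel_left1 del: power_Suc)
    then have "f (2 * (s / 2 ^ Suc n)) \<le> 2 * f (s / 2 ^ Suc n)"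
      using s by (intro double) auto
    then have "2 ^ n * f (s / 2 ^ n) \<le> 2 ^ n * (2 * f (s / 2 ^ Suc n))"
      by (intro mult_left_mono) auto
    from order_trans[OF Suc this] show ?case by (simp add: mult_ac)
  qed simp
  have eq_small: "\<gamma> s = \<delta> s" if s: "0 < s" "s < t1" for s
  proof -
    have "((\<lambda>s. coord (\<gamma> s) /\<^sub>R s - coord (\<delta> s) /\<^sub>R s) \<longlongrightarrow> A - A) (at_right 0)"
      by (intro tendsto_diff quot \<gamma> \<delta>)
    then have q0: "((\<lambda>s. norm (coord (\<gamma> s) /\<^sub>R s - coord (\<delta> s) /\<^sub>R s)) \<longlongrightarrow> 0) (at_right 0)"
      using tendsto_norm_zero by simp
    have "(\<lambda>n. s * (1 / 2) ^ n) \<longlonglongrightarrow> s * 0"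
      by (intro tendsto_mult tendsto_const LIMSEQ_power_zero) simp
    then have "filterlim (\<lambda>n. s / 2 ^ n) (at_right 0) sequentially"
      using s by (simp add: filterlim_at power_divide)
    from filterlim_compose[OF q0 this]
    have "(\<lambda>n. norm (coord (\<gamma> (s / 2 ^ n)) /\<^sub>R (s / 2 ^ n) - coord (\<delta> (s / 2 ^ n)) /\<^sub>R (s / 2 ^ n))) \<longlonglongrightarrow> 0" .
    moreover have "norm (coord (\<gamma> (s / 2 ^ n)) /\<^sub>R (s / 2 ^ n) - coord (\<delta> (s / 2 ^ n)) /\<^sub>R (s / 2 ^ n))
        = 2 ^ n * e (s / 2 ^ n) / s" for n
      using s by (simp add: e_def flip: scaleR_diff_right)
    ultimately have "(\<lambda>n. 2 ^ n * e (s / 2 ^ n) / s) \<longlonglongrightarrow> 0" by simp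
    then have lim: "(\<lambda>n. s * (2 ^ n * e (s / 2 ^ n) / s)) \<longlonglongrightarrow> s * 0" by (intro tendsto_intros)
    have "f s \<le> s * (2 ^ n * e (s / 2 ^ n) / s)" for n
    proof -
      have "f (s / 2 ^ n) \<le> 1 * e (s / 2 ^ n)"
        unfolding f_def using s L C0 by (intro mult_right_mono) (auto simp: e_def)
      then have "2 ^ n * f (s / 2 ^ n) \<le> 2 ^ n * e (s / 2 ^ n)" by simp
      from order_trans[OF halve[OF s] this] show ?thesis using s by simp
    qed
    then have "f s \<le> s * 0" using lim by (intro tendsto_lowerbound[OF lim]) auto
    then have "e s \<le> 0" by (simp add: f_def mult_le_0_iff)
    then have "coord (\<gamma> s) = coord (\<delta> s)" by (simp add: e_def)
    moreover have "\<gamma> s \<in> fst c" "\<delta> s \<in> fst c" using t1'[OF s] by (auto simp: near_def)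
    ultimately show ?thesis using point_coord by metis
  qed
  have eq_pos: "\<gamma> s = \<delta> s" if "0 < s" for s
  proof -
    obtain n where n: "s / t1 < real n" using reals_Archimedean2 by blast
    have n0: "0 < real n" using that t1 by (intro le_less_trans[OF _ n]) auto
    have "\<gamma> (s / real n) = \<delta> (s / real n)"
      using that n n0 t1 by (intro eq_small) (auto simp: field_simps)
    then have "\<gamma> (real n * (s / real n)) = \<delta> (real n * (s / real n))"
      by (simp only: one_parameter_subgroup_multiple[OF \<gamma>(1)] one_parameter_subgroup_multiple[OF \<delta>(1)])
    then show ?thesis using n0 by simp
  qed
  show ?thesis
  proof
    fix s :: real
    consider "s > 0" | "s = 0" | "- s > 0" by linarith
    then show "\<gamma> s = \<delta> s"
    proof cases
      case 3
      then show ?thesis using eq_pos[of "- s"] \<gamma>D(5)[of "- s"] \<delta>D(5)[of "- s"] by simp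
    qed (use eq_pos \<gamma>D(4) \<delta>D(4) in auto)
  qed
qed

lemma one_parameter_subgroup_rescale:
  assumes "one_parameter_subgroup G \<gamma>" "((snd c \<circ> \<gamma>) has_vector_derivative A) (at 0)"
  shows "one_parameter_subgroup G (\<lambda>t. \<gamma> (t * s))"
    "((snd c \<circ> (\<lambda>t. \<gamma> (t * s))) has_vector_derivative s *\<^sub>R A) (at 0)"
proof -
  show "one_parameter_subgroup G (\<lambda>t. \<gamma> (t * s))"
    unfolding one_parameter_subgroup_def
  proof (intro conjI allI)
    show "continuous_on UNIV (\<lambda>t. \<gamma> (t * s))"
      by (rule continuous_on_compose2[OF one_parameter_subgroupD(2)[OF assms(1)]])
        (auto intro: continuous_intros)
  qed (use one_parameter_subgroupD(1,3)[OF assms(1)] in \<open>auto simp: distrib_right\<close>)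
  have "((\<lambda>t. t * s) has_vector_derivative s) (at 0)"
    by (auto intro!: derivative_eq_intros simp flip: has_real_derivative_iff_has_vector_derivative)
  from vector_diff_chain_at[OF this, of "snd c \<circ> \<gamma>" A] assms(2)
  show "((snd c \<circ> (\<lambda>t. \<gamma> (t * s))) has_vector_derivative s *\<^sub>R A) (at 0)"
    by (simp add: o_def)
qed

lemma lie_exp_eqI:
  assumes "one_parameter_subgroup G \<gamma>" "((snd c \<circ> \<gamma>) has_vector_derivative A) (at 0)"
  shows "lie_exp G c (s *\<^sub>R A) = \<gamma> s"
  unfolding lie_exp_def
proof (rule the_equality)
  note re = one_parameter_subgroup_rescale[OF assms, of s]
  show "\<exists>\<delta>. one_parameter_subgroup G \<delta> \<and> ((snd c \<circ> \<delta>) has_vector_derivative s *\<^sub>R A) (at 0) \<and> \<gamma> s = \<delta> 1"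
    using re by (intro exI[of _ "\<lambda>t. \<gamma> (t * s)"]) simp
  fix g assume "\<exists>\<delta>. one_parameter_subgroup G \<delta> \<and> ((snd c \<circ> \<delta>) has_vector_derivative s *\<^sub>R A) (at 0) \<and> g = \<delta> 1"
  then obtain \<delta> where \<delta>: "one_parameter_subgroup G \<delta>" "((snd c \<circ> \<delta>) has_vector_derivative s *\<^sub>R A) (at 0)" "g = \<delta> 1"
    by blast
  then show "g = \<gamma> s" using fun_cong[OF one_parameter_subgroup_unique[OF \<delta>(1,2) re], of 1] by simp
qed

lemma lie_exp_curve:
  shows one_parameter_subgroup_lie_exp: "one_parameter_subgroup G (\<lambda>s. lie_exp G c (s *\<^sub>R A))"
    and lie_exp_has_vector_derivative: "((snd c \<circ> (\<lambda>s. lie_exp G c (s *\<^sub>R A))) has_vector_derivative A) (at 0)"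
proof -
  obtain \<gamma> where \<gamma>: "one_parameter_subgroup G \<gamma>" "((snd c \<circ> \<gamma>) has_vector_derivative A) (at 0)"
    using one_parameter_subgroup_exists by blast
  then have "(\<lambda>s. lie_exp G c (s *\<^sub>R A)) = \<gamma>" using lie_exp_eqI by blast
  with \<gamma> show "one_parameter_subgroup G (\<lambda>s. lie_exp G c (s *\<^sub>R A))"
    "((snd c \<circ> (\<lambda>s. lie_exp G c (s *\<^sub>R A))) has_vector_derivative A) (at 0)" by simp_all
qed

text \<open>Identities in the Lie algebra are obtained from identities between one-parameter subgroups.\<close>

lemma lie_exp_inject:
  assumes "\<And>s. lie_exp G c (s *\<^sub>R A) = lie_exp G c (s *\<^sub>R B)"
  shows "A = B"
  using vector_derivative_unique_at[OF lie_exp_has_vector_derivative[of A, unfolded assms]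
      lie_exp_has_vector_derivative[of B]] .

section \<open>The adjoint action\<close>

text \<open>The smoothness axiom concerns the product of two elements in charts, and \<open>g\<close> may be far from
the identity. So conjugation is split into left and right multiplication, passing through a chart
around \<open>g\<close> in between.\<close>

lemma conjugation_differentiable:
  assumes g: "g \<in> carrier G"
  shows "((\<lambda>x. snd c (g \<otimes> chart_inv c x \<otimes> inv g)) has_derivative Ad G c g) (at (snd c \<one>))"
proof -
  define x0 where "x0 = snd c \<one>"
  obtain a where a: "a \<in> atlas" "g \<in> fst a" using chart_exists[OF g] by blast
  obtain b where b: "b \<in> atlas" "inv g \<in> fst b" using chart_exists[OF inv_closed[OF g]] by blast
  have x0: "x0 \<in> chart_image c" "chart_inv c x0 = \<one>"
    unfolding x0_def using chart_mem[OF c_atlas one_in_chart] chart_inv_chart[OF c_atlas one_in_chart] by auto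
  have smooth1: "f differentiable (at x)" if "smooth_on S f" "x \<in> S" for S f and x
    using that unfolding smooth_on_def by (metis Ck_on.simps(2))
  define M1 where "M1 p = snd a (chart_inv a (fst p) \<otimes> chart_inv c (snd p))" for p
  define M2 where "M2 p = snd c (chart_inv a (fst p) \<otimes> chart_inv b (snd p))" for p
  have "M1 differentiable (at ((\<lambda>x. (snd a g, x)) x0))"
    unfolding M1_def
    by (rule smooth1[OF smooth_mult[OF a(1) c_atlas a(1)]])
       (use x0 a g chart_mem[OF a] chart_inv_chart[OF a(1) a(2)] in auto)
  moreover have "(\<lambda>x. (snd a g, x)) differentiable (at x0)"
    by (intro differentiableI[where f' = "\<lambda>u. (0, u)"] derivative_intros)
  ultimately have d1: "(M1 \<circ> (\<lambda>x. (snd a g, x))) differentiable (at x0)"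
    by (rule differentiable_chain_at[rotated])
  have M1: "(M1 \<circ> (\<lambda>x. (snd a g, x))) x0 = snd a g"
    using x0 g chart_inv_chart[OF a] by (simp add: M1_def)
  have "M2 differentiable (at ((\<lambda>y. (y, snd b (inv g))) (snd a g)))"
    unfolding M2_def
    by (rule smooth1[OF smooth_mult[OF a(1) b(1) c_atlas]])
       (use a b g one_in_chart chart_mem[OF a] chart_mem[OF b] chart_inv_chart[OF a] chart_inv_chart[OF b] in auto)
  moreover have "(\<lambda>y. (y, snd b (inv g))) differentiable (at (snd a g))"
    by (intro differentiableI[where f' = "\<lambda>u. (u, 0)"] derivative_intros)
  ultimately have d2: "(M2 \<circ> (\<lambda>y. (y, snd b (inv g)))) differentiable (at (snd a g))"
    by (rule differentiable_chain_at[rotated])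
  have "((M2 \<circ> (\<lambda>y. (y, snd b (inv g)))) \<circ> (M1 \<circ> (\<lambda>x. (snd a g, x)))) differentiable (at x0)"
    by (rule differentiable_chain_at[OF d1]) (simp only: M1 d2)
  then obtain D where D: "(((M2 \<circ> (\<lambda>y. (y, snd b (inv g)))) \<circ> (M1 \<circ> (\<lambda>x. (snd a g, x)))) has_derivative D) (at x0)"
    unfolding differentiable_def by blast
  define O' where "O' = {x \<in> chart_image c. g \<otimes> chart_inv c x \<in> fst a}"
  have "open O'"
  proof -
    have "open ((\<lambda>x. (snd a g, x)) -` {p \<in> chart_image a \<times> chart_image c.
        chart_inv a (fst p) \<otimes> chart_inv c (snd p) \<in> fst a})"
      by (intro open_vimage open_chart_product_domain a c_atlas continuous_intros)
    also have "\<dots> = O'"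
      using chart_mem[OF a] chart_inv_chart[OF a] by (auto simp: O'_def)
    finally show ?thesis .
  qed
  moreover have "x0 \<in> O'" using x0 a g by (simp add: O'_def)
  ultimately have "((\<lambda>x. snd c (g \<otimes> chart_inv c x \<otimes> inv g)) has_derivative D) (at x0)"
    by (rule has_derivative_transform_within_open[OF D])
      (use a b in \<open>simp add: O'_def M1_def M2_def chart_inv_chart\<close>)
  then show ?thesis
    unfolding Ad_def[abs_def] x0_def[symmetric]
    using frechet_derivative_at by fastforce
qed

lemma linear_Ad: "g \<in> carrier G \<Longrightarrow> linear (Ad G c g)"
  using conjugation_differentiable by (rule has_derivative_linear)

lemma lie_exp_Ad:
  assumes g: "g \<in> carrier G"
  shows "lie_exp G c (s *\<^sub>R Ad G c g A) = g \<otimes> lie_exp G c (s *\<^sub>R A) \<otimes> inv g"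
proof (rule lie_exp_eqI)
  let ?\<gamma> = "\<lambda>s. lie_exp G c (s *\<^sub>R A)"
  note \<gamma> = one_parameter_subgroup_lie_exp[of A] and \<gamma>' = lie_exp_has_vector_derivative[of A]
  note \<gamma>D = one_parameter_subgroupD[OF \<gamma>]
  show "one_parameter_subgroup G (\<lambda>s. g \<otimes> ?\<gamma> s \<otimes> inv g)"
    unfolding one_parameter_subgroup_def
  proof (intro conjI allI)
    show "range (\<lambda>s. g \<otimes> ?\<gamma> s \<otimes> inv g) \<subseteq> carrier G" using g \<gamma>D(1) by auto
    show "continuous_on UNIV (\<lambda>s. g \<otimes> ?\<gamma> s \<otimes> inv g)"
      unfolding continuous_on_def using g \<gamma>D(1,6)
      by (intro ballI tendsto_group_mult tendsto_const) auto
    fix s t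
    have "inv g \<otimes> (g \<otimes> x) = x" if "x \<in> carrier G" for x
      using g that by (simp add: m_assoc[symmetric])
    then show "g \<otimes> ?\<gamma> (s + t) \<otimes> inv g = g \<otimes> ?\<gamma> s \<otimes> inv g \<otimes> (g \<otimes> ?\<gamma> t \<otimes> inv g)"
      using g \<gamma>D(1) \<gamma>D(3)[of s t] by (simp add: m_assoc)
  qed
  have "(?\<gamma> \<longlongrightarrow> \<one>) (nhds 0)"
    using \<gamma>D(6)[of 0 UNIV] \<gamma>D(4) tendsto_at_iff_tendsto_nhds[of ?\<gamma> 0] by simp
  then have ev: "\<forall>\<^sub>F s in nhds 0. ?\<gamma> s \<in> fst c"
    using \<gamma>D(1) by (intro eventually_in_chart[OF c_atlas _ _ one_in_chart]) auto
  have "((\<lambda>x. snd c (g \<otimes> chart_inv c x \<otimes> inv g)) has_derivative Ad G c g) (at ((snd c \<circ> ?\<gamma>) 0))"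
    using conjugation_differentiable[OF g] \<gamma>D(4) by simp
  from diff_chain_at[OF \<gamma>'[unfolded has_vector_derivative_def] this]
  have "((\<lambda>s. snd c (g \<otimes> chart_inv c (snd c (?\<gamma> s)) \<otimes> inv g)) has_vector_derivative Ad G c g A) (at 0)"
    by (simp add: has_vector_derivative_def o_def linear_scale[OF linear_Ad[OF g]])
  then show "((snd c \<circ> (\<lambda>s. g \<otimes> ?\<gamma> s \<otimes> inv g)) has_vector_derivative Ad G c g A) (at 0)"
    by (rule has_vector_derivative_cong_ev[THEN iffD1, rotated 2])
      (use ev \<gamma>D(4) one_in_chart in \<open>auto simp: chart_inv_chart[OF c_atlas] elim: eventually_mono\<close>)
qed

lemma Ad_one: "Ad G c \<one> A = A"
  using one_parameter_subgroupD(1)[OF one_parameter_subgroup_lie_exp]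
  by (intro lie_exp_inject) (simp add: lie_exp_Ad)

lemma Ad_mult:
  assumes "g \<in> carrier G" "h \<in> carrier G"
  shows "Ad G c (g \<otimes> h) A = Ad G c g (Ad G c h A)"
  using assms one_parameter_subgroupD(1)[OF one_parameter_subgroup_lie_exp]
  by (intro lie_exp_inject) (simp add: lie_exp_Ad inv_mult_group m_assoc)

end

section \<open>The derived representation is linear\<close>

lemma unitary_repD:
  assumes "unitary_rep G \<rho>" "g \<in> carrier G"
  shows unitary_rep_cinner: "cinner (\<rho> g z) (\<rho> g w) = cinner z w"
    and unitary_rep_mult: "h \<in> carrier G \<Longrightarrow> \<rho> (g \<otimes>\<^bsub>G\<^esub> h) z = \<rho> g (\<rho> h z)"
    and unitary_rep_linear: "linear (\<rho> g)"
    and unitary_rep_norm: "norm (\<rho> g z) = norm z"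
proof -
  have 1: "clinear_map (\<rho> g)" using assms by (auto simp: unitary_rep_def)
  show 2: "cinner (\<rho> g z) (\<rho> g w) = cinner z w" for z w
    using assms by (auto simp: unitary_rep_def)
  show "h \<in> carrier G \<Longrightarrow> \<rho> (g \<otimes>\<^bsub>G\<^esub> h) z = \<rho> g (\<rho> h z)"
    using assms by (simp add: unitary_rep_def)
  show "linear (\<rho> g)" using 1 by (rule clinear_map_imp_linear)
  show "norm (\<rho> g z) = norm z"
    using 2[of z z] by (simp add: norm_eq_sqrt_inner inner_eq_Re_cinner)
qed

lemma unitary_rep_one: "unitary_rep G \<rho> \<Longrightarrow> \<rho> \<one>\<^bsub>G\<^esub> z = z"
  by (simp add: unitary_rep_def)

lemma unitary_rep_continuous: "unitary_rep G \<rho> \<Longrightarrow> continuous_on (carrier G) (\<lambda>g. \<rho> g z)"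
  by (simp add: unitary_rep_def)

context compact_lie_group_chart begin

lemma lie_exp_closed: "lie_exp G c A \<in> carrier G"
  using one_parameter_subgroupD(1)[OF one_parameter_subgroup_lie_exp[of A], of 1] by simp

lemma lie_exp_zero: "lie_exp G c (0 *\<^sub>R A) = \<one>"
  using one_parameter_subgroupD(4)[OF one_parameter_subgroup_lie_exp[of A]] .

lemma lie_exp_minus: "lie_exp G c ((- s) *\<^sub>R A) = inv (lie_exp G c (s *\<^sub>R A))"
  using one_parameter_subgroupD(5)[OF one_parameter_subgroup_lie_exp[of A]] .

text \<open>The definition of \<^const>\<open>derived_rep\<close> by \<^const>\<open>vector_derivative\<close> is only meaningful once the
curve is known to be differentiable.\<close>

lemma derived_rep_has_vector_derivative:
  assumes \<rho>: "unitary_rep G \<rho>"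
  shows "((\<lambda>s. \<rho> (lie_exp G c (s *\<^sub>R A)) z) has_vector_derivative derived_rep G c \<rho> A z) (at 0)"
proof -
  let ?\<gamma> = "\<lambda>s. lie_exp G c (s *\<^sub>R A)"
  note \<gamma>D = one_parameter_subgroupD[OF one_parameter_subgroup_lie_exp[of A]]
  obtain D where "((\<lambda>s. \<rho> (?\<gamma> s) z) has_vector_derivative D) (at 0)"
  proof (rule one_parameter_operator_group_differentiable[of "\<lambda>s. \<rho> (?\<gamma> s)"])
    show "linear (\<rho> (?\<gamma> s))" for s by (rule unitary_rep_linear[OF \<rho> \<gamma>D(1)])
    show "\<rho> (?\<gamma> 0) z = z" for z using unitary_rep_one[OF \<rho>] \<gamma>D(4) by simp
    show "\<rho> (?\<gamma> (s + t)) z = \<rho> (?\<gamma> s) (\<rho> (?\<gamma> t) z)" for s t z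
      unfolding \<gamma>D(3) by (rule unitary_rep_mult[OF \<rho> \<gamma>D(1) \<gamma>D(1)])
    show "continuous_on UNIV (\<lambda>s. \<rho> (?\<gamma> s) z)" for z
      by (rule continuous_on_compose2[OF unitary_rep_continuous[OF \<rho>] \<gamma>D(2)]) (use \<gamma>D(1) in auto)
  qed
  then show ?thesis unfolding derived_rep_def by (simp add: vector_derivative_at)
qed

text \<open>Let \<open>w = \<rho> g z - z\<close>. If \<open>\<rho>\<close> moves vectors by at most half their length on \<open>near R\<close> and the
first \<open>n\<close> powers of \<open>g\<close> stay there, then the telescoping sum of the \<open>\<rho> (g [^] k) w\<close> differs from
\<open>n\<close> copies of \<open>w\<close> by at most half of that, so \<open>n * norm w \<le> norm z\<close>. By \<open>power_near\<close>
one can take \<open>n\<close> inversely proportional to the size of \<open>g\<close>.\<close>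

lemma unitary_rep_lipschitz_at_one:
  fixes \<rho> :: "'a \<Rightarrow> 'v::hermitian_space \<Rightarrow> 'v"
  assumes \<rho>: "unitary_rep G \<rho>"
  obtains R L where "0 < R" "\<And>g z. g \<in> near R \<Longrightarrow> norm (\<rho> g z - z) \<le> L * norm (coord g) * norm z"
proof -
  obtain r C where law: "local_law r C" using ex_local_law by blast
  obtain Cb :: "'v set" and k where Cb: "finite Cb" "\<And>c. c \<in> Cb \<Longrightarrow> 0 \<le> k c"
    "\<And>f :: 'v \<Rightarrow> 'v. \<And>x. linear f \<Longrightarrow> norm (f x) \<le> (\<Sum>c\<in>Cb. k c * norm (f c)) * norm x"
    using linear_bounded_on_orthogonal_basis by blast
  have lin: "linear (\<lambda>z. \<rho> g z - z)" if "g \<in> carrier G" for g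
    using unitary_rep_linear[OF \<rho> that] by (intro linear_compose_sub linear_id[unfolded id_def])
  \<comment> \<open>\<open>\<phi> g\<close> bounds the operator norm of \<open>\<rho> g - 1\<close> and is continuous in \<open>g\<close> because each orbit map of \<open>\<rho>\<close> is.\<close>
  define \<phi> where "\<phi> g = (\<Sum>c\<in>Cb. k c * norm (\<rho> g c - c))" for g
  have "continuous_on (carrier G) \<phi>"
    unfolding \<phi>_def by (intro continuous_intros unitary_rep_continuous[OF \<rho>])
  have "\<exists>R>0. R \<le> r \<and> (\<forall>g\<in>near R. \<phi> g \<le> 1 / 2)"
  proof -
    have "continuous_on (cball 0 r) (\<lambda>x. \<phi> (point x))"
      unfolding point_def
    proof (rule continuous_on_compose2[OF \<open>continuous_on (carrier G) \<phi>\<close>])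
      show "continuous_on (cball 0 r) (\<lambda>x. chart_inv c (snd c \<one> + x))"
        by (rule continuous_on_compose2[OF continuous_on_chart_inv[OF c_atlas]])
          (use local_lawD(4)[OF law] in \<open>auto intro!: continuous_intros simp del: image_add_cball\<close>)
      show "(\<lambda>x. chart_inv c (snd c \<one> + x)) ` cball 0 r \<subseteq> carrier G"
        using local_lawD(4)[OF law] chart_inv_mem[OF c_atlas] chart_subset[OF c_atlas] by fastforce
    qed
    moreover have "\<phi> (point 0) = 0"
      by (simp add: \<phi>_def point_def chart_inv_chart[OF c_atlas one_in_chart] unitary_rep_one[OF \<rho>])
    ultimately obtain d where d: "d > 0" "\<And>x. norm x \<le> r \<Longrightarrow> norm x < d \<Longrightarrow> \<bar>\<phi> (point x)\<bar> < 1 / 2"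
      using local_lawD(1)[OF law] unfolding continuous_on_iff
      by (elim ballE[of _ _ 0] allE[of _ "1/2"]) (auto simp: dist_real_def)
    show ?thesis
    proof (intro exI[of _ "min r (d / 2)"] conjI ballI)
      fix g assume "g \<in> near (min r (d / 2))"
      then have "g \<in> fst c" "norm (coord g) \<le> r" "norm (coord g) < d"
        using d(1) by (auto simp: near_def)
      then show "\<phi> g \<le> 1 / 2" using d(2)[of "coord g"] by (simp add: point_coord)
    qed (use d(1) local_lawD(1)[OF law] in auto)
  qed
  then obtain R where R: "R > 0" "R \<le> r" "\<And>g. g \<in> near R \<Longrightarrow> \<phi> g \<le> 1 / 2" by blast
  have half: "norm (\<rho> g z - z) \<le> 1 / 2 * norm z" if "g \<in> near R" for g z
  proof -
    have "norm (\<rho> g z - z) \<le> \<phi> g * norm z"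
      unfolding \<phi>_def using Cb(3)[OF lin[OF near_carrier[OF that]]] .
    also have "\<dots> \<le> 1 / 2 * norm z" by (intro mult_right_mono R(3) that) simp
    finally show ?thesis .
  qed
  have "norm (\<rho> g z - z) \<le> (4 / R) * norm (coord g) * norm z" if g: "g \<in> near (R / 2)" for g z
  proof (cases "norm (coord g) = 0")
    case True
    then have "g = \<one>" using g point_coord[of g] point_coord[OF one_in_chart] by (simp add: near_def)
    then show ?thesis by (simp add: unitary_rep_one[OF \<rho>])
  next
    case False
    define d where "d = norm (coord g)"
    have d: "0 < d" "2 * d \<le> R" using False g by (auto simp: d_def near_def)
    have gc: "g \<in> fst c" "g \<in> carrier G" using g near_carrier by (auto simp: near_def)
    define n where "n = nat \<lfloor>R / (2 * d)\<rfloor>"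
    have "1 \<le> R / (2 * d)" using d by simp
    then have "1 \<le> \<lfloor>R / (2 * d)\<rfloor>" by simp
    then have n1: "1 \<le> real n" and n2: "real n \<le> R / (2 * d)" and n3: "R / (2 * d) < real n + 1"
      unfolding n_def by linarith+
    have n4: "R / (4 * d) \<le> real n"
    proof -
      have "R / (4 * d) = (R / (2 * d)) / 2" by simp
      then show ?thesis using n1 n3 by linarith
    qed
    have pow: "g [^] k \<in> near R" if "k \<le> n" for k
    proof -
      have "2 * real k * d \<le> 2 * real n * d" using that d by simp
      also have "\<dots> \<le> R" using n2 d by (simp add: field_simps)
      finally have le: "2 * real k * d \<le> R" .
      then have "g [^] k \<in> near (2 * real k * d)"
        using power_near[OF law gc(1), of k] R(2) by (simp add: d_def)
      then show ?thesis using le by (rule near_mono)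
    qed
    define w where "w = \<rho> g z - z"
    have tele: "\<rho> (g [^] m) z - z = (\<Sum>k<m. \<rho> (g [^] k) w)" for m :: nat
    proof (induction m)
      case 0 show ?case by (simp add: unitary_rep_one[OF \<rho>])
    next
      case (Suc m)
      have "\<rho> (g [^] Suc m) z = \<rho> (g [^] m) (\<rho> g z)"
        using unitary_rep_mult[OF \<rho> nat_pow_closed[OF gc(2)] gc(2)] by simp
      then have "\<rho> (g [^] Suc m) z - z = \<rho> (g [^] m) w + (\<rho> (g [^] m) z - z)"
        using linear_diff[OF unitary_rep_linear[OF \<rho> nat_pow_closed[OF gc(2)]]] by (simp add: w_def)
      then show ?case using Suc by simp
    qed
    have "real n *\<^sub>R w = (\<rho> (g [^] n) z - z) - (\<Sum>k<n. \<rho> (g [^] k) w - w)"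
      by (simp add: tele sum_subtractf scaleR_conv_of_real sum_constant_scaleR)
    then have "norm (real n *\<^sub>R w) \<le> norm (\<rho> (g [^] n) z - z) + norm (\<Sum>k<n. \<rho> (g [^] k) w - w)"
      using norm_triangle_ineq4 by metis
    also have "\<dots> \<le> 1 / 2 * norm z + (\<Sum>k<n. 1 / 2 * norm w)"
      by (intro add_mono half pow sum_norm_le) auto
    finally have "real n * norm w \<le> norm z" by simp
    then have "R / (4 * d) * norm w \<le> norm z"
      using mult_right_mono[OF n4, of "norm w"] by simp
    then show ?thesis using d R(1) by (simp add: w_def d_def field_simps)
  qed
  then show ?thesis using that[of "R / 2" "4 / R"] R(1) by simp
qed

text \<open>The quotient \<open>h s\<close> of two tangent curves has coordinates of order \<open>o(s)\<close>, so by the Lipschitz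
estimate \<open>\<rho> (h s)\<close> moves vectors only by \<open>o(s)\<close>.\<close>

lemma rep_derivative_determined_by_tangent:
  fixes \<rho> :: "'a \<Rightarrow> 'v::hermitian_space \<Rightarrow> 'v"
  assumes \<rho>: "unitary_rep G \<rho>"
    and \<alpha>: "\<And>s. \<alpha> s \<in> carrier G" "\<alpha> 0 = \<one>" "(\<alpha> \<longlongrightarrow> \<one>) (at 0)" "((snd c \<circ> \<alpha>) has_vector_derivative A) (at 0)"
    and \<beta>: "\<And>s. \<beta> s \<in> carrier G" "\<beta> 0 = \<one>" "(\<beta> \<longlongrightarrow> \<one>) (at 0)" "((snd c \<circ> \<beta>) has_vector_derivative A) (at 0)"
    and D: "((\<lambda>s. \<rho> (\<beta> s) z) has_vector_derivative D) (at 0)"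
  shows "((\<lambda>s. \<rho> (\<alpha> s) z) has_vector_derivative D) (at 0)"
proof -
  obtain r C where law: "local_law r C" using ex_local_law by blast
  obtain R L where RL: "0 < R" "\<And>g z. g \<in> near R \<Longrightarrow> norm (\<rho> g z - z) \<le> L * norm (coord g) * norm z"
    using unitary_rep_lipschitz_at_one[OF \<rho>] by blast
  define h where "h s = inv (\<beta> s) \<otimes> \<alpha> s" for s
  have hG: "h s \<in> carrier G" for s using \<alpha>(1) \<beta>(1) by (simp add: h_def)
  have \<beta>h: "\<beta> s \<otimes> h s = \<alpha> s" for s using \<alpha>(1) \<beta>(1) by (simp add: h_def m_assoc[symmetric])
  have "((\<lambda>s. inv (\<beta> s) \<otimes> \<alpha> s) \<longlongrightarrow> inv \<one> \<otimes> \<one>) (at 0)"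
    using \<alpha> \<beta> by (intro tendsto_group_mult tendsto_group_inv) auto
  then have h_lim: "(h \<longlongrightarrow> \<one>) (at 0)" by (simp add: h_def[abs_def])
  have r0: "min r R > 0" using local_lawD(1)[OF law] RL(1) by simp
  have nr: "\<forall>\<^sub>F s in at 0. h s \<in> near (min r R)"
    by (rule eventually_near[OF h_lim always_eventually r0]) (simp add: hG)
  have nr': "\<forall>\<^sub>F s in at 0. \<beta> s \<in> near r"
    by (rule eventually_near[OF \<beta>(3) always_eventually local_lawD(1)[OF law]]) (simp add: \<beta>(1))
  have "\<forall>\<^sub>F s in at 0. norm (\<rho> (\<alpha> s) z - \<rho> (\<beta> s) z) \<le> \<bar>L\<bar> * 2 * norm z * norm (coord (\<alpha> s) - coord (\<beta> s))"
    using nr nr'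
  proof (eventually_elim)
    case (elim s)
    have hn: "h s \<in> near r" "h s \<in> near R" and bn: "\<beta> s \<in> near r"
      using elim near_mono[of "h s" "min r R" r] near_mono[of "h s" "min r R" R] by simp_all
    have "norm (coord (\<alpha> s) - coord (\<beta> s) - coord (h s)) \<le> C * r * norm (coord (h s))"
      using local_law_mult_right[OF law order_refl bn hn(1)] unfolding \<beta>h .
    also have "\<dots> \<le> 1 / 4 * norm (coord (h s))"
      by (intro mult_right_mono local_lawD(3)[OF law]) simp
    finally have "norm (coord (h s)) \<le> 2 * norm (coord (\<alpha> s) - coord (\<beta> s))"
      using norm_triangle_ineq4[of "coord (\<alpha> s) - coord (\<beta> s)" "coord (\<alpha> s) - coord (\<beta> s) - coord (h s)"]
        norm_ge_zero[of "coord (h s)"] by (simp del: norm_ge_zero)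
    then have k: "\<bar>L\<bar> * norm z * norm (coord (h s)) \<le> \<bar>L\<bar> * norm z * (2 * norm (coord (\<alpha> s) - coord (\<beta> s)))"
      by (intro mult_left_mono) auto
    have "norm (\<rho> (\<alpha> s) z - \<rho> (\<beta> s) z) = norm (\<rho> (\<beta> s) (\<rho> (h s) z - z))"
      using unitary_rep_mult[OF \<rho> \<beta>(1) hG, of s s z] linear_diff[OF unitary_rep_linear[OF \<rho> \<beta>(1)]]
      by (simp add: \<beta>h)
    also have "\<dots> = norm (\<rho> (h s) z - z)" by (rule unitary_rep_norm[OF \<rho> \<beta>(1)])
    also have "\<dots> \<le> L * norm (coord (h s)) * norm z" by (rule RL(2)[OF hn(2)])
    also have "\<dots> \<le> \<bar>L\<bar> * norm (coord (h s)) * norm z" by (intro mult_right_mono) auto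
    finally show ?case using k by (simp add: mult_ac)
  qed
  moreover have "((\<lambda>s. coord (\<alpha> s) - coord (\<beta> s)) has_vector_derivative A - A) (at 0)"
    using \<alpha>(4) \<beta>(4) by (intro has_vector_derivative_diff) (simp_all add: coord_has_vector_derivative_iff)
  ultimately have "((\<lambda>s. \<rho> (\<alpha> s) z - \<rho> (\<beta> s) z) has_vector_derivative 0) (at 0)"
    unfolding has_vector_derivative_iff_quotient_tendsto
  proof -
    assume ev: "\<forall>\<^sub>F s in at 0. norm (\<rho> (\<alpha> s) z - \<rho> (\<beta> s) z) \<le> \<bar>L\<bar> * 2 * norm z * norm (coord (\<alpha> s) - coord (\<beta> s))"
      and q: "((\<lambda>s. (coord (\<alpha> s) - coord (\<beta> s) - (coord (\<alpha> 0) - coord (\<beta> 0))) /\<^sub>R (s - 0)) \<longlongrightarrow> A - A) (at 0)"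
    have "((\<lambda>s. \<bar>L\<bar> * 2 * norm z * norm ((coord (\<alpha> s) - coord (\<beta> s)) /\<^sub>R s)) \<longlongrightarrow> \<bar>L\<bar> * 2 * norm z * norm (A - A)) (at 0)"
      using q \<alpha>(2) \<beta>(2) by (intro tendsto_intros) simp
    then have g0: "((\<lambda>s. \<bar>L\<bar> * 2 * norm z * norm ((coord (\<alpha> s) - coord (\<beta> s)) /\<^sub>R s)) \<longlongrightarrow> 0) (at 0)" by simp
    show "((\<lambda>s. (\<rho> (\<alpha> s) z - \<rho> (\<beta> s) z - (\<rho> (\<alpha> 0) z - \<rho> (\<beta> 0) z)) /\<^sub>R (s - 0)) \<longlongrightarrow> 0) (at 0)"
    proof (rule Lim_null_comparison[OF _ g0])
      show "\<forall>\<^sub>F s in at 0. norm ((\<rho> (\<alpha> s) z - \<rho> (\<beta> s) z - (\<rho> (\<alpha> 0) z - \<rho> (\<beta> 0) z)) /\<^sub>R (s - 0))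
          \<le> \<bar>L\<bar> * 2 * norm z * norm ((coord (\<alpha> s) - coord (\<beta> s)) /\<^sub>R s)"
        using ev
      proof eventually_elim
        case (elim s)
        have "inverse \<bar>s\<bar> * norm (\<rho> (\<alpha> s) z - \<rho> (\<beta> s) z)
            \<le> inverse \<bar>s\<bar> * (\<bar>L\<bar> * 2 * norm z * norm (coord (\<alpha> s) - coord (\<beta> s)))"
          using elim by (intro mult_left_mono) auto
        then show ?case by (simp add: \<alpha>(2) \<beta>(2) mult_ac)
      qed
    qed
  qed
  from has_vector_derivative_add[OF this D] show ?thesis by simp
qed

lemma product_curve_derivative:
  assumes \<rho>: "unitary_rep G \<rho>"
    and \<alpha>: "\<And>s. \<alpha> s \<in> carrier G" "\<alpha> 0 = \<one>" "(\<alpha> \<longlongrightarrow> \<one>) (at 0)" "((\<lambda>s. \<rho> (\<alpha> s) z) has_vector_derivative D) (at 0)"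
    and \<beta>: "\<And>s. \<beta> s \<in> carrier G" "\<beta> 0 = \<one>" "((\<lambda>s. \<rho> (\<beta> s) z) has_vector_derivative E) (at 0)"
  shows "((\<lambda>s. \<rho> (\<alpha> s \<otimes> \<beta> s) z) has_vector_derivative D + E) (at 0)"
proof -
  have one: "\<rho> \<one> x = x" for x by (rule unitary_rep_one[OF \<rho>])
  have q: "((\<lambda>s. (\<rho> (\<alpha> s) z - z) /\<^sub>R s) \<longlongrightarrow> D) (at 0)" "((\<lambda>s. (\<rho> (\<beta> s) z - z) /\<^sub>R s) \<longlongrightarrow> E) (at 0)"
    using \<alpha>(4) \<beta>(3) unfolding has_vector_derivative_iff_quotient_tendsto by (simp_all add: \<alpha>(2) \<beta>(2) one)
  have "((\<lambda>s. \<rho> (\<alpha> s) E) \<longlongrightarrow> \<rho> \<one> E) (at 0)"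
    by (rule tendsto_compose_within[OF unitary_rep_continuous[OF \<rho>] \<alpha>(3)]) (use \<alpha>(1) in auto)
  then have "((\<lambda>s. \<rho> (\<alpha> s) E) \<longlongrightarrow> E) (at 0)" by (simp add: one)
  moreover have "((\<lambda>s. \<rho> (\<alpha> s) ((\<rho> (\<beta> s) z - z) /\<^sub>R s - E)) \<longlongrightarrow> 0) (at 0)"
    by (rule tendsto_norm_zero_cancel)
      (simp add: unitary_rep_norm[OF \<rho> \<alpha>(1)] tendsto_norm_zero_iff Lim_null[symmetric] q)
  ultimately have "((\<lambda>s. \<rho> (\<alpha> s) E + \<rho> (\<alpha> s) ((\<rho> (\<beta> s) z - z) /\<^sub>R s - E)) \<longlongrightarrow> E + 0) (at 0)"
    by (rule tendsto_add)
  from tendsto_add[OF q(1) this]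
  have "((\<lambda>s. (\<rho> (\<alpha> s) z - z) /\<^sub>R s + (\<rho> (\<alpha> s) E + \<rho> (\<alpha> s) ((\<rho> (\<beta> s) z - z) /\<^sub>R s - E))) \<longlongrightarrow> D + E) (at 0)"
    by simp
  moreover have "(\<rho> (\<alpha> s) z - z) /\<^sub>R s + (\<rho> (\<alpha> s) E + \<rho> (\<alpha> s) ((\<rho> (\<beta> s) z - z) /\<^sub>R s - E))
      = (\<rho> (\<alpha> s \<otimes> \<beta> s) z - z) /\<^sub>R s" for s
    using unitary_rep_mult[OF \<rho> \<alpha>(1) \<beta>(1), of s s z] unitary_rep_linear[OF \<rho> \<alpha>(1), of s]
    by (simp add: linear_diff linear_scale scaleR_diff_right)
  ultimately show ?thesis
    unfolding has_vector_derivative_iff_quotient_tendsto by (simp add: \<alpha>(2) \<beta>(2) one)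
qed

lemma product_curve_tangent:
  assumes \<alpha>: "\<And>s. \<alpha> s \<in> carrier G" "\<alpha> 0 = \<one>" "(\<alpha> \<longlongrightarrow> \<one>) (at 0)" "((snd c \<circ> \<alpha>) has_vector_derivative A) (at 0)"
    and \<beta>: "\<And>s. \<beta> s \<in> carrier G" "\<beta> 0 = \<one>" "(\<beta> \<longlongrightarrow> \<one>) (at 0)" "((snd c \<circ> \<beta>) has_vector_derivative B) (at 0)"
  shows "((snd c \<circ> (\<lambda>s. \<alpha> s \<otimes> \<beta> s)) has_vector_derivative A + B) (at 0)"
proof -
  obtain r C where law: "local_law r C" using ex_local_law by blast
  have qa: "((\<lambda>s. coord (\<alpha> s) /\<^sub>R s) \<longlongrightarrow> A) (at 0)"
    and qb: "((\<lambda>s. coord (\<beta> s) /\<^sub>R s) \<longlongrightarrow> B) (at 0)"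
    using \<alpha>(4) \<beta>(4) unfolding coord_has_vector_derivative_iff[symmetric] has_vector_derivative_iff_quotient_tendsto
    by (simp_all add: \<alpha>(2) \<beta>(2) coord_def)
  have ca: "((\<lambda>s. coord (\<alpha> s)) \<longlongrightarrow> coord \<one>) (at 0)" and cb: "((\<lambda>s. coord (\<beta> s)) \<longlongrightarrow> coord \<one>) (at 0)"
    by (rule tendsto_coord[OF \<alpha>(3) always_eventually one_in_chart], simp add: \<alpha>(1))
      (rule tendsto_coord[OF \<beta>(3) always_eventually one_in_chart], simp add: \<beta>(1))
  let ?e = "\<lambda>s. (coord (\<alpha> s \<otimes> \<beta> s) - coord (\<alpha> s) - coord (\<beta> s)) /\<^sub>R s"
  let ?m = "\<lambda>s. C * (norm (coord (\<alpha> s)) + norm (coord (\<beta> s))) * norm (coord (\<beta> s) /\<^sub>R s)"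
  have "(?m \<longlongrightarrow> C * (norm (coord \<one>) + norm (coord \<one>)) * norm B) (at 0)"
    by (intro tendsto_intros ca cb qb)
  then have m0: "(?m \<longlongrightarrow> 0) (at 0)" by simp
  have nr: "\<forall>\<^sub>F s in at 0. \<alpha> s \<in> near (r / 2)" "\<forall>\<^sub>F s in at 0. \<beta> s \<in> near (r / 2)"
    using \<alpha>(1,3) \<beta>(1,3) local_lawD(1)[OF law] by (auto intro!: eventually_near)
  have "(?e \<longlongrightarrow> 0) (at 0)"
  proof (rule Lim_null_comparison[OF _ m0])
    show "\<forall>\<^sub>F s in at 0. norm (?e s) \<le> ?m s"
      using nr
    proof eventually_elim
      case (elim s)
      define R where "R = norm (coord (\<alpha> s)) + norm (coord (\<beta> s))"
      have "R \<le> r" "\<alpha> s \<in> near R" "\<beta> s \<in> near R" using elim by (auto simp: near_def R_def)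
      then have "norm (coord (\<alpha> s \<otimes> \<beta> s) - coord (\<alpha> s) - coord (\<beta> s)) \<le> C * R * norm (coord (\<beta> s))"
        by (rule local_law_mult_right[OF law])
      then have "inverse \<bar>s\<bar> * norm (coord (\<alpha> s \<otimes> \<beta> s) - coord (\<alpha> s) - coord (\<beta> s)) \<le> inverse \<bar>s\<bar> * (C * R * norm (coord (\<beta> s)))"
        by (intro mult_left_mono) auto
      then show ?case by (simp add: R_def mult_ac)
    qed
  qed
  from tendsto_add[OF this tendsto_add[OF qa qb]]
  have "((\<lambda>s. coord (\<alpha> s \<otimes> \<beta> s) /\<^sub>R s) \<longlongrightarrow> A + B) (at 0)"
    by (simp add: algebra_simps)
  then have "((\<lambda>s. coord (\<alpha> s \<otimes> \<beta> s)) has_vector_derivative A + B) (at 0)"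
    unfolding has_vector_derivative_iff_quotient_tendsto by (simp add: \<alpha>(2) \<beta>(2))
  then show ?thesis unfolding coord_has_vector_derivative_iff .
qed

lemma lie_exp_tendsto_one: "((\<lambda>s. lie_exp G c (s *\<^sub>R A)) \<longlongrightarrow> \<one>) (at 0)"
  using one_parameter_subgroupD(6)[OF one_parameter_subgroup_lie_exp[of A], of 0 UNIV] lie_exp_zero[of A] by simp

text \<open>The product of the one-parameter subgroups of \<open>A\<close> and \<open>B\<close> need not be a one-parameter subgroup,
but it is tangent to that of \<open>A + B\<close>.\<close>

proposition linear_derived_rep:
  assumes \<rho>: "unitary_rep G \<rho>"
  shows "linear (\<lambda>A. derived_rep G c \<rho> A z)"
proof
  fix A B :: 'c
  let ?\<alpha> = "\<lambda>s. lie_exp G c (s *\<^sub>R A)" and ?\<beta> = "\<lambda>s. lie_exp G c (s *\<^sub>R B)"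
  have "((\<lambda>s. ?\<alpha> s \<otimes> ?\<beta> s) \<longlongrightarrow> \<one> \<otimes> \<one>) (at 0)"
    by (intro tendsto_group_mult lie_exp_tendsto_one) (auto simp: lie_exp_closed)
  then have lim: "((\<lambda>s. ?\<alpha> s \<otimes> ?\<beta> s) \<longlongrightarrow> \<one>) (at 0)" by simp
  have "((\<lambda>s. \<rho> (lie_exp G c (s *\<^sub>R (A + B))) z) has_vector_derivative derived_rep G c \<rho> A z + derived_rep G c \<rho> B z) (at 0)"
  proof (rule rep_derivative_determined_by_tangent[OF \<rho>, where \<alpha> = "\<lambda>s. lie_exp G c (s *\<^sub>R (A + B))" and \<beta> = "\<lambda>s. ?\<alpha> s \<otimes> ?\<beta> s"])
    show "((snd c \<circ> (\<lambda>s. lie_exp G c (s *\<^sub>R (A + B)))) has_vector_derivative A + B) (at 0)"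
      by (rule lie_exp_has_vector_derivative)
    show "((snd c \<circ> (\<lambda>s. ?\<alpha> s \<otimes> ?\<beta> s)) has_vector_derivative A + B) (at 0)"
      by (rule product_curve_tangent) (rule lie_exp_closed lie_exp_zero lie_exp_tendsto_one lie_exp_has_vector_derivative)+
    show "((\<lambda>s. \<rho> (?\<alpha> s \<otimes> ?\<beta> s) z) has_vector_derivative derived_rep G c \<rho> A z + derived_rep G c \<rho> B z) (at 0)"
      by (rule product_curve_derivative[OF \<rho>])
        (rule lie_exp_closed lie_exp_zero lie_exp_tendsto_one derived_rep_has_vector_derivative[OF \<rho>])+
    show "?\<alpha> 0 \<otimes> ?\<beta> 0 = \<one>" by (simp only: lie_exp_zero one_closed r_one)
  qed (rule lim lie_exp_zero lie_exp_tendsto_one lie_exp_closed m_closed)+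
  then show "derived_rep G c \<rho> (A + B) z = derived_rep G c \<rho> A z + derived_rep G c \<rho> B z"
    using derived_rep_has_vector_derivative[OF \<rho>] vector_derivative_unique_at by blast
next
  fix r :: real and A :: 'c
  have "((\<lambda>t. t * r) has_vector_derivative r) (at 0)"
    by (auto intro!: derivative_eq_intros simp flip: has_real_derivative_iff_has_vector_derivative)
  from vector_diff_chain_at[OF this, of "\<lambda>s. \<rho> (lie_exp G c (s *\<^sub>R A)) z"] derived_rep_has_vector_derivative[OF \<rho>, of A z]
  have "((\<lambda>s. \<rho> (lie_exp G c (s *\<^sub>R (r *\<^sub>R A))) z) has_vector_derivative r *\<^sub>R derived_rep G c \<rho> A z) (at 0)"
    by (simp add: o_def)
  then show "derived_rep G c \<rho> (r *\<^sub>R A) z = r *\<^sub>R derived_rep G c \<rho> A z"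
    using derived_rep_has_vector_derivative[OF \<rho>] vector_derivative_unique_at by blast
qed

end

section \<open>Joint eigenvectors of commuting orthogonal operators\<close>

lemma linear_inj_imp_surj_finite_dim:
  fixes f :: "'a::finite_dim_inner \<Rightarrow> 'a"
  assumes "linear f" "inj f"
  shows "surj f"
proof -
  obtain C :: "'a set" where "finite_dimensional_vector_space scaleR C"
    using finite_dimensional_basis by blast
  then interpret fd: finite_dimensional_vector_space "scaleR :: real \<Rightarrow> 'a \<Rightarrow> 'a" C .
  show ?thesis
    using fd.linear_inj_imp_surj assms by (simp add: linear_def)
qed

lemma minimal_subspace:
  fixes N :: "'a::finite_dim_inner set"
  assumes "P N" "\<And>M. P M \<Longrightarrow> subspace M"
  obtains M where "P M" "\<And>M'. P M' \<Longrightarrow> M' \<subseteq> M \<Longrightarrow> M' = M"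
proof -
  obtain C :: "'a set" where "finite_dimensional_vector_space scaleR C"
    using finite_dimensional_basis by blast
  then interpret fd: finite_dimensional_vector_space "scaleR :: real \<Rightarrow> 'a \<Rightarrow> 'a" C .
  obtain M where M: "P M" "\<And>M'. P M' \<Longrightarrow> dim M \<le> dim M'"
    using assms(1) ex_has_least_nat[of P N dim] by blast
  have "M' = M" if "P M'" "M' \<subseteq> M" for M'
    using fd.subspace_dim_equal[of M' M] assms(2) that M by (simp add: subspace_raw_def dim_raw_def)
  then show ?thesis using that M(1) by blast
qed

locale positive_form =
  fixes B :: "'e::finite_dim_inner \<Rightarrow> 'e \<Rightarrow> real"
  assumes linear_right: "linear (B X)"
    and symmetric: "B X Y = B Y X"
    and positive: "X \<noteq> 0 \<Longrightarrow> B X X > 0"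
begin

lemmas form_simps = linear_add[OF linear_right] linear_diff[OF linear_right]
  linear_scale[OF linear_right] linear_0[OF linear_right] linear_neg[OF linear_right]

lemma form_left_simps: "B (X + Y) Z = B X Z + B Y Z" "B (X - Y) Z = B X Z - B Y Z"
  "B (r *\<^sub>R X) Z = r *\<^sub>R B X Z" "B 0 Z = 0" "B (- X) Z = - B X Z"
  by (simp_all add: symmetric[of _ Z] form_simps)

lemma form_eq_0_iff: "B X X = 0 \<longleftrightarrow> X = 0"
  using positive[of X] by (cases "X = 0") (auto simp: form_simps)

lemma form_nonneg: "0 \<le> B X X"
  using positive[of X] form_eq_0_iff[of X] by (cases "X = 0") auto

lemma continuous_on_form:
  assumes "continuous_on S f" "continuous_on S g"
  shows "continuous_on S (\<lambda>x. B (f x) (g x))"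
proof -
  obtain C :: "'e set" where C: "\<And>x. x = (\<Sum>c\<in>C. (inner x c / inner c c) *\<^sub>R c)"
    using orthogonal_basis by metis
  have "B (f x) (g x) = (\<Sum>c\<in>C. (inner (f x) c / inner c c) * B c (g x))" for x
  proof -
    have "B (f x) (g x) = B (g x) (\<Sum>c\<in>C. (inner (f x) c / inner c c) *\<^sub>R c)"
      using C[of "f x"] symmetric by metis
    also have "\<dots> = (\<Sum>c\<in>C. (inner (f x) c / inner c c) * B (g x) c)"
      by (simp add: linear_sum[OF linear_right] linear_scale[OF linear_right])
    finally show ?thesis by (simp add: symmetric[of "g x"])
  qed
  moreover have "continuous_on S (\<lambda>x. (inner (f x) c / inner c c) * B c (g x))" for c
  proof (cases "c = 0")
    case False
    then show ?thesis
      using assms by (intro continuous_intros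
        bounded_linear.continuous_on[OF linear_imp_bounded_linear[OF linear_right]]) auto
  qed (simp add: continuous_on_const)
  ultimately show ?thesis by (simp add: continuous_on_sum)
qed

text \<open>Relative to the ambient inner product, \<open>B\<close> is given by an injective linear operator, which in
finite dimension is onto.\<close>

lemma functional_representation:
  assumes \<xi>: "linear (\<xi> :: 'e \<Rightarrow> real)"
  obtains Y where "\<And>X. \<xi> X = B Y X"
proof -
  obtain C :: "'e set" where C: "\<And>x. x = (\<Sum>c\<in>C. (inner x c / inner c c) *\<^sub>R c)"
    using orthogonal_basis by metis
  define R where "R \<phi> = (\<Sum>c\<in>C. (\<phi> c / inner c c) *\<^sub>R c)" for \<phi> :: "'e \<Rightarrow> real"
  have R: "\<phi> X = inner (R \<phi>) X" if "linear \<phi>" for \<phi> X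
  proof -
    have "\<phi> X = \<phi> (\<Sum>c\<in>C. (inner X c / inner c c) *\<^sub>R c)" using C by metis
    also have "\<dots> = (\<Sum>c\<in>C. (inner X c / inner c c) * \<phi> c)"
      by (simp add: linear_sum[OF that] linear_scale[OF that])
    also have "\<dots> = inner (R \<phi>) X"
      by (simp add: R_def inner_sum_left inner_commute[of X] mult_ac)
    finally show ?thesis .
  qed
  define L where "L X = R (B X)" for X
  have L: "B X Z = inner (L X) Z" for X Z
    unfolding L_def by (rule R[OF linear_right])
  have "linear L"
  proof
    have "inner (L (x + y)) z = inner (L x + L y) z" for x y z
      by (simp add: L[symmetric] inner_add_left form_left_simps)
    then show "L (x + y) = L x + L y" for x y by (rule vector_eq_rdot[THEN iffD1, OF allI])
    have "inner (L (r *\<^sub>R x)) z = inner (r *\<^sub>R L x) z" for r x z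
      by (simp add: L[symmetric] form_left_simps)
    then show "L (r *\<^sub>R x) = r *\<^sub>R L x" for r x by (rule vector_eq_rdot[THEN iffD1, OF allI])
  qed
  moreover have "inj L"
  proof (rule injI)
    fix x y assume "L x = L y"
    then have "B x Z = B y Z" for Z by (simp add: L)
    then have "B (x - y) (x - y) = 0" by (simp add: form_left_simps)
    then show "x = y" by (simp add: form_eq_0_iff)
  qed
  ultimately obtain Y where "L Y = R \<xi>"
    using linear_inj_imp_surj_finite_dim by (metis surjD)
  then have "\<xi> X = B Y X" for X by (simp add: L R[OF \<xi>])
  then show ?thesis by (rule that)
qed

text \<open>Maximise the Rayleigh quotient. At a maximum \<open>Y\<close> with value \<open>\<nu>\<close> the form \<open>Q\<close> of \<open>\<nu> - L\<close> is
positive semidefinite and vanishes at \<open>Y\<close>, so \<open>Y\<close> is in its kernel.\<close>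

lemma symmetric_eigenvector:
  assumes M: "subspace M" "M \<noteq> {0}" and L: "linear L" "\<And>X. X \<in> M \<Longrightarrow> L X \<in> M"
    and sym: "\<And>X Y. X \<in> M \<Longrightarrow> Y \<in> M \<Longrightarrow> B (L X) Y = B X (L Y)"
  obtains \<nu> Y where "Y \<in> M" "Y \<noteq> 0" "L Y = \<nu> *\<^sub>R Y"
proof -
  define S where "S = {Y \<in> M. norm Y = 1}"
  define q where "q Y = B (L Y) Y / B Y Y" for Y
  have "compact S"
  proof -
    have "S = (M \<inter> {x. norm x = 1}) \<inter> cball 0 1" by (auto simp: S_def)
    moreover have "compact ((M \<inter> {x. norm x = 1}) \<inter> cball 0 1)"
      by (intro closed_Int_compact closed_Int closed_finite_dim_subspace[OF M(1)] closed_Collect_eq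
          compact_cball continuous_intros)
    ultimately show ?thesis by simp
  qed
  obtain X where X: "X \<in> M" "X \<noteq> 0" using M subspace_0 by blast
  then have "(1 / norm X) *\<^sub>R X \<in> S" using subspace_scale[OF M(1)] by (simp add: S_def)
  then have "S \<noteq> {}" by blast
  have "continuous_on S q"
    unfolding q_def
    by (intro continuous_intros continuous_on_form
        bounded_linear.continuous_on[OF linear_imp_bounded_linear[OF L(1)]])
       (auto simp: S_def form_eq_0_iff)
  then obtain Y where Y: "Y \<in> S" "\<And>Z. Z \<in> S \<Longrightarrow> q Z \<le> q Y"
    using continuous_attains_sup[OF \<open>compact S\<close> \<open>S \<noteq> {}\<close>] by blast
  have Y': "Y \<in> M" "Y \<noteq> 0" using Y(1) by (auto simp: S_def)
  define \<nu> where "\<nu> = q Y"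
  define Q where "Q X Z = \<nu> * B X Z - B (L X) Z" for X Z
  have Q_nonneg: "0 \<le> Q Z Z" if "Z \<in> M" for Z
  proof (cases "Z = 0")
    case False
    define u where "u = (1 / norm Z) *\<^sub>R Z"
    have "u \<in> S" using that False subspace_scale[OF M(1)] by (simp add: u_def S_def)
    then have "q u \<le> \<nu>" using Y(2) by (simp add: \<nu>_def)
    moreover have "q u = q Z"
      using False by (simp add: q_def u_def linear_scale[OF L(1)] form_simps form_left_simps)
    ultimately have "B (L Z) Z / B Z Z \<le> \<nu>" by (simp add: q_def)
    then show ?thesis using positive[OF False] by (simp add: Q_def pos_divide_le_eq)
  qed (simp add: Q_def form_simps)
  have Q_Y: "Q Y Y = 0"
    using positive[OF Y'(2)] by (simp add: Q_def \<nu>_def q_def)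
  define Z where "Z = \<nu> *\<^sub>R Y - L Y"
  have Z: "Z \<in> M" using Y' L(2) M(1) by (simp add: Z_def subspace_diff subspace_scale)
  have "Q Y Z = 0"
  proof -
    define a where "a = Q Y Z"
    define b where "b = Q Z Z"
    have b: "0 \<le> b" using Q_nonneg[OF Z] by (simp add: b_def)
    have QZY: "Q Z Y = a"
      using sym[OF Z Y'(1)] by (simp add: a_def Q_def symmetric[of Z Y] symmetric[of Z "L Y"])
    have exp: "Q (Y + t *\<^sub>R Z) (Y + t *\<^sub>R Z) = 2 * t * a + t\<^sup>2 * b" for t
    proof -
      have "Q (Y + t *\<^sub>R Z) (Y + t *\<^sub>R Z) = Q Y Y + t * Q Y Z + t * Q Z Y + t * t * Q Z Z"
        by (simp add: Q_def linear_add[OF L(1)] linear_scale[OF L(1)] form_simps form_left_simps algebra_simps)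
      then show ?thesis by (simp add: Q_Y QZY a_def[symmetric] b_def[symmetric] power2_eq_square)
    qed
    define u where "u = a / (b + 1)"
    have a: "a = u * (b + 1)" using b by (simp add: u_def)
    have "0 \<le> 2 * (- u) * a + (- u)\<^sup>2 * b"
      unfolding exp[symmetric] using Y' Z M(1) by (intro Q_nonneg subspace_add subspace_scale)
    also have "\<dots> = - (u\<^sup>2 * (b + 2))"
      by (simp add: a power2_eq_square algebra_simps)
    finally have "u\<^sup>2 * (b + 2) \<le> 0" by simp
    then have "a = 0" using b a by (simp add: mult_le_0_iff)
    then show ?thesis by (simp add: a_def)
  qed
  moreover have "B (\<nu> *\<^sub>R Y - L Y) Z = Q Y Z" by (simp add: Q_def form_left_simps)
  ultimately have "B Z Z = 0" by (simp add: Z_def)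
  then have "L Y = \<nu> *\<^sub>R Y" by (simp add: form_eq_0_iff Z_def)
  then show ?thesis using that Y' by blast
qed

text \<open>On a minimal nonzero invariant subspace \<open>M\<close>, a symmetric operator commuting with the family is a
scalar, because its eigenspaces are invariant. This applies to the symmetric parts \<open>S h\<close>. If the
skew parts \<open>A h\<close> vanish, each vector of \<open>M\<close> is a real joint eigenvector. Otherwise fix a nonzero
one, \<open>J\<close>. All products \<open>A h J\<close> are symmetric, hence scalars, so \<open>J\<close> is up to scaling a
complex structure on \<open>M\<close> and each \<open>A h\<close> is a multiple of it; a vector of type \<open>(Y, -JY)\<close> is
then a complex joint eigenvector.\<close>

lemma commuting_orthogonal_joint_eigenvector:
  fixes Op :: "'h \<Rightarrow> 'e \<Rightarrow> 'e"
  assumes N: "subspace N" "N \<noteq> {0}"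
    and lin: "\<And>h. h \<in> T \<Longrightarrow> linear (Op h)"
    and inv: "\<And>h X. h \<in> T \<Longrightarrow> X \<in> N \<Longrightarrow> Op h X \<in> N"
    and orth: "\<And>h X Y. h \<in> T \<Longrightarrow> B (Op h X) (Op h Y) = B X Y"
    and comm: "\<And>g h X. g \<in> T \<Longrightarrow> h \<in> T \<Longrightarrow> Op g (Op h X) = Op h (Op g X)"
    and inverse: "\<And>h. h \<in> T \<Longrightarrow> h' h \<in> T" "\<And>h X. h \<in> T \<Longrightarrow> Op (h' h) (Op h X) = X"
  obtains X \<theta> where "X \<noteq> 0" "fst X \<in> N" "snd X \<in> N"
    "\<And>h. h \<in> T \<Longrightarrow> (Op h (fst X), Op h (snd X)) = complexified_scale (\<theta> h) X"
proof -
  define P where "P M \<longleftrightarrow> subspace M \<and> M \<subseteq> N \<and> M \<noteq> {0} \<and> (\<forall>h\<in>T. \<forall>X\<in>M. Op h X \<in> M)" for M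
  obtain M where M: "P M" "\<And>M'. P M' \<Longrightarrow> M' \<subseteq> M \<Longrightarrow> M' = M"
    using minimal_subspace[of P N] N inv by (metis P_def order_refl)
  have sub: "subspace M" "M \<subseteq> N" "M \<noteq> {0}" and Minv: "\<And>h X. h \<in> T \<Longrightarrow> X \<in> M \<Longrightarrow> Op h X \<in> M"
    using M(1) by (auto simp: P_def)
  have scalar: "\<exists>\<nu>. \<forall>Y\<in>M. L Y = \<nu> *\<^sub>R Y"
    if L: "linear L" "\<And>X. X \<in> M \<Longrightarrow> L X \<in> M"
      "\<And>X Y. X \<in> M \<Longrightarrow> Y \<in> M \<Longrightarrow> B (L X) Y = B X (L Y)"
      "\<And>h X. h \<in> T \<Longrightarrow> L (Op h X) = Op h (L X)" for L
  proof -
    obtain \<nu> Y where Y: "Y \<in> M" "Y \<noteq> 0" "L Y = \<nu> *\<^sub>R Y"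
      by (rule symmetric_eigenvector[OF sub(1,3) L(1,2,3)]) (assumption | rule that)+
    define E where "E = {Y \<in> M. L Y = \<nu> *\<^sub>R Y}"
    have "subspace E"
      using sub(1) L(1) by (auto simp: E_def subspace_def linear_add linear_scale linear_0 algebra_simps)
    moreover have "Op h X \<in> E" if "h \<in> T" "X \<in> E" for h X
      using that Minv L(4) linear_scale[OF lin] by (simp add: E_def)
    ultimately have "P E" using sub(2) Y by (auto simp: P_def E_def)
    then have "E = M" by (rule M(2)) (auto simp: E_def)
    then show ?thesis by (auto simp: E_def)
  qed
  define S where "S h X = Op h X + Op (h' h) X" for h X
  define A where "A h X = Op h X - Op (h' h) X" for h X
  have adj: "B (Op h X) Y = B X (Op (h' h) Y)" "B (Op (h' h) X) Y = B X (Op h Y)" if "h \<in> T" for h X Y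
    using orth[OF inverse(1)[OF that], of "Op h X" Y] orth[OF that, of "Op (h' h) X" Y]
      inverse(2)[OF that] comm[OF that inverse(1)[OF that]] by simp_all
  have linS: "linear (S h)" and linA: "linear (A h)" if "h \<in> T" for h
    unfolding S_def A_def using lin[OF that] lin[OF inverse(1)[OF that]]
    by (auto intro: linear_compose_add linear_compose_sub)
  have commA: "A h (Op g X) = Op g (A h X)" if "h \<in> T" "g \<in> T" for g h X
    using that comm[OF that] comm[OF inverse(1)[OF that(1)] that(2)] linear_diff[OF lin[OF that(2)]]
    by (simp add: A_def)
  have AM: "A h X \<in> M" if "h \<in> T" "X \<in> M" for h X
    using that Minv inverse(1) sub(1) by (simp add: A_def subspace_diff)
  have skew: "B (A h X) Y = - B X (A h Y)" if "h \<in> T" for h X Y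
    using adj[OF that] by (simp add: A_def form_simps form_left_simps)
  have "\<exists>c. \<forall>Y\<in>M. S h Y = c *\<^sub>R Y" if "h \<in> T" for h
  proof (rule scalar[OF linS[OF that]])
    show "S h X \<in> M" if "X \<in> M" for X
      using that \<open>h \<in> T\<close> Minv inverse(1) sub(1) by (simp add: S_def subspace_add)
    show "B (S h X) Y = B X (S h Y)" for X Y
      using adj[OF that] by (simp add: S_def form_simps form_left_simps)
    show "S h (Op g X) = Op g (S h X)" if "g \<in> T" for g X
      using that \<open>h \<in> T\<close> comm inverse(1) linear_add[OF lin[OF that]] by (simp add: S_def)
  qed
  then obtain a where a: "\<And>h Y. h \<in> T \<Longrightarrow> Y \<in> M \<Longrightarrow> S h Y = a h *\<^sub>R Y" by metis
  have Op_split: "Op h X = (1/2) *\<^sub>R (S h X + A h X)" for h X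
    by (simp add: S_def A_def flip: scaleR_2)
  obtain Y where Y: "Y \<in> M" "Y \<noteq> 0" using sub subspace_0 by blast
  show ?thesis
  proof (cases "\<forall>h\<in>T. \<forall>X\<in>M. A h X = 0")
    case True
    show ?thesis
    proof (rule that[of "(Y, 0)" "\<lambda>h. complex_of_real (a h / 2)"])
      show "(Op h (fst (Y, 0)), Op h (snd (Y, 0))) = complexified_scale (complex_of_real (a h / 2)) (Y, 0)"
        if "h \<in> T" for h
        using True that Y a[OF that] linear_0[OF lin[OF that]]
        by (simp add: complexified_scale_def Op_split[of h Y])
    qed (use Y sub subspace_0[OF N(1)] in \<open>auto simp: prod_eq_iff\<close>)
  next
    case False
    then obtain g X0 where g: "g \<in> T" "X0 \<in> M" "A g X0 \<noteq> 0" by auto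
    define J where "J = A g"
    have "\<exists>c. \<forall>Y\<in>M. A h (J Y) = c *\<^sub>R Y" if h: "h \<in> T" for h
    proof (rule scalar)
      show "linear (\<lambda>Y. A h (J Y))"
        using linear_compose[OF linA[OF g(1)] linA[OF h]] by (simp add: J_def o_def)
      show "A h (J X) \<in> M" if "X \<in> M" for X using that AM g(1) h by (simp add: J_def)
      show "A h (J (Op k X)) = Op k (A h (J X))" if "k \<in> T" for k X
        using commA h g(1) that by (simp add: J_def)
      have "A g (A h Z) = A h (A g Z)" for Z
        using commA[OF g(1) h] commA[OF g(1) inverse(1)[OF h]] linear_diff[OF linA[OF g(1)]]
        by (simp add: A_def[of h])
      then show "B (A h (J X)) Y = B X (A h (J Y))" for X Y
        using skew[OF h] skew[OF g(1)] by (simp add: J_def)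
    qed
    then obtain n where n: "\<And>h Y. h \<in> T \<Longrightarrow> Y \<in> M \<Longrightarrow> A h (J Y) = n h *\<^sub>R Y" by metis
    define \<mu> where "\<mu> = n g"
    have JJ: "J (J Z) = \<mu> *\<^sub>R Z" if "Z \<in> M" for Z
      using n[OF g(1) that] by (simp add: J_def \<mu>_def)
    have JM: "J Z \<in> M" if "Z \<in> M" for Z using AM[OF g(1) that] by (simp add: J_def)
    have "\<mu> * B X0 X0 = - B (J X0) (J X0)"
      using skew[OF g(1), of "J X0" X0] JJ[OF g(2)] by (simp add: J_def form_left_simps)
    moreover have "0 < B (J X0) (J X0)" using g(3) by (intro positive) (simp add: J_def)
    ultimately have "\<mu> * B X0 X0 < 0" by simp
    then have \<mu>: "\<mu> < 0"
      using form_nonneg[of X0] by (simp add: mult_less_0_iff)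
    define k where "k = sqrt (- \<mu>)"
    have k: "k > 0" "k * k = - \<mu>" using \<mu> by (auto simp: k_def)
    have Aform: "A h Z = (n h / \<mu>) *\<^sub>R J Z" if "h \<in> T" "Z \<in> M" for h Z
    proof -
      have "\<mu> *\<^sub>R A h Z = n h *\<^sub>R J Z"
        using n[OF that(1) JM[OF that(2)]] JJ[OF that(2)] linear_scale[OF linA[OF that(1)]] by simp
      then have "(1 / \<mu>) *\<^sub>R (\<mu> *\<^sub>R A h Z) = (1 / \<mu>) *\<^sub>R (n h *\<^sub>R J Z)" by simp
      then show ?thesis using \<mu> by simp
    qed
    define b where "b h = k * n h / (2 * \<mu>)" for h
    define W where "W = - ((1 / k) *\<^sub>R J Y)"
    have WM: "W \<in> M" using JM[OF Y(1)] sub(1) by (simp add: W_def subspace_neg subspace_scale)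
    show ?thesis
    proof (rule that[of "(Y, W)" "\<lambda>h. Complex (a h / 2) (b h)"])
      fix h assume h: "h \<in> T"
      have b1: "b h / k = n h / (2 * \<mu>)" using k(1) by (simp add: b_def)
      have mu: "\<mu> = - (k * k)" using k(2) by simp
      have b2: "n h / (2 * k) = - b h" using k(1) by (simp add: b_def mu)
      have "Op h Y = (a h / 2) *\<^sub>R Y + (n h / (2 * \<mu>)) *\<^sub>R J Y"
        using a[OF h Y(1)] Aform[OF h Y(1)] by (simp add: Op_split[of h Y] scaleR_add_right)
      then have 1: "Op h Y = (a h / 2) *\<^sub>R Y - b h *\<^sub>R W"
        by (simp add: W_def b1[symmetric])
      have "Op h (J Y) = (a h / 2) *\<^sub>R J Y + (n h / 2) *\<^sub>R Y"
        using a[OF h JM[OF Y(1)]] Aform[OF h JM[OF Y(1)]] JJ[OF Y(1)] \<mu>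
        by (simp add: Op_split[of h "J Y"] scaleR_add_right)
      then have "Op h W = - ((1 / k) *\<^sub>R ((a h / 2) *\<^sub>R J Y + (n h / 2) *\<^sub>R Y))"
        by (simp add: W_def linear_neg[OF lin[OF h]] linear_scale[OF lin[OF h]])
      also have "\<dots> = (a h / 2) *\<^sub>R W - (n h / (2 * k)) *\<^sub>R Y"
        by (simp add: W_def scaleR_add_right mult.commute)
      finally have 2: "Op h W = b h *\<^sub>R Y + (a h / 2) *\<^sub>R W" by (simp add: b2)
      show "(Op h (fst (Y, W)), Op h (snd (Y, W))) = complexified_scale (Complex (a h / 2) (b h)) (Y, W)"
        by (simp add: complexified_scale_def 1 2)
    qed (use Y WM sub(2) in \<open>auto simp: prod_eq_iff\<close>)
  qed
qed

end

section \<open>Maximal tori, roots and the moment map\<close>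

lemma Ad_invariant_positive_form:
  "Ad_invariant_inner G c B \<Longrightarrow> positive_form B"
  by (rule positive_form.intro) (auto simp: Ad_invariant_inner_def)

context compact_lie_group_chart begin

text \<open>The infinitesimal form of the torus being abelian.\<close>

lemma torus_Ad_fixes_lie_algebra:
  assumes "torus_in G T" "h \<in> T" "A \<in> subgroup_lie_algebra G c T"
  shows "Ad G c h A = A"
proof (rule lie_exp_inject)
  fix s
  have T: "T \<subseteq> carrier G" "\<And>g h. g \<in> T \<Longrightarrow> h \<in> T \<Longrightarrow> g \<otimes> h = h \<otimes> g"
    using assms(1) subgroup.subset by (auto simp: torus_in_def)
  have h: "h \<in> carrier G" using T assms(2) by blast
  have e: "lie_exp G c (s *\<^sub>R A) \<in> T" using assms(3) by (simp add: subgroup_lie_algebra_def)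
  have "lie_exp G c (s *\<^sub>R Ad G c h A) = h \<otimes> lie_exp G c (s *\<^sub>R A) \<otimes> inv h"
    by (rule lie_exp_Ad[OF h])
  also have "\<dots> = lie_exp G c (s *\<^sub>R A) \<otimes> h \<otimes> inv h"
    using T(2)[OF assms(2) e] by simp
  also have "\<dots> = lie_exp G c (s *\<^sub>R A)"
    using h lie_exp_closed by (simp add: m_assoc)
  finally show "lie_exp G c (s *\<^sub>R Ad G c h A) = lie_exp G c (s *\<^sub>R A)" .
qed

text \<open>The one-parameter subgroup \<open>\<gamma>\<close> of \<open>A\<close> commutes with \<open>T\<close>, so the closure of the product of \<open>T\<close>
with \<open>\<gamma>\<close> is again a torus. By maximality it is \<open>T\<close>.\<close>

lemma maximal_torus_lie_algebraI:
  assumes T: "maximal_torus G T" and fixed: "\<And>h. h \<in> T \<Longrightarrow> Ad G c h A = A"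
  shows "A \<in> subgroup_lie_algebra G c T"
proof -
  define \<gamma> where "\<gamma> s = lie_exp G c (s *\<^sub>R A)" for s
  have \<gamma>: "one_parameter_subgroup G \<gamma>"
    unfolding \<gamma>_def[abs_def] by (rule one_parameter_subgroup_lie_exp)
  note \<gamma>D = one_parameter_subgroupD[OF \<gamma>]
  have tor: "subgroup T G" "compact T" "connected T" "\<And>g h. g \<in> T \<Longrightarrow> h \<in> T \<Longrightarrow> g \<otimes> h = h \<otimes> g"
    using T by (auto simp: maximal_torus_def torus_in_def)
  have TG: "h \<in> carrier G" if "h \<in> T" for h using tor(1) that subgroup.subset by blast
  have comm: "h \<otimes> \<gamma> s = \<gamma> s \<otimes> h" if "h \<in> T" for h s
  proof -
    have "\<gamma> s = h \<otimes> \<gamma> s \<otimes> inv h"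
      using lie_exp_Ad[OF TG[OF that], of s A] fixed[OF that] by (simp add: \<gamma>_def)
    then have "\<gamma> s \<otimes> h = h \<otimes> \<gamma> s \<otimes> inv h \<otimes> h" by simp
    then show ?thesis using TG[OF that] \<gamma>D(1) by (simp add: m_assoc)
  qed
  define S where "S = (\<lambda>p. fst p \<otimes> \<gamma> (snd p)) ` (T \<times> UNIV)"
  define T' where "T' = closure S"
  have SG: "S \<subseteq> carrier G" using TG \<gamma>D(1) by (auto simp: S_def)
  have T'G: "T' \<subseteq> carrier G"
    unfolding T'_def using closure_minimal[OF SG compact_imp_closed[OF compact_carrier]] .
  have S_T': "S \<subseteq> T'" by (simp add: T'_def closure_subset)
  have T_S: "h \<in> S" if "h \<in> T" for h
    unfolding S_def using that TG \<gamma>D(4) by (intro image_eqI[of _ _ "(h, 0)"]) auto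
  have mult_eq: "(h \<otimes> \<gamma> s) \<otimes> (h' \<otimes> \<gamma> s') = (h \<otimes> h') \<otimes> \<gamma> (s + s')" if "h \<in> T" "h' \<in> T" for h h' s s'
  proof -
    have "(h \<otimes> \<gamma> s) \<otimes> (h' \<otimes> \<gamma> s') = h \<otimes> (\<gamma> s \<otimes> h') \<otimes> \<gamma> s'"
      using TG that \<gamma>D(1) by (simp add: m_assoc)
    also have "\<dots> = h \<otimes> (h' \<otimes> \<gamma> s) \<otimes> \<gamma> s'" using comm[OF that(2)] by simp
    also have "\<dots> = (h \<otimes> h') \<otimes> \<gamma> (s + s')" using TG that \<gamma>D(1) by (simp add: m_assoc \<gamma>D(3))
    finally show ?thesis .
  qed
  have S_mult: "x \<otimes> y \<in> S" if xy: "x \<in> S" "y \<in> S" for x y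
  proof -
    obtain h s h' s' where hs: "h \<in> T" "h' \<in> T" "x = h \<otimes> \<gamma> s" "y = h' \<otimes> \<gamma> s'"
      using xy by (auto simp: S_def)
    have "x \<otimes> y = (h \<otimes> h') \<otimes> \<gamma> (s + s')" unfolding hs(3,4) by (rule mult_eq[OF hs(1,2)])
    moreover have "h \<otimes> h' \<in> T" using subgroup.m_closed[OF tor(1) hs(1,2)] .
    ultimately show ?thesis
      unfolding S_def by (intro image_eqI[of _ _ "(h \<otimes> h', s + s')"]) auto
  qed
  have S_comm: "x \<otimes> y = y \<otimes> x" if xy: "x \<in> S" "y \<in> S" for x y
  proof -
    obtain h s h' s' where hs: "h \<in> T" "h' \<in> T" "x = h \<otimes> \<gamma> s" "y = h' \<otimes> \<gamma> s'"
      using xy by (auto simp: S_def)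
    show ?thesis
      unfolding hs(3,4) mult_eq[OF hs(1,2)] mult_eq[OF hs(2,1)] using tor(4)[OF hs(1,2)] by (simp add: add.commute)
  qed
  have S_inv: "inv x \<in> S" if xy: "x \<in> S" for x
  proof -
    obtain h s where hs: "h \<in> T" "x = h \<otimes> \<gamma> s"
      using xy by (auto simp: S_def)
    have hT: "inv h \<in> T" using subgroup.m_inv_closed[OF tor(1) hs(1)] .
    have "inv x = \<gamma> (- s) \<otimes> inv h"
      unfolding hs(2) using TG[OF hs(1)] \<gamma>D(1) by (simp add: inv_mult_group \<gamma>D(5))
    also have "\<dots> = inv h \<otimes> \<gamma> (- s)" using comm[OF hT] by simp
    finally show ?thesis
      unfolding S_def using hT by (intro image_eqI[of _ _ "(inv h, - s)"]) auto
  qed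
  have cont_mult: "continuous_on (T' \<times> T') (\<lambda>p. fst p \<otimes> snd p)"
    using continuous_on_subset[OF continuous_mult, of "T' \<times> T'"] T'G by (auto simp: split_beta)
  have cont_mult': "continuous_on (T' \<times> T') (\<lambda>p. snd p \<otimes> fst p)"
    by (rule continuous_on_compose2[OF cont_mult, of "T' \<times> T'" "\<lambda>p. (snd p, fst p)", simplified])
      (auto intro!: continuous_intros)
  have T'_mult: "x \<otimes> y \<in> T'" if "x \<in> T'" "y \<in> T'" for x y
  proof -
    have "(\<lambda>p. fst p \<otimes> snd p) ` closure (S \<times> S) \<subseteq> T'"
      using cont_mult S_mult S_T'
      by (intro image_closure_subset) (auto simp: closure_Times T'_def)
    then have "\<forall>p\<in>closure (S \<times> S). fst p \<otimes> snd p \<in> T'"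
      by (simp only: image_subset_iff)
    from bspec[OF this, of "(x, y)"] that show ?thesis by (simp add: closure_Times T'_def)
  qed
  have T'_comm: "x \<otimes> y = y \<otimes> x" if "x \<in> T'" "y \<in> T'" for x y
  proof -
    have "(\<lambda>p. (fst p \<otimes> snd p, snd p \<otimes> fst p)) ` closure (S \<times> S) \<subseteq> {y. \<exists>x. y = (x, x)}"
    proof (rule image_closure_subset[OF _ closed_diagonal])
      show "continuous_on (closure (S \<times> S)) (\<lambda>p. (fst p \<otimes> snd p, snd p \<otimes> fst p))"
        using cont_mult cont_mult' by (auto simp: closure_Times T'_def intro: continuous_on_Pair)
      show "(\<lambda>p. (fst p \<otimes> snd p, snd p \<otimes> fst p)) ` (S \<times> S) \<subseteq> {y. \<exists>x. y = (x, x)}"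
        using S_comm by auto
    qed
    then have "\<forall>p\<in>closure (S \<times> S). (fst p \<otimes> snd p, snd p \<otimes> fst p) \<in> {y. \<exists>x. y = (x, x)}"
      by (simp only: image_subset_iff)
    from bspec[OF this, of "(x, y)"] that show ?thesis by (simp add: closure_Times T'_def)
  qed
  have T'_inv: "inv x \<in> T'" if "x \<in> T'" for x
  proof -
    have "(\<lambda>x. inv x) ` closure S \<subseteq> T'"
      using continuous_on_subset[OF continuous_inv T'G] S_inv S_T'
      by (intro image_closure_subset) (auto simp: T'_def)
    then show ?thesis using that by (auto simp: T'_def)
  qed
  have one: "\<one> \<in> T'" using S_T' T_S subgroup.one_closed[OF tor(1)] by blast
  have "torus_in G T'"
    unfolding torus_in_def
  proof (intro conjI ballI)
    show "subgroup T' G"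
      using T'G T'_mult T'_inv one by (intro subgroup.intro) auto
    show "compact T'"
      using compact_Int_closed[OF compact_carrier, of T'] T'G
      by (simp add: T'_def Int_absorb1)
    have "continuous_on (T \<times> UNIV) (\<lambda>p. \<gamma> (snd p))"
      by (rule continuous_on_compose2[OF \<gamma>D(2)]) (auto intro: continuous_intros)
    then have "continuous_on (T \<times> UNIV) (\<lambda>p. (case (fst p, \<gamma> (snd p)) of (g, h) \<Rightarrow> g \<otimes> h))"
      by (intro continuous_on_compose2[OF continuous_mult] continuous_on_Pair continuous_on_fst continuous_on_id)
        (use TG \<gamma>D(1) in auto)
    then have "connected S"
      unfolding S_def using tor(3) by (intro connected_continuous_image connected_Times) auto
    then show "connected T'" unfolding T'_def by (rule connected_imp_connected_closure)
    show "x \<otimes> y = y \<otimes> x" if "x \<in> T'" "y \<in> T'" for x y using T'_comm that .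
  qed
  moreover have "T \<subseteq> T'" using T_S S_T' by blast
  ultimately have "T' = T" using T by (auto simp: maximal_torus_def)
  moreover have "\<gamma> s \<in> S" for s
    unfolding S_def using subgroup.one_closed[OF tor(1)] \<gamma>D(1) by (intro image_eqI[of _ _ "(\<one>, s)"]) auto
  ultimately show ?thesis using S_T' by (auto simp: subgroup_lie_algebra_def \<gamma>_def)
qed

text \<open>The norm is constant along the orbits of a one-parameter subgroup.\<close>

lemma derived_rep_skew:
  assumes \<rho>: "unitary_rep G \<rho>"
  shows "Re (cinner (derived_rep G c \<rho> A z) z) = 0"
proof -
  let ?U = "\<lambda>s. \<rho> (lie_exp G c (s *\<^sub>R A)) z"
  note d = derived_rep_has_vector_derivative[OF \<rho>, of A z, unfolded has_vector_derivative_def]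
  have "((\<lambda>s. inner (?U s) (?U s)) has_derivative
      (\<lambda>h. inner (?U 0) (h *\<^sub>R derived_rep G c \<rho> A z) + inner (h *\<^sub>R derived_rep G c \<rho> A z) (?U 0))) (at 0)"
    by (rule has_derivative_inner[OF d d])
  moreover have "inner (?U s) (?U s) = inner z z" for s
    using unitary_rep_norm[OF \<rho> lie_exp_closed] by (simp add: power2_norm_eq_inner[symmetric])
  ultimately have "((\<lambda>s::real. inner z z) has_derivative
      (\<lambda>h. inner (?U 0) (h *\<^sub>R derived_rep G c \<rho> A z) + inner (h *\<^sub>R derived_rep G c \<rho> A z) (?U 0))) (at 0)"
    by simp
  from fun_cong[OF has_derivative_unique[OF this has_derivative_const], of 1]
  have "inner (derived_rep G c \<rho> A z) z = 0"
    using lie_exp_zero[of A] unitary_rep_one[OF \<rho>] by (simp add: inner_commute)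
  then show ?thesis by (simp add: inner_eq_Re_cinner)
qed

lemma linear_moment_map:
  assumes "unitary_rep G \<rho>" shows "linear (moment_map G c \<rho> z)"
  unfolding moment_map_def
  by (intro linearI) (simp_all add: linear_add[OF linear_derived_rep[OF assms]]
      linear_scale[OF linear_derived_rep[OF assms]] omega_add_right omega_scaleR_right)

lemma moment_map_equivariant:
  assumes \<rho>: "unitary_rep G \<rho>" and g: "g \<in> carrier G"
  shows "moment_map G c \<rho> (\<rho> g z) = coadjoint G c g (moment_map G c \<rho> z)"
proof
  fix A
  define A' where "A' = Ad G c (inv g) A"
  have "((\<lambda>s. \<rho> g (\<rho> (lie_exp G c (s *\<^sub>R A')) z)) has_vector_derivative \<rho> g (derived_rep G c \<rho> A' z)) (at 0)"
    by (rule bounded_linear.has_vector_derivative[OF linear_imp_bounded_linear[OF unitary_rep_linear[OF \<rho> g]]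
          derived_rep_has_vector_derivative[OF \<rho>]])
  moreover have "\<rho> g (\<rho> (lie_exp G c (s *\<^sub>R A')) z) = \<rho> (lie_exp G c (s *\<^sub>R A)) (\<rho> g z)" for s
  proof -
    have "g \<otimes> lie_exp G c (s *\<^sub>R A') = lie_exp G c (s *\<^sub>R A) \<otimes> g"
      using g lie_exp_closed[of "s *\<^sub>R A"] lie_exp_Ad[OF inv_closed[OF g], of s A]
      by (simp add: A'_def m_assoc[symmetric])
    then show ?thesis
      using unitary_rep_mult[OF \<rho> g lie_exp_closed] unitary_rep_mult[OF \<rho> lie_exp_closed g] by metis
  qed
  ultimately have "((\<lambda>s. \<rho> (lie_exp G c (s *\<^sub>R A)) (\<rho> g z)) has_vector_derivative \<rho> g (derived_rep G c \<rho> A' z)) (at 0)"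
    by simp
  then have "derived_rep G c \<rho> A (\<rho> g z) = \<rho> g (derived_rep G c \<rho> A' z)"
    using derived_rep_has_vector_derivative[OF \<rho>] vector_derivative_unique_at by blast
  then show "moment_map G c \<rho> (\<rho> g z) A = coadjoint G c g (moment_map G c \<rho> z) A"
    using unitary_rep_cinner[OF \<rho> g] by (simp add: moment_map_def coadjoint_def omega_def A'_def)
qed

lemma orbit_subset_moment_image:
  assumes "unitary_rep G \<rho>" "moment_map G c \<rho> z = \<alpha>"
  shows "coadjoint_orbit G c \<alpha> \<subseteq> range (moment_map G c \<rho>)"
  unfolding coadjoint_orbit_def
  using moment_map_equivariant[OF assms(1), of _ z] assms(2) by (auto simp: image_iff) metis

text \<open>Represent \<open>\<xi>\<close> by a vector \<open>Y\<close> with respect to \<open>B\<close>; it lies in the subspace \<open>N\<close> orthogonal to the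
torus and to all root vectors. This subspace is invariant under the torus, so if it were nonzero
it would contain both components of a joint eigenvector, that is, of a root vector or of a
vector fixed by the torus, which would be orthogonal to itself.\<close>

lemma functional_eq_0_if_vanishing_on_root_decomposition:
  assumes T: "maximal_torus G T" and B: "Ad_invariant_inner G c B" and \<xi>: "linear (\<xi> :: _ \<Rightarrow> real)"
    and torus: "\<And>A. A \<in> subgroup_lie_algebra G c T \<Longrightarrow> \<xi> A = 0"
    and root: "\<And>\<theta> X. \<theta> \<in> roots G c T \<Longrightarrow> X \<in> root_space G c T \<theta> \<Longrightarrow> \<xi> (fst X) = 0 \<and> \<xi> (snd X) = 0"
  shows "\<xi> A = 0"
proof -
  interpret positive_form B using B by (rule Ad_invariant_positive_form)
  have Binv: "B (Ad G c g X) (Ad G c g Y) = B X Y" if "g \<in> carrier G" for g X Y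
    using B that by (auto simp: Ad_invariant_inner_def)
  have tor: "torus_in G T" "subgroup T G" "\<And>g h. g \<in> T \<Longrightarrow> h \<in> T \<Longrightarrow> g \<otimes> h = h \<otimes> g"
    using T by (auto simp: maximal_torus_def torus_in_def)
  have TG: "h \<in> carrier G" and Tinv: "inv h \<in> T" if "h \<in> T" for h
    using subsetD[OF subgroup.subset[OF tor(2)] that] subgroup.m_inv_closed[OF tor(2) that] by auto
  have Ad_inv: "Ad G c (inv h) (Ad G c h X) = X" "Ad G c h (Ad G c (inv h) X) = X" if "h \<in> T" for h X
    using Ad_mult[OF inv_closed[OF TG[OF that]] TG[OF that], of X]
      Ad_mult[OF TG[OF that] inv_closed[OF TG[OF that]], of X] TG[OF that] by (simp_all add: Ad_one)
  obtain Y where Y: "\<And>X. \<xi> X = B Y X" using functional_representation[OF \<xi>] by blast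
  define N where "N = {Y. (\<forall>A\<in>subgroup_lie_algebra G c T. B A Y = 0) \<and>
    (\<forall>\<theta>\<in>roots G c T. \<forall>X\<in>root_space G c T \<theta>. B (fst X) Y = 0 \<and> B (snd X) Y = 0)}"
  have "subspace N"
    by (auto simp: N_def subspace_def form_simps)
  have YN: "Y \<in> N"
    using torus root by (auto simp: N_def symmetric[of _ Y] Y[symmetric])
  have N_inv: "Ad G c h Z \<in> N" if h: "h \<in> T" and Z: "Z \<in> N" for h Z
  proof -
    have adj: "B X (Ad G c h Z) = B (Ad G c (inv h) X) Z" for X
      using Binv[OF TG[OF h], of "Ad G c (inv h) X" Z] by (simp add: Ad_inv[OF h])
    have "B X (Ad G c h Z) = 0" if "X \<in> subgroup_lie_algebra G c T" for X
      using Z that torus_Ad_fixes_lie_algebra[OF tor(1) Tinv[OF h] that] by (simp add: adj N_def)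
    moreover have "B (fst X) (Ad G c h Z) = 0 \<and> B (snd X) (Ad G c h Z) = 0"
      if "\<theta> \<in> roots G c T" "X \<in> root_space G c T \<theta>" for \<theta> X
    proof -
      have "(Ad G c (inv h) (fst X), Ad G c (inv h) (snd X)) = complexified_scale (\<theta> (inv h)) X"
        using that(2) Tinv[OF h] by (simp add: root_space_def)
      moreover have "B (fst X) Z = 0" "B (snd X) Z = 0" using Z that by (auto simp: N_def)
      ultimately show ?thesis
        by (simp add: adj complexified_scale_def form_left_simps)
    qed
    ultimately show ?thesis by (simp add: N_def)
  qed
  have "N = {0}"
  proof (rule ccontr)
    assume "N \<noteq> {0}"
    then obtain X \<theta> where X: "X \<noteq> 0" "fst X \<in> N" "snd X \<in> N"
      "\<And>h. h \<in> T \<Longrightarrow> (Ad G c h (fst X), Ad G c h (snd X)) = complexified_scale (\<theta> h) X"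
    proof (rule commuting_orthogonal_joint_eigenvector[OF \<open>subspace N\<close>, of T "Ad G c" "\<lambda>h. inv h"])
      show "linear (Ad G c h)" if "h \<in> T" for h by (rule linear_Ad[OF TG[OF that]])
      show "Ad G c h Z \<in> N" if "h \<in> T" "Z \<in> N" for h Z by (rule N_inv[OF that])
      show "B (Ad G c h Z) (Ad G c h Z') = B Z Z'" if "h \<in> T" for h Z Z' by (rule Binv[OF TG[OF that]])
      show "Ad G c g (Ad G c h Z) = Ad G c h (Ad G c g Z)" if "g \<in> T" "h \<in> T" for g h Z
        using Ad_mult[OF TG[OF that(1)] TG[OF that(2)]] Ad_mult[OF TG[OF that(2)] TG[OF that(1)]] tor(3)[OF that] by simp
      show "inv h \<in> T" if "h \<in> T" for h by (rule Tinv[OF that])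
      show "Ad G c (inv h) (Ad G c h Z) = Z" if "h \<in> T" for h Z by (rule Ad_inv(1)[OF that])
    qed blast
    have "B (fst X) (fst X) = 0 \<and> B (snd X) (snd X) = 0"
    proof (cases "\<exists>h\<in>T. \<theta> h \<noteq> 1")
      case True
      let ?\<theta> = "restrict \<theta> T"
      have Xr: "X \<in> root_space G c T ?\<theta>" using X(4) by (simp add: root_space_def)
      then have "?\<theta> \<in> roots G c T" using True X(1) by (auto simp: roots_def)
      then show ?thesis using Xr X(2,3) by (auto simp: N_def)
    next
      case False
      have "Ad G c h (fst X) = fst X" "Ad G c h (snd X) = snd X" if "h \<in> T" for h
        using X(4)[OF that] False that by (simp_all add: complexified_scale_def)
      then have "fst X \<in> subgroup_lie_algebra G c T" "snd X \<in> subgroup_lie_algebra G c T"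
        using maximal_torus_lie_algebraI[OF T] by blast+
      then show ?thesis using X(2,3) by (auto simp: N_def)
    qed
    then show False using X(1) by (simp add: form_eq_0_iff prod_eq_iff)
  qed
  then have "Y = 0" using YN by blast
  then show ?thesis by (simp add: Y form_left_simps)
qed

text \<open>The complex number with parts \<open>B (fst X) A\<close> and \<open>B (snd X) A\<close> is multiplied by \<open>\<theta> h\<close> when \<open>h\<close> acts
on \<open>X\<close> and \<open>A\<close>, but is also unchanged by invariance of \<open>B\<close>.\<close>

lemma root_space_orthogonal_torus:
  assumes T: "torus_in G T" and B: "Ad_invariant_inner G c B"
    and \<theta>: "\<theta> \<in> roots G c T" and X: "X \<in> root_space G c T \<theta>" and A: "A \<in> subgroup_lie_algebra G c T"
  shows "B (fst X) A = 0 \<and> B (snd X) A = 0"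
proof -
  interpret positive_form B using B by (rule Ad_invariant_positive_form)
  obtain h where h: "h \<in> T" "\<theta> h \<noteq> 1" using \<theta> by (auto simp: roots_def)
  have hG: "h \<in> carrier G" using T h subgroup.subset by (auto simp: torus_in_def)
  have inv: "B (Ad G c h Z) A = B Z A" for Z
    using B hG torus_Ad_fixes_lie_algebra[OF T h(1) A] by (metis Ad_invariant_inner_def)
  define b where "b = Complex (B (fst X) A) (B (snd X) A)"
  have "(Ad G c h (fst X), Ad G c h (snd X)) = complexified_scale (\<theta> h) X"
    using X h(1) by (simp add: root_space_def)
  then have "b = \<theta> h * b"
    using inv[of "fst X"] inv[of "snd X"]
    by (simp add: b_def complexified_scale_def form_left_simps complex_eq_iff)
  then have "b = 0" using h(2) by simp
  then show ?thesis by (simp add: b_def complex_eq_iff)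
qed

text \<open>Complex conjugation of a root vector conjugates the root, and invariance of \<open>B\<close> forces roots to
have modulus one. The complement of a positive system is therefore reached by conjugation.\<close>

lemma root_space_conjugate:
  assumes B: "Ad_invariant_inner G c B" and TG: "T \<subseteq> carrier G" and X: "X \<in> root_space G c T \<theta>"
  shows "(fst X, - snd X) \<in> root_space G c T (restrict (\<lambda>h. inverse (\<theta> h)) T)"
proof (cases "X = 0")
  case True
  then show ?thesis
    using TG linear_0[OF linear_Ad] by (auto simp: root_space_def complexified_scale_def)
next
  case False
  interpret positive_form B using B by (rule Ad_invariant_positive_form)
  show ?thesis
    unfolding root_space_def
  proof (intro CollectI ballI)
    fix h assume h: "h \<in> T"
    then have hG: "h \<in> carrier G" using TG by blast
    define x y where "x = fst X" and "y = snd X"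
    have Ad: "Ad G c h x = Re (\<theta> h) *\<^sub>R x - Im (\<theta> h) *\<^sub>R y" "Ad G c h y = Im (\<theta> h) *\<^sub>R x + Re (\<theta> h) *\<^sub>R y"
      using X h by (auto simp: root_space_def complexified_scale_def x_def y_def)
    have "B (Ad G c h Z) (Ad G c h Z) = B Z Z" for Z
      using B hG by (auto simp: Ad_invariant_inner_def)
    from this[of x] this[of y]
    have "B x x + B y y = ((Re (\<theta> h))\<^sup>2 + (Im (\<theta> h))\<^sup>2) * (B x x + B y y)"
      unfolding Ad by (simp add: form_simps form_left_simps symmetric[of y x] power2_eq_square algebra_simps)
    moreover have "B x x + B y y > 0"
      using False positive[of x] positive[of y] form_nonneg[of x] form_nonneg[of y]
      by (cases "x = 0") (auto simp: x_def y_def prod_eq_iff add_pos_nonneg add_nonneg_pos)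
    ultimately have "(Re (\<theta> h))\<^sup>2 + (Im (\<theta> h))\<^sup>2 = 1" by simp
    then have "inverse (\<theta> h) = cnj (\<theta> h)"
      by (simp add: complex_eq_iff)
    then show "(Ad G c h (fst (fst X, - snd X)), Ad G c h (snd (fst X, - snd X)))
        = complexified_scale (restrict (\<lambda>h. inverse (\<theta> h)) T h) (fst X, - snd X)"
      using h Ad linear_neg[OF linear_Ad[OF hG]] by (simp add: complexified_scale_def x_def y_def)
  qed
qed

text \<open>The minus sign stems from the inverse in the action of the group on functions.\<close>

lemma highest_weight_polynomial_derivative:
  fixes \<Phi> :: "'w::hermitian_space \<Rightarrow> 'v::hermitian_space \<Rightarrow> complex"
  assumes \<rho>: "unitary_rep G \<rho>"
    and equiv: "\<And>g w z. g \<in> carrier G \<Longrightarrow> \<Phi> (\<sigma> g w) z = \<Phi> w (\<rho> (inv g) z)"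
    and D: "(\<Phi> v has_derivative D) (at z)"
  shows "((\<lambda>s. \<Phi> (\<sigma> (lie_exp G c (s *\<^sub>R A)) v) z) has_vector_derivative - D (derived_rep G c \<rho> A z)) (at 0)"
proof -
  have lin: "linear D" using D by (rule has_derivative_linear)
  have neg: "derived_rep G c \<rho> (- A) z = - derived_rep G c \<rho> A z"
    using linear_neg[OF linear_derived_rep[OF \<rho>]] by metis
  let ?U = "\<lambda>s. \<rho> (lie_exp G c (s *\<^sub>R (- A))) z"
  have U: "(?U has_vector_derivative derived_rep G c \<rho> (- A) z) (at 0)"
    by (rule derived_rep_has_vector_derivative[OF \<rho>])
  have "(\<Phi> v has_derivative D) (at (?U 0))"
    using D lie_exp_zero[of "- A"] unitary_rep_one[OF \<rho>] by simp
  from diff_chain_at[OF U[unfolded has_vector_derivative_def] this]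
  have "((\<lambda>s. \<Phi> v (?U s)) has_vector_derivative D (derived_rep G c \<rho> (- A) z)) (at 0)"
    by (simp add: has_vector_derivative_def o_def linear_scale[OF lin])
  moreover have "\<Phi> v (?U s) = \<Phi> (\<sigma> (lie_exp G c (s *\<^sub>R A)) v) z" for s
    using equiv[OF lie_exp_closed] lie_exp_minus[of s A] by simp
  ultimately show ?thesis by (simp add: neg linear_neg[OF lin])
qed

text \<open>The maximum point \<open>z\<close> of the Gaussian-weighted highest weight polynomial has the required moment.
There, \<open>m A\<close> times the value of the polynomial is minus the value of \<open>A\<close> acting on it, which is
known for \<open>A\<close> in the torus and for positive root vectors.\<close>

proposition highest_weight_in_moment_image:
  fixes \<rho> :: "'a \<Rightarrow> 'v::hermitian_space \<Rightarrow> 'v" and \<sigma> :: "'a \<Rightarrow> 'w::hermitian_space \<Rightarrow> 'w"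
  assumes \<rho>: "unitary_rep G \<rho>" and \<sigma>: "unitary_rep G \<sigma>" and occ: "occurs_in_polynomials G \<rho> \<sigma>"
    and T: "maximal_torus G T" and P: "positive_system G c T P" and B: "Ad_invariant_inner G c B"
    and hw: "highest_weight G c T P \<sigma> \<mu>" and \<alpha>: "linear \<alpha>"
    and \<alpha>_torus: "\<And>A. A \<in> subgroup_lie_algebra G c T \<Longrightarrow> weight_differential G c \<mu> A = \<i> * complex_of_real (\<alpha> A)"
    and \<alpha>_orth: "\<And>X. (\<And>A. A \<in> subgroup_lie_algebra G c T \<Longrightarrow> B X A = 0) \<Longrightarrow> \<alpha> X = 0"
  shows "\<exists>z. moment_map G c \<rho> z = \<alpha>"
proof -
  have tor: "torus_in G T" "T \<subseteq> carrier G"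
    using T subgroup.subset by (auto simp: maximal_torus_def torus_in_def)
  obtain \<Phi> :: "'w \<Rightarrow> 'v \<Rightarrow> complex" where \<Phi>: "range \<Phi> \<subseteq> polynomial_functions" "inj \<Phi>"
    "\<And>v w z. \<Phi> (v + w) z = \<Phi> v z + \<Phi> w z" "\<And>a w z. \<Phi> (a *\<^sub>C w) z = a * \<Phi> w z"
    "\<And>g w z. g \<in> carrier G \<Longrightarrow> \<Phi> (\<sigma> g w) z = \<Phi> w (\<rho> (inv g) z)"
    using occ unfolding occurs_in_polynomials_def by blast
  obtain v where v: "v \<noteq> 0" "\<And>h. h \<in> T \<Longrightarrow> \<sigma> h v = \<mu> h *\<^sub>C v"
    "\<And>\<theta> X. \<theta> \<in> P \<Longrightarrow> X \<in> root_space G c T \<theta> \<Longrightarrow> complexified_derived_rep G c \<sigma> X v = 0"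
    using hw unfolding highest_weight_def by blast
  have \<Phi>0: "\<Phi> 0 z = 0" for z using \<Phi>(3)[of 0 0 z] by simp
  have "\<Phi> v \<noteq> \<Phi> 0" using \<Phi>(2) v(1) by (auto dest: injD)
  then obtain z1 where z1: "\<Phi> v z1 \<noteq> 0" using \<Phi>0 by (metis ext)
  have poly: "\<Phi> v \<in> polynomial_functions" using \<Phi>(1) by blast
  obtain z where z: "\<Phi> v z \<noteq> 0"
    "\<And>w. (norm (\<Phi> v w))\<^sup>2 * exp (- (norm w)\<^sup>2) \<le> (norm (\<Phi> v z))\<^sup>2 * exp (- (norm z)\<^sup>2)"
    using gaussian_weighted_maximum[OF poly z1] by blast
  obtain D where D: "(\<Phi> v has_derivative D) (at z)" "clinear_form D"
    using polynomial_function_derivative[OF poly] by blast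
  have crit: "D w = cinner w z * \<Phi> v z" for w
    by (rule gaussian_critical_point[OF D z(2)])
  define m where "m A = cinner (derived_rep G c \<rho> A z) z" for A
  have deriv: "((\<lambda>s. \<Phi> (\<sigma> (lie_exp G c (s *\<^sub>R A)) v) z) has_vector_derivative - (m A * \<Phi> v z)) (at 0)" for A
    using highest_weight_polynomial_derivative[OF \<rho> \<Phi>(5) D(1), of A] by (simp add: crit m_def)
  have moment: "moment_map G c \<rho> z A = - Im (m A)" for A
    using arg_cong[OF cinner_commute[of z "derived_rep G c \<rho> A z"], of Im]
    by (simp add: moment_map_def omega_def m_def)
  have m_re: "Re (m A) = 0" for A unfolding m_def by (rule derived_rep_skew[OF \<rho>])
  define \<xi> where "\<xi> A = moment_map G c \<rho> z A - \<alpha> A" for A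
  have "linear \<xi>"
    unfolding \<xi>_def by (intro linear_compose_sub linear_moment_map[OF \<rho>] \<alpha>)
  have torus: "\<xi> A = 0" if A: "A \<in> subgroup_lie_algebra G c T" for A
  proof -
    have "\<Phi> (\<sigma> (lie_exp G c (s *\<^sub>R A)) v) z = \<mu> (lie_exp G c (s *\<^sub>R A)) * \<Phi> v z" for s
      using A v(2) by (simp add: subgroup_lie_algebra_def \<Phi>(4))
    with deriv[of A] have "((\<lambda>s. \<mu> (lie_exp G c (s *\<^sub>R A)) * \<Phi> v z) has_vector_derivative - (m A * \<Phi> v z)) (at 0)"
      by simp
    from has_vector_derivative_mult_left[OF this, of "inverse (\<Phi> v z)"]
    have "((\<lambda>s. \<mu> (lie_exp G c (s *\<^sub>R A))) has_vector_derivative - m A) (at 0)"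
      using z(1) by (simp add: mult.assoc)
    then have "weight_differential G c \<mu> A = - m A"
      unfolding weight_differential_def by (rule vector_derivative_at)
    then have "- m A = \<i> * complex_of_real (\<alpha> A)" using \<alpha>_torus[OF A] by simp
    from arg_cong[OF this, of Im] show ?thesis by (simp add: \<xi>_def moment)
  qed
  have pos: "moment_map G c \<rho> z (fst X) = 0 \<and> moment_map G c \<rho> z (snd X) = 0"
    if \<theta>: "\<theta> \<in> P" and X: "X \<in> root_space G c T \<theta>" for \<theta> X
  proof -
    have blin: "bounded_linear (\<lambda>w. \<Phi> w z)"
    proof (intro linear_imp_bounded_linear linearI)
      show "\<Phi> (r *\<^sub>R w) z = r *\<^sub>R \<Phi> w z" for r w
        using \<Phi>(4)[of "complex_of_real r" w z] by (simp add: scaleC_of_real scaleR_conv_of_real)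
    qed (rule \<Phi>(3))
    have d: "\<Phi> (derived_rep G c \<sigma> A v) z = - (m A * \<Phi> v z)" for A
      using vector_derivative_unique_at[OF bounded_linear.has_vector_derivative[OF blin derived_rep_has_vector_derivative[OF \<sigma>]] deriv] .
    have "0 = \<Phi> (derived_rep G c \<sigma> (fst X) v + \<i> *\<^sub>C derived_rep G c \<sigma> (snd X) v) z"
      using v(3)[OF \<theta> X] \<Phi>0 by (simp add: complexified_derived_rep_def)
    also have "\<dots> = - ((m (fst X) + \<i> * m (snd X)) * \<Phi> v z)"
      by (simp add: \<Phi>(3,4) d algebra_simps)
    finally have "m (fst X) + \<i> * m (snd X) = 0" using z(1) by simp
    then show ?thesis
      using m_re[of "fst X"] m_re[of "snd X"] by (simp add: moment complex_eq_iff)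
  qed
  have root: "\<xi> (fst X) = 0 \<and> \<xi> (snd X) = 0"
    if \<theta>: "\<theta> \<in> roots G c T" and X: "X \<in> root_space G c T \<theta>" for \<theta> X
  proof -
    have "\<alpha> (fst X) = 0" "\<alpha> (snd X) = 0"
      using root_space_orthogonal_torus[OF tor(1) B \<theta> X] by (auto intro: \<alpha>_orth)
    moreover have "moment_map G c \<rho> z (fst X) = 0 \<and> moment_map G c \<rho> z (snd X) = 0"
    proof (cases "\<theta> \<in> P")
      case True
      then show ?thesis using pos X by blast
    next
      case False
      then have "restrict (\<lambda>h. inverse (\<theta> h)) T \<in> P"
        using P \<theta> by (auto simp: positive_system_def)
      from pos[OF this root_space_conjugate[OF B tor(2) X]]
      show ?thesis using linear_neg[OF linear_moment_map[OF \<rho>]] by simp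
    qed
    ultimately show ?thesis by (simp add: \<xi>_def)
  qed
  have "\<xi> A = 0" for A
    by (rule functional_eq_0_if_vanishing_on_root_decomposition[OF T B \<open>linear \<xi>\<close> torus root])
  then have "moment_map G c \<rho> z = \<alpha>" by (auto simp: \<xi>_def)
  then show ?thesis by blast
qed

end

theorem theorem4:
  fixes K :: "('k::t2_space, 'm) monoid_scheme"
    and atlas :: "('k, 'e::finite_dim_inner) chart set"
    and c :: "('k, 'e) chart"
    and \<rho> :: "'k \<Rightarrow> 'v::hermitian_space \<Rightarrow> 'v"
    and \<sigma> :: "'k \<Rightarrow> 'w::hermitian_space \<Rightarrow> 'w"
    and T :: "'k set" and P :: "('k \<Rightarrow> complex) set"
    and B :: "'e \<Rightarrow> 'e \<Rightarrow> real"
    and \<O> :: "('e \<Rightarrow> real) set"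
  assumes "lie_group K atlas" and "compact (carrier K)" and "connected (carrier K)"
    and "c \<in> atlas" and "\<one>\<^bsub>K\<^esub> \<in> fst c"
    and "unitary_rep K \<rho>" and "gelfand_pair K \<rho>"
    and "maximal_torus K T" and "positive_system K c T P" and "Ad_invariant_inner K c B"
    and "irreducible_unitary_rep K \<sigma>" and "occurs_in_polynomials K \<rho> \<sigma>"
    and "orbit_corresponds K c T P B \<sigma> \<O>"
  shows "\<O> \<subseteq> range (moment_map K c \<rho>)"
proof -
  interpret lie_group K atlas by fact
  interpret compact_lie_group_chart K atlas c
    using assms(2,4,5) by unfold_locales
  obtain \<mu> \<alpha> where \<alpha>: "highest_weight K c T P \<sigma> \<mu>" "linear \<alpha>"
    "\<forall>A\<in>subgroup_lie_algebra K c T. weight_differential K c \<mu> A = \<i> * complex_of_real (\<alpha> A)"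
    "\<forall>X. (\<forall>A\<in>subgroup_lie_algebra K c T. B X A = 0) \<longrightarrow> \<alpha> X = 0"
    and \<O>: "\<O> = coadjoint_orbit K c \<alpha>"
    using assms(13) unfolding orbit_corresponds_def by blast
  have "unitary_rep K \<sigma>" using assms(11) by (simp add: irreducible_unitary_rep_def)
  then have "\<exists>z. moment_map K c \<rho> z = \<alpha>"
    using highest_weight_in_moment_image[OF assms(6) _ assms(12,8,9,10) \<alpha>(1,2)] \<alpha>(3,4) by blast
  then show ?thesis unfolding \<O> using orbit_subset_moment_image[OF assms(6)] by blast
qed

end
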